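(* The pair formed by the function associating $Q_{\mathcal{B}}$ to every decorated bicategory $\mathcal{B}$ and the free double functor $Q_G$ to every decorated pseudofunctor $G$ is a functor from $\mathbf{bCat}^*$ to $\mathbf{gCat}$.
   Context: Double categories. A double category $C$ (possibly weak in the horizontal direction) consists of a category $C_0$ (objects and vertical morphisms), a category $C_1$ (horizontal morphisms and squares; composition in $C_1$ is vertical composition, written $\bullet$), functors $s,t:C_1\to C_0$ (left and right edge), a horizontal identity functor $i:C_0\to C_1$ (its value on a vertical morphism $f$ is the square $i_f$), a horizontal composition functor $*:C_1\times_{C_0}C_1\to C_1$ (the composite of $\Phi$ followed on its right by $\Psi$ is written $\Psi*\Phi$), and invertible globular associator and left/right unitor natural transformations satisfying the usual coherence axioms. A square is globular if its left and right edges are identity vertical morphisms. $HC$ denotes the horizontal bicategory of $C$: 0-cells, 1-cells, 2-cells are the objects, horizontal morphisms, globular squares of $C$. A double functor $F:C\to C'$ is a pair of functors $F_0:C_0\to C_0'$, $F_1:C_1\to C_1'$ commuting with $s,t$ and compatible with $i$ and $*$ up to specified coherent invertible globular squares (its coherence data). Decorated bicategories. A decorated bicategory $\mathcal{B}$ is a bicategory (also written $\mathcal{B}$) together with a category $\mathcal{B}^*$ (the decoration) whose objects are the 0-cells of $\mathcal{B}$. A decorated pseudofunctor $G:\mathcal{B}\to\mathcal{B}'$ is a pseudofunctor together with a functor $G^*:\mathcal{B}^*\to\mathcal{B}'^*$ agreeing with it on 0-cells. $C$ is globularly generated if every square of $C$ can be obtained by vertical and horizontal compositions from globular squares and squares $i_f$.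 $\mathbf{bCat}^*$ is the category of decorated bicategories and decorated pseudofunctors; $\mathbf{gCat}$ is the category of globularly generated double categories and double functors. The free globularly generated double category $Q_{\mathcal{B}}$. Let $\mathbb{G}$ be the collection of formal squares of two kinds: for every 2-cell $\varphi:\alpha\Rightarrow\beta$ of $\mathcal{B}$ with $\alpha,\beta:a\to b$, a square $\varphi$ with top $\alpha$, bottom $\beta$, left edge $id_a$, right edge $id_b$; and for every morphism $f:a\to b$ of $\mathcal{B}^*$, a square $i_f$ with top the identity 1-cell $i_a$, bottom $i_b$, left and right edges $f$. The squares $i_{id_a}$ and $id_{i_a}$ are regarded as equal. Form all formal expressions obtained from $\mathbb{G}$ by formal vertical composition $\Psi\bullet\Phi$ (when the bottom of $\Phi$ equals the top of $\Psi$; left and right edges compose in $\mathcal{B}^*$) and formal parenthesized horizontal composition $\Psi*\Phi$ (when the right edge of $\Phi$ equals the left edge of $\Psi$; tops and bottoms compose as 1-cells of $\mathcal{B}$). Then $Q_{\mathcal{B}}$ has $\mathcal{B}^*$ as category of objects, the 1-cells of $\mathcal{B}$ (with their composition and identities) as horizontal morphisms, and as squares the expressions modulo the smallest equivalence relation compatible with $\bullet$ and $*$ such that: $\bullet$ is associative and the identity 2-cell $id_\alpha$ is a vertical identity at $\alpha$; (1) $(\Psi_2\bullet\Psi_1)*(\Phi_2\bullet\Phi_1)\sim(\Psi_2*\Phi_2)\bullet(\Psi_1*\Phi_1)$ whenever both sides make sense; (2) for vertically composable 2-cells of $\mathcal{B}$ the formal composite $\psi\bullet\varphi$ is identified with their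 vertical composite in $\mathcal{B}$, and $i_g\bullet i_f\sim i_{gf}$ for composable $f,g$ in $\mathcal{B}^*$; (3) for horizontally composable 2-cells of $\mathcal{B}$ the formal composite $\psi*\varphi$ is identified with their horizontal composite in $\mathcal{B}$; (4) the left and right unitors of $\mathcal{B}$ are natural with respect to all squares; (5) the associators of $\mathcal{B}$ are natural with respect to all squares. Horizontal identities are the $i_f$; associators and unitors are those of $\mathcal{B}$. The free double functor $Q_G:Q_{\mathcal{B}}\to Q_{\mathcal{B}'}$ of a decorated pseudofunctor $G:\mathcal{B}\to\mathcal{B}'$ is the double functor consisting of $G^*:\mathcal{B}^*\to\mathcal{B}'^*$ on objects and vertical morphisms and of the functor on categories of squares which equals $G$ on 1-cells, is given on generators by $\varphi\mapsto G\varphi$ for 2-cells $\varphi$ of $\mathcal{B}$ and $i_f\mapsto i_{G^*f}$ for morphisms $f$ of $\mathcal{B}^*$, and is extended recursively to all expressions compatibly with vertical and horizontal composition (the coherence data of $G$ serving as coherence data of $Q_G$).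
   Formalization: For a pseudofunctor G with unit comparisons u_a from i_{Ga} to G(i_a), the square i_{G*f} need not have the edges G(i_a), G(i_b) that Q_G requires; so Q_G sends i_f (f from a to b) to u_b • i_{G*f} • u_a^{-1}, which is i_{G*f} when G is strictly unital. *)

theory Defs
  imports "HOL-Library.FuncSet"
begin

section \<open>Categories and functors\<close>

text \<open>
  All structures are records with explicit carriers, as in HOL-Algebra.  Composition is written
  in applicative order: in \<open>g \<cdot>\<^bsub>C\<^esub> f\<close> the arrow \<open>f\<close> comes first.  Structures may take
  arbitrary values outside their carriers.  Structure maps between them (double functors and
  pseudofunctors) are required to be extensional, so that equality of records is equality of maps.
\<close>

record ('o, 'a) cat =
  Ob :: "'o set"
  Ar :: "'a set"
  Dom :: "'a \<Rightarrow> 'o"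
  Cod :: "'a \<Rightarrow> 'o"
  Id :: "'o \<Rightarrow> 'a"
  Comp :: "'a \<Rightarrow> 'a \<Rightarrow> 'a"  (infixr "\<cdot>\<index>" 70)

locale category =
  fixes C :: "('o, 'a) cat" (structure)
  assumes dom_ob: "f \<in> Ar C \<Longrightarrow> Dom C f \<in> Ob C"
    and cod_ob: "f \<in> Ar C \<Longrightarrow> Cod C f \<in> Ob C"
    and id_ar: "a \<in> Ob C \<Longrightarrow> Id C a \<in> Ar C"
    and dom_id: "a \<in> Ob C \<Longrightarrow> Dom C (Id C a) = a"
    and cod_id: "a \<in> Ob C \<Longrightarrow> Cod C (Id C a) = a"
    and comp_ar: "\<lbrakk>f \<in> Ar C; g \<in> Ar C; Cod C f = Dom C g\<rbrakk> \<Longrightarrow> g \<cdot> f \<in> Ar C"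
    and dom_comp: "\<lbrakk>f \<in> Ar C; g \<in> Ar C; Cod C f = Dom C g\<rbrakk> \<Longrightarrow> Dom C (g \<cdot> f) = Dom C f"
    and cod_comp: "\<lbrakk>f \<in> Ar C; g \<in> Ar C; Cod C f = Dom C g\<rbrakk> \<Longrightarrow> Cod C (g \<cdot> f) = Cod C g"
    and comp_id_left: "f \<in> Ar C \<Longrightarrow> Id C (Cod C f) \<cdot> f = f"
    and comp_id_right: "f \<in> Ar C \<Longrightarrow> f \<cdot> Id C (Dom C f) = f"
    and comp_assoc: "\<lbrakk>f \<in> Ar C; g \<in> Ar C; h \<in> Ar C; Cod C f = Dom C g; Cod C g = Dom C h\<rbrakk>
           \<Longrightarrow> (h \<cdot> g) \<cdot> f = h \<cdot> (g \<cdot> f)"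

definition inverse_arrows :: "('o, 'a) cat \<Rightarrow> 'a \<Rightarrow> 'a \<Rightarrow> bool" where
  "inverse_arrows C f g \<longleftrightarrow> f \<in> Ar C \<and> g \<in> Ar C \<and> Dom C g = Cod C f \<and> Cod C g = Dom C f
     \<and> g \<cdot>\<^bsub>C\<^esub> f = Id C (Dom C f) \<and> f \<cdot>\<^bsub>C\<^esub> g = Id C (Cod C f)"

definition invertible :: "('o, 'a) cat \<Rightarrow> 'a \<Rightarrow> bool" where
  "invertible C f \<longleftrightarrow> (\<exists>g. inverse_arrows C f g)"

definition inv_ar :: "('o, 'a) cat \<Rightarrow> 'a \<Rightarrow> 'a" where
  "inv_ar C f = (THE g. inverse_arrows C f g)"

record ('o, 'a, 'p, 'b) ftor =
  FOb :: "'o \<Rightarrow> 'p"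
  FAr :: "'a \<Rightarrow> 'b"

locale is_functor = A: category A + B: category B
  for A :: "('o, 'a) cat" and B :: "('p, 'b) cat" +
  fixes F :: "('o, 'a, 'p, 'b) ftor"
  assumes ob: "a \<in> Ob A \<Longrightarrow> FOb F a \<in> Ob B"
    and ar: "f \<in> Ar A \<Longrightarrow> FAr F f \<in> Ar B"
    and dom: "f \<in> Ar A \<Longrightarrow> Dom B (FAr F f) = FOb F (Dom A f)"
    and cod: "f \<in> Ar A \<Longrightarrow> Cod B (FAr F f) = FOb F (Cod A f)"
    and pres_id: "a \<in> Ob A \<Longrightarrow> FAr F (Id A a) = Id B (FOb F a)"
    and pres_comp: "\<lbrakk>f \<in> Ar A; g \<in> Ar A; Cod A f = Dom A g\<rbrakk>
           \<Longrightarrow> FAr F (g \<cdot>\<^bsub>A\<^esub> f) = FAr F g \<cdot>\<^bsub>B\<^esub> FAr F f"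

definition ext_ftor :: "('o, 'a) cat \<Rightarrow> ('o, 'a, 'p, 'b) ftor \<Rightarrow> bool" where
  "ext_ftor A F \<longleftrightarrow> FOb F \<in> extensional (Ob A) \<and> FAr F \<in> extensional (Ar A)"

definition ftor_id :: "('o, 'a) cat \<Rightarrow> ('o, 'a, 'o, 'a) ftor" where
  "ftor_id A = \<lparr>FOb = (\<lambda>a\<in>Ob A. a), FAr = (\<lambda>f\<in>Ar A. f)\<rparr>"

definition ftor_comp ::
  "('o, 'a) cat \<Rightarrow> ('p, 'b, 'q, 'c) ftor \<Rightarrow> ('o, 'a, 'p, 'b) ftor \<Rightarrow> ('o, 'a, 'q, 'c) ftor" where
  "ftor_comp A G F = \<lparr>FOb = compose (Ob A) (FOb G) (FOb F), FAr = compose (Ar A) (FAr G) (FAr F)\<rparr>"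


section \<open>Double categories\<close>

text \<open>
  \<open>SrcF\<close>, \<open>TrgF\<close> and \<open>IdF\<close> are the functors \<open>s\<close>, \<open>t\<close> and \<open>i\<close>.
\<close>

record ('o, 'v, 'h, 's) dblcat =
  C0 :: "('o, 'v) cat"
  C1 :: "('h, 's) cat"
  SrcF :: "('h, 's, 'o, 'v) ftor"
  TrgF :: "('h, 's, 'o, 'v) ftor"
  IdF :: "('o, 'v, 'h, 's) ftor"
  HorF :: "('h \<times> 'h, 's \<times> 's, 'h, 's) ftor"
  Asc :: "'h \<Rightarrow> 'h \<Rightarrow> 'h \<Rightarrow> 's"
  LUn :: "'h \<Rightarrow> 's"
  RUn :: "'h \<Rightarrow> 's"

definition hmor :: "('o, 'v, 'h, 's) dblcat \<Rightarrow> 'h \<Rightarrow> 'h \<Rightarrow> 'h"  (infixr "\<odot>\<index>" 75) where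
  "\<beta> \<odot>\<^bsub>D\<^esub> \<alpha> = FOb (HorF D) (\<beta>, \<alpha>)"

definition hsq :: "('o, 'v, 'h, 's) dblcat \<Rightarrow> 's \<Rightarrow> 's \<Rightarrow> 's"  (infixr "\<ast>\<index>" 75) where
  "\<Psi> \<ast>\<^bsub>D\<^esub> \<Phi> = FAr (HorF D) (\<Psi>, \<Phi>)"

definition vsq :: "('o, 'v, 'h, 's) dblcat \<Rightarrow> 's \<Rightarrow> 's \<Rightarrow> 's"  (infixr "\<bullet>\<index>" 70) where
  "\<Psi> \<bullet>\<^bsub>D\<^esub> \<Phi> = Comp (C1 D) \<Psi> \<Phi>"

text \<open>
  The pullback \<open>C\<^sub>1 \<times>\<^bsub>C\<^sub>0\<^esub> C\<^sub>1\<close>; a pair \<open>(\<Psi>, \<Phi>)\<close> has \<open>\<Phi>\<close> on the left of \<open>\<Psi>\<close>.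
\<close>

definition pullback :: "('o, 'v, 'h, 's) dblcat \<Rightarrow> ('h \<times> 'h, 's \<times> 's) cat" where
  "pullback D =
    \<lparr>Ob = {(\<beta>, \<alpha>). \<beta> \<in> Ob (C1 D) \<and> \<alpha> \<in> Ob (C1 D) \<and> FOb (TrgF D) \<alpha> = FOb (SrcF D) \<beta>},
     Ar = {(\<Psi>, \<Phi>). \<Psi> \<in> Ar (C1 D) \<and> \<Phi> \<in> Ar (C1 D) \<and> FAr (TrgF D) \<Phi> = FAr (SrcF D) \<Psi>},
     Dom = map_prod (Dom (C1 D)) (Dom (C1 D)),
     Cod = map_prod (Cod (C1 D)) (Cod (C1 D)),
     Id = map_prod (Id (C1 D)) (Id (C1 D)),
     Comp = (\<lambda>(\<Psi>', \<Phi>') (\<Psi>, \<Phi>). (\<Psi>' \<bullet>\<^bsub>D\<^esub> \<Psi>, \<Phi>' \<bullet>\<^bsub>D\<^esub> \<Phi>))\<rparr>"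

definition globular :: "('o, 'v, 'h, 's) dblcat \<Rightarrow> 's \<Rightarrow> bool" where
  "globular D \<Phi> \<longleftrightarrow> \<Phi> \<in> Ar (C1 D)
     \<and> (\<exists>a \<in> Ob (C0 D). FAr (SrcF D) \<Phi> = Id (C0 D) a)
     \<and> (\<exists>b \<in> Ob (C0 D). FAr (TrgF D) \<Phi> = Id (C0 D) b)"

definition globular_iso :: "('o, 'v, 'h, 's) dblcat \<Rightarrow> 's \<Rightarrow> 'h \<Rightarrow> 'h \<Rightarrow> bool" where
  "globular_iso D \<Phi> \<alpha> \<beta> \<longleftrightarrow> globular D \<Phi> \<and> invertible (C1 D) \<Phi>
     \<and> Dom (C1 D) \<Phi> = \<alpha> \<and> Cod (C1 D) \<Phi> = \<beta>"

locale double_category =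
  fixes D :: "('o, 'v, 'h, 's) dblcat" (structure)
  assumes src_functor: "is_functor (C1 D) (C0 D) (SrcF D)"
    and trg_functor: "is_functor (C1 D) (C0 D) (TrgF D)"
    and id_functor: "is_functor (C0 D) (C1 D) (IdF D)"
    and hor_functor: "is_functor (pullback D) (C1 D) (HorF D)"
    and src_id: "a \<in> Ob (C0 D) \<Longrightarrow> FOb (SrcF D) (FOb (IdF D) a) = a"
    and trg_id: "a \<in> Ob (C0 D) \<Longrightarrow> FOb (TrgF D) (FOb (IdF D) a) = a"
    and src_id_ar: "f \<in> Ar (C0 D) \<Longrightarrow> FAr (SrcF D) (FAr (IdF D) f) = f"
    and trg_id_ar: "f \<in> Ar (C0 D) \<Longrightarrow> FAr (TrgF D) (FAr (IdF D) f) = f"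
    and src_hor: "(\<beta>, \<alpha>) \<in> Ob (pullback D) \<Longrightarrow> FOb (SrcF D) (\<beta> \<odot> \<alpha>) = FOb (SrcF D) \<alpha>"
    and trg_hor: "(\<beta>, \<alpha>) \<in> Ob (pullback D) \<Longrightarrow> FOb (TrgF D) (\<beta> \<odot> \<alpha>) = FOb (TrgF D) \<beta>"
    and src_hor_ar: "(\<Psi>, \<Phi>) \<in> Ar (pullback D) \<Longrightarrow> FAr (SrcF D) (\<Psi> \<ast> \<Phi>) = FAr (SrcF D) \<Phi>"
    and trg_hor_ar: "(\<Psi>, \<Phi>) \<in> Ar (pullback D) \<Longrightarrow> FAr (TrgF D) (\<Psi> \<ast> \<Phi>) = FAr (TrgF D) \<Psi>"
    and asc_iso: "\<lbrakk>(\<gamma>, \<beta>) \<in> Ob (pullback D); (\<beta>, \<alpha>) \<in> Ob (pullback D)\<rbrakk>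
           \<Longrightarrow> globular_iso D (Asc D \<gamma> \<beta> \<alpha>) ((\<gamma> \<odot> \<beta>) \<odot> \<alpha>) (\<gamma> \<odot> (\<beta> \<odot> \<alpha>))"
    and asc_natural: "\<lbrakk>(\<Theta>, \<Psi>) \<in> Ar (pullback D); (\<Psi>, \<Phi>) \<in> Ar (pullback D)\<rbrakk>
           \<Longrightarrow> Asc D (Cod (C1 D) \<Theta>) (Cod (C1 D) \<Psi>) (Cod (C1 D) \<Phi>) \<bullet> ((\<Theta> \<ast> \<Psi>) \<ast> \<Phi>)
             = (\<Theta> \<ast> (\<Psi> \<ast> \<Phi>)) \<bullet> Asc D (Dom (C1 D) \<Theta>) (Dom (C1 D) \<Psi>) (Dom (C1 D) \<Phi>)"
    and lun_iso: "\<alpha> \<in> Ob (C1 D)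
           \<Longrightarrow> globular_iso D (LUn D \<alpha>) (FOb (IdF D) (FOb (TrgF D) \<alpha>) \<odot> \<alpha>) \<alpha>"
    and lun_natural: "\<Phi> \<in> Ar (C1 D)
           \<Longrightarrow> LUn D (Cod (C1 D) \<Phi>) \<bullet> (FAr (IdF D) (FAr (TrgF D) \<Phi>) \<ast> \<Phi>)
             = \<Phi> \<bullet> LUn D (Dom (C1 D) \<Phi>)"
    and run_iso: "\<alpha> \<in> Ob (C1 D)
           \<Longrightarrow> globular_iso D (RUn D \<alpha>) (\<alpha> \<odot> FOb (IdF D) (FOb (SrcF D) \<alpha>)) \<alpha>"
    and run_natural: "\<Phi> \<in> Ar (C1 D)
           \<Longrightarrow> RUn D (Cod (C1 D) \<Phi>) \<bullet> (\<Phi> \<ast> FAr (IdF D) (FAr (SrcF D) \<Phi>))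
             = \<Phi> \<bullet> RUn D (Dom (C1 D) \<Phi>)"
    and pentagon: "\<lbrakk>(\<delta>, \<gamma>) \<in> Ob (pullback D); (\<gamma>, \<beta>) \<in> Ob (pullback D); (\<beta>, \<alpha>) \<in> Ob (pullback D)\<rbrakk>
           \<Longrightarrow> Asc D \<delta> \<gamma> (\<beta> \<odot> \<alpha>) \<bullet> Asc D (\<delta> \<odot> \<gamma>) \<beta> \<alpha>
             = (Id (C1 D) \<delta> \<ast> Asc D \<gamma> \<beta> \<alpha>) \<bullet> (Asc D \<delta> (\<gamma> \<odot> \<beta>) \<alpha> \<bullet> (Asc D \<delta> \<gamma> \<beta> \<ast> Id (C1 D) \<alpha>))"
    and triangle: "(\<beta>, \<alpha>) \<in> Ob (pullback D)
           \<Longrightarrow> (Id (C1 D) \<beta> \<ast> LUn D \<alpha>) \<bullet> Asc D \<beta> (FOb (IdF D) (FOb (TrgF D) \<alpha>)) \<alpha>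
             = RUn D \<beta> \<ast> Id (C1 D) \<alpha>"

inductive_set generated_squares :: "('o, 'v, 'h, 's) dblcat \<Rightarrow> 's set"
  for D :: "('o, 'v, 'h, 's) dblcat" where
  glob: "globular D \<Phi> \<Longrightarrow> \<Phi> \<in> generated_squares D"
| hid: "f \<in> Ar (C0 D) \<Longrightarrow> FAr (IdF D) f \<in> generated_squares D"
| vert: "\<lbrakk>\<Psi> \<in> generated_squares D; \<Phi> \<in> generated_squares D; Cod (C1 D) \<Phi> = Dom (C1 D) \<Psi>\<rbrakk>
    \<Longrightarrow> \<Psi> \<bullet>\<^bsub>D\<^esub> \<Phi> \<in> generated_squares D"
| hor: "\<lbrakk>\<Psi> \<in> generated_squares D; \<Phi> \<in> generated_squares D; FAr (TrgF D) \<Phi> = FAr (SrcF D) \<Psi>\<rbrakk>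
    \<Longrightarrow> \<Psi> \<ast>\<^bsub>D\<^esub> \<Phi> \<in> generated_squares D"

definition globularly_generated :: "('o, 'v, 'h, 's) dblcat \<Rightarrow> bool" where
  "globularly_generated D \<longleftrightarrow> Ar (C1 D) \<subseteq> generated_squares D"


section \<open>Double functors\<close>

text \<open>
  Double functors are pseudo: \<open>DComp F (\<beta>, \<alpha>)\<close> is the comparison square from
  \<open>F \<beta> \<odot> F \<alpha>\<close> to \<open>F (\<beta> \<odot> \<alpha>)\<close>, and \<open>DUnit F a\<close> the one from \<open>i (F a)\<close> to \<open>F (i a)\<close>.
\<close>

record ('o, 'v, 'h, 's, 'p, 'w, 'k, 'r) dblfun =
  F0 :: "('o, 'v, 'p, 'w) ftor"
  F1 :: "('h, 's, 'k, 'r) ftor"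
  DComp :: "'h \<times> 'h \<Rightarrow> 'r"
  DUnit :: "'o \<Rightarrow> 'r"

locale double_functor = D: double_category D + E: double_category E
  for D :: "('o, 'v, 'h, 's) dblcat" and E :: "('p, 'w, 'k, 'r) dblcat" +
  fixes F :: "('o, 'v, 'h, 's, 'p, 'w, 'k, 'r) dblfun"
  assumes functor0: "is_functor (C0 D) (C0 E) (F0 F)"
    and functor1: "is_functor (C1 D) (C1 E) (F1 F)"
    and ext0: "ext_ftor (C0 D) (F0 F)"
    and ext1: "ext_ftor (C1 D) (F1 F)"
    and ext_comp: "DComp F \<in> extensional (Ob (pullback D))"
    and ext_unit: "DUnit F \<in> extensional (Ob (C0 D))"
    and src: "\<alpha> \<in> Ob (C1 D) \<Longrightarrow> FOb (SrcF E) (FOb (F1 F) \<alpha>) = FOb (F0 F) (FOb (SrcF D) \<alpha>)"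
    and trg: "\<alpha> \<in> Ob (C1 D) \<Longrightarrow> FOb (TrgF E) (FOb (F1 F) \<alpha>) = FOb (F0 F) (FOb (TrgF D) \<alpha>)"
    and src_ar: "\<Phi> \<in> Ar (C1 D) \<Longrightarrow> FAr (SrcF E) (FAr (F1 F) \<Phi>) = FAr (F0 F) (FAr (SrcF D) \<Phi>)"
    and trg_ar: "\<Phi> \<in> Ar (C1 D) \<Longrightarrow> FAr (TrgF E) (FAr (F1 F) \<Phi>) = FAr (F0 F) (FAr (TrgF D) \<Phi>)"
    and comp_iso: "(\<beta>, \<alpha>) \<in> Ob (pullback D) \<Longrightarrow>
           globular_iso E (DComp F (\<beta>, \<alpha>)) (FOb (F1 F) \<beta> \<odot>\<^bsub>E\<^esub> FOb (F1 F) \<alpha>) (FOb (F1 F) (\<beta> \<odot>\<^bsub>D\<^esub> \<alpha>))"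
    and comp_natural: "(\<Psi>, \<Phi>) \<in> Ar (pullback D) \<Longrightarrow>
           DComp F (Cod (C1 D) \<Psi>, Cod (C1 D) \<Phi>) \<bullet>\<^bsub>E\<^esub> (FAr (F1 F) \<Psi> \<ast>\<^bsub>E\<^esub> FAr (F1 F) \<Phi>)
           = FAr (F1 F) (\<Psi> \<ast>\<^bsub>D\<^esub> \<Phi>) \<bullet>\<^bsub>E\<^esub> DComp F (Dom (C1 D) \<Psi>, Dom (C1 D) \<Phi>)"
    and unit_iso: "a \<in> Ob (C0 D) \<Longrightarrow>
           globular_iso E (DUnit F a) (FOb (IdF E) (FOb (F0 F) a)) (FOb (F1 F) (FOb (IdF D) a))"
    and unit_natural: "f \<in> Ar (C0 D) \<Longrightarrow>
           DUnit F (Cod (C0 D) f) \<bullet>\<^bsub>E\<^esub> FAr (IdF E) (FAr (F0 F) f)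
           = FAr (F1 F) (FAr (IdF D) f) \<bullet>\<^bsub>E\<^esub> DUnit F (Dom (C0 D) f)"
    and asc_coherence: "\<lbrakk>(\<gamma>, \<beta>) \<in> Ob (pullback D); (\<beta>, \<alpha>) \<in> Ob (pullback D)\<rbrakk> \<Longrightarrow>
           FAr (F1 F) (Asc D \<gamma> \<beta> \<alpha>) \<bullet>\<^bsub>E\<^esub>
             (DComp F (\<gamma> \<odot>\<^bsub>D\<^esub> \<beta>, \<alpha>) \<bullet>\<^bsub>E\<^esub> (DComp F (\<gamma>, \<beta>) \<ast>\<^bsub>E\<^esub> Id (C1 E) (FOb (F1 F) \<alpha>)))
           = DComp F (\<gamma>, \<beta> \<odot>\<^bsub>D\<^esub> \<alpha>) \<bullet>\<^bsub>E\<^esub>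
             ((Id (C1 E) (FOb (F1 F) \<gamma>) \<ast>\<^bsub>E\<^esub> DComp F (\<beta>, \<alpha>))
               \<bullet>\<^bsub>E\<^esub> Asc E (FOb (F1 F) \<gamma>) (FOb (F1 F) \<beta>) (FOb (F1 F) \<alpha>))"
    and lun_coherence: "\<lbrakk>\<alpha> \<in> Ob (C1 D); b = FOb (TrgF D) \<alpha>\<rbrakk> \<Longrightarrow>
           FAr (F1 F) (LUn D \<alpha>) \<bullet>\<^bsub>E\<^esub>
             (DComp F (FOb (IdF D) b, \<alpha>) \<bullet>\<^bsub>E\<^esub> (DUnit F b \<ast>\<^bsub>E\<^esub> Id (C1 E) (FOb (F1 F) \<alpha>)))
           = LUn E (FOb (F1 F) \<alpha>)"
    and run_coherence: "\<lbrakk>\<alpha> \<in> Ob (C1 D); a = FOb (SrcF D) \<alpha>\<rbrakk> \<Longrightarrow>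
           FAr (F1 F) (RUn D \<alpha>) \<bullet>\<^bsub>E\<^esub>
             (DComp F (\<alpha>, FOb (IdF D) a) \<bullet>\<^bsub>E\<^esub> (Id (C1 E) (FOb (F1 F) \<alpha>) \<ast>\<^bsub>E\<^esub> DUnit F a))
           = RUn E (FOb (F1 F) \<alpha>)"

definition dblfun_id ::
  "('o, 'v, 'h, 's) dblcat \<Rightarrow> ('o, 'v, 'h, 's, 'o, 'v, 'h, 's) dblfun" where
  "dblfun_id D =
    \<lparr>F0 = ftor_id (C0 D), F1 = ftor_id (C1 D),
     DComp = (\<lambda>(\<beta>, \<alpha>) \<in> Ob (pullback D). Id (C1 D) (\<beta> \<odot>\<^bsub>D\<^esub> \<alpha>)),
     DUnit = (\<lambda>a \<in> Ob (C0 D). Id (C1 D) (FOb (IdF D) a))\<rparr>"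

definition dblfun_comp ::
  "('o, 'v, 'h, 's) dblcat \<Rightarrow> ('p', 'w', 'k', 'r') dblcat
     \<Rightarrow> ('p, 'w, 'k, 'r, 'p', 'w', 'k', 'r') dblfun \<Rightarrow> ('o, 'v, 'h, 's, 'p, 'w, 'k, 'r) dblfun
     \<Rightarrow> ('o, 'v, 'h, 's, 'p', 'w', 'k', 'r') dblfun" where
  "dblfun_comp D E G F =
    \<lparr>F0 = ftor_comp (C0 D) (F0 G) (F0 F), F1 = ftor_comp (C1 D) (F1 G) (F1 F),
     DComp = (\<lambda>(\<beta>, \<alpha>) \<in> Ob (pullback D).
       FAr (F1 G) (DComp F (\<beta>, \<alpha>)) \<bullet>\<^bsub>E\<^esub> DComp G (FOb (F1 F) \<beta>, FOb (F1 F) \<alpha>)),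
     DUnit = (\<lambda>a \<in> Ob (C0 D). FAr (F1 G) (DUnit F a) \<bullet>\<^bsub>E\<^esub> DUnit G (FOb (F0 F) a))\<rparr>"

text \<open>
  The category \<open>gCat\<close>.  A morphism is a double functor together with its domain and codomain.
\<close>

type_synonym ('o, 'v, 'h, 's) gmor =
  "('o, 'v, 'h, 's) dblcat \<times> ('o, 'v, 'h, 's, 'o, 'v, 'h, 's) dblfun \<times> ('o, 'v, 'h, 's) dblcat"

definition gCat :: "(('o, 'v, 'h, 's) dblcat, ('o, 'v, 'h, 's) gmor) cat" where
  "gCat =
    \<lparr>Ob = {D. double_category D \<and> globularly_generated D},
     Ar = {(D, F, E). double_functor D E F \<and> globularly_generated D \<and> globularly_generated E},
     Dom = (\<lambda>(D, F, E). D),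
     Cod = (\<lambda>(D, F, E). E),
     Id = (\<lambda>D. (D, dblfun_id D, D)),
     Comp = (\<lambda>(D', G, E) (D, F, _). (D, dblfun_comp D E G F, E))\<rparr>"


section \<open>Decorated bicategories\<close>

text \<open>
  The hom-categories of a bicategory are given together, as the single category \<open>Cells B\<close> of all
  1-cells and 2-cells with vertical composition: \<open>\<B>(a, b)\<close> is its full subcategory on the 1-cells
  with source \<open>a\<close> and target \<open>b\<close>, and 2-cells exist only between parallel 1-cells.
  The composite of \<open>\<alpha> : a \<rightarrow> b\<close> and \<open>\<beta> : b \<rightarrow> c\<close> is \<open>\<beta> \<star>\<^bsub>B\<^esub> \<alpha>\<close>; that of 2-cells is \<open>\<psi> \<diamondop>\<^bsub>B\<^esub> \<phi>\<close>.
\<close>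

record ('o, 'h, 'c) bicat =
  Cell0 :: "'o set"
  Cells :: "('h, 'c) cat"
  Src :: "'h \<Rightarrow> 'o"
  Trg :: "'h \<Rightarrow> 'o"
  Unit :: "'o \<Rightarrow> 'h"
  HComp1 :: "'h \<Rightarrow> 'h \<Rightarrow> 'h"  (infixr "\<star>\<index>" 75)
  HComp2 :: "'c \<Rightarrow> 'c \<Rightarrow> 'c"  (infixr "\<diamondop>\<index>" 75)
  BAsc :: "'h \<Rightarrow> 'h \<Rightarrow> 'h \<Rightarrow> 'c"
  BLUn :: "'h \<Rightarrow> 'c"
  BRUn :: "'h \<Rightarrow> 'c"

definition hpairs :: "('o, 'h, 'c, 'x) bicat_scheme \<Rightarrow> ('h \<times> 'h) set" where
  "hpairs B = {(\<beta>, \<alpha>). \<beta> \<in> Ob (Cells B) \<and> \<alpha> \<in> Ob (Cells B) \<and> Trg B \<alpha> = Src B \<beta>}"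

definition hpairs2 :: "('o, 'h, 'c, 'x) bicat_scheme \<Rightarrow> ('c \<times> 'c) set" where
  "hpairs2 B = {(\<psi>, \<phi>). \<psi> \<in> Ar (Cells B) \<and> \<phi> \<in> Ar (Cells B)
     \<and> Trg B (Dom (Cells B) \<phi>) = Src B (Dom (Cells B) \<psi>)}"

definition cell_iso :: "('o, 'h, 'c, 'x) bicat_scheme \<Rightarrow> 'c \<Rightarrow> 'h \<Rightarrow> 'h \<Rightarrow> bool" where
  "cell_iso B \<phi> \<alpha> \<beta> \<longleftrightarrow> invertible (Cells B) \<phi> \<and> Dom (Cells B) \<phi> = \<alpha> \<and> Cod (Cells B) \<phi> = \<beta>"

definition vcell :: "('o, 'h, 'c, 'x) bicat_scheme \<Rightarrow> 'c \<Rightarrow> 'c \<Rightarrow> 'c"  (infixr "\<cdot>\<cdot>\<index>" 70) where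
  "\<psi> \<cdot>\<cdot>\<^bsub>B\<^esub> \<phi> = Comp (Cells B) \<psi> \<phi>"

locale bicategory =
  fixes B :: "('o, 'h, 'c, 'x) bicat_scheme" (structure)
  assumes cells: "category (Cells B)"
    and src_cell0: "\<alpha> \<in> Ob (Cells B) \<Longrightarrow> Src B \<alpha> \<in> Cell0 B"
    and trg_cell0: "\<alpha> \<in> Ob (Cells B) \<Longrightarrow> Trg B \<alpha> \<in> Cell0 B"
    and src_parallel: "\<phi> \<in> Ar (Cells B) \<Longrightarrow> Src B (Dom (Cells B) \<phi>) = Src B (Cod (Cells B) \<phi>)"
    and trg_parallel: "\<phi> \<in> Ar (Cells B) \<Longrightarrow> Trg B (Dom (Cells B) \<phi>) = Trg B (Cod (Cells B) \<phi>)"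
    and unit_cell: "a \<in> Cell0 B \<Longrightarrow> Unit B a \<in> Ob (Cells B)"
    and src_unit: "a \<in> Cell0 B \<Longrightarrow> Src B (Unit B a) = a"
    and trg_unit: "a \<in> Cell0 B \<Longrightarrow> Trg B (Unit B a) = a"
    and hcomp1_cell: "(\<beta>, \<alpha>) \<in> hpairs B \<Longrightarrow> \<beta> \<star> \<alpha> \<in> Ob (Cells B)"
    and src_hcomp1: "(\<beta>, \<alpha>) \<in> hpairs B \<Longrightarrow> Src B (\<beta> \<star> \<alpha>) = Src B \<alpha>"
    and trg_hcomp1: "(\<beta>, \<alpha>) \<in> hpairs B \<Longrightarrow> Trg B (\<beta> \<star> \<alpha>) = Trg B \<beta>"
    and hcomp2_cell: "(\<psi>, \<phi>) \<in> hpairs2 B \<Longrightarrow> \<psi> \<diamondop> \<phi> \<in> Ar (Cells B)"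
    and dom_hcomp2: "(\<psi>, \<phi>) \<in> hpairs2 B
           \<Longrightarrow> Dom (Cells B) (\<psi> \<diamondop> \<phi>) = Dom (Cells B) \<psi> \<star> Dom (Cells B) \<phi>"
    and cod_hcomp2: "(\<psi>, \<phi>) \<in> hpairs2 B
           \<Longrightarrow> Cod (Cells B) (\<psi> \<diamondop> \<phi>) = Cod (Cells B) \<psi> \<star> Cod (Cells B) \<phi>"
    and hcomp2_id: "(\<beta>, \<alpha>) \<in> hpairs B
           \<Longrightarrow> Id (Cells B) \<beta> \<diamondop> Id (Cells B) \<alpha> = Id (Cells B) (\<beta> \<star> \<alpha>)"
    and interchange: "\<lbrakk>(\<psi>', \<phi>') \<in> hpairs2 B; (\<psi>, \<phi>) \<in> hpairs2 B;
             Cod (Cells B) \<psi> = Dom (Cells B) \<psi>'; Cod (Cells B) \<phi> = Dom (Cells B) \<phi>'\<rbrakk>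
           \<Longrightarrow> (\<psi>' \<cdot>\<cdot> \<psi>) \<diamondop> (\<phi>' \<cdot>\<cdot> \<phi>) = (\<psi>' \<diamondop> \<phi>') \<cdot>\<cdot> (\<psi> \<diamondop> \<phi>)"
    and asc_iso: "\<lbrakk>(\<gamma>, \<beta>) \<in> hpairs B; (\<beta>, \<alpha>) \<in> hpairs B\<rbrakk>
           \<Longrightarrow> cell_iso B (BAsc B \<gamma> \<beta> \<alpha>) ((\<gamma> \<star> \<beta>) \<star> \<alpha>) (\<gamma> \<star> (\<beta> \<star> \<alpha>))"
    and asc_natural: "\<lbrakk>(\<theta>, \<psi>) \<in> hpairs2 B; (\<psi>, \<phi>) \<in> hpairs2 B\<rbrakk>
           \<Longrightarrow> BAsc B (Cod (Cells B) \<theta>) (Cod (Cells B) \<psi>) (Cod (Cells B) \<phi>) \<cdot>\<cdot> ((\<theta> \<diamondop> \<psi>) \<diamondop> \<phi>)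
             = (\<theta> \<diamondop> (\<psi> \<diamondop> \<phi>)) \<cdot>\<cdot> BAsc B (Dom (Cells B) \<theta>) (Dom (Cells B) \<psi>) (Dom (Cells B) \<phi>)"
    and lun_iso: "\<alpha> \<in> Ob (Cells B) \<Longrightarrow> cell_iso B (BLUn B \<alpha>) (Unit B (Trg B \<alpha>) \<star> \<alpha>) \<alpha>"
    and lun_natural: "\<lbrakk>\<phi> \<in> Ar (Cells B); b = Trg B (Dom (Cells B) \<phi>)\<rbrakk>
           \<Longrightarrow> BLUn B (Cod (Cells B) \<phi>) \<cdot>\<cdot> (Id (Cells B) (Unit B b) \<diamondop> \<phi>)
             = \<phi> \<cdot>\<cdot> BLUn B (Dom (Cells B) \<phi>)"
    and run_iso: "\<alpha> \<in> Ob (Cells B) \<Longrightarrow> cell_iso B (BRUn B \<alpha>) (\<alpha> \<star> Unit B (Src B \<alpha>)) \<alpha>"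
    and run_natural: "\<lbrakk>\<phi> \<in> Ar (Cells B); a = Src B (Dom (Cells B) \<phi>)\<rbrakk>
           \<Longrightarrow> BRUn B (Cod (Cells B) \<phi>) \<cdot>\<cdot> (\<phi> \<diamondop> Id (Cells B) (Unit B a))
             = \<phi> \<cdot>\<cdot> BRUn B (Dom (Cells B) \<phi>)"
    and pentagon: "\<lbrakk>(\<delta>, \<gamma>) \<in> hpairs B; (\<gamma>, \<beta>) \<in> hpairs B; (\<beta>, \<alpha>) \<in> hpairs B\<rbrakk>
           \<Longrightarrow> BAsc B \<delta> \<gamma> (\<beta> \<star> \<alpha>) \<cdot>\<cdot> BAsc B (\<delta> \<star> \<gamma>) \<beta> \<alpha>
             = (Id (Cells B) \<delta> \<diamondop> BAsc B \<gamma> \<beta> \<alpha>)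
                 \<cdot>\<cdot> (BAsc B \<delta> (\<gamma> \<star> \<beta>) \<alpha> \<cdot>\<cdot> (BAsc B \<delta> \<gamma> \<beta> \<diamondop> Id (Cells B) \<alpha>))"
    and triangle: "(\<beta>, \<alpha>) \<in> hpairs B
           \<Longrightarrow> (Id (Cells B) \<beta> \<diamondop> BLUn B \<alpha>) \<cdot>\<cdot> BAsc B \<beta> (Unit B (Trg B \<alpha>)) \<alpha>
             = BRUn B \<beta> \<diamondop> Id (Cells B) \<alpha>"

record ('o, 'v, 'h, 'c) decbicat = "('o, 'h, 'c) bicat" +
  Dec :: "('o, 'v) cat"

locale decorated_bicategory = bicategory B
  for B :: "('o, 'v, 'h, 'c) decbicat" (structure) +
  assumes dec: "category (Dec B)"
    and ob_dec: "Ob (Dec B) = Cell0 B"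


section \<open>Decorated pseudofunctors\<close>

text \<open>
  \<open>PComp G (\<beta>, \<alpha>)\<close> is the comparison 2-cell from \<open>G \<beta> \<star> G \<alpha>\<close> to \<open>G (\<beta> \<star> \<alpha>)\<close>, and \<open>PUnit G a\<close> the
  one from the identity 1-cell of \<open>G a\<close> to the image of that of \<open>a\<close>.
\<close>

record ('o, 'h, 'c, 'p, 'k, 'd) psfun =
  P0 :: "'o \<Rightarrow> 'p"
  PCells :: "('h, 'c, 'k, 'd) ftor"
  PComp :: "'h \<times> 'h \<Rightarrow> 'd"
  PUnit :: "'o \<Rightarrow> 'd"

locale pseudofunctor = B: bicategory B + B': bicategory B'
  for B :: "('o, 'h, 'c, 'x) bicat_scheme" and B' :: "('p, 'k, 'd, 'y) bicat_scheme" +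
  fixes G :: "('o, 'h, 'c, 'p, 'k, 'd, 'z) psfun_scheme"
  assumes zero_cell: "a \<in> Cell0 B \<Longrightarrow> P0 G a \<in> Cell0 B'"
    and functor_cells: "is_functor (Cells B) (Cells B') (PCells G)"
    and ext0: "P0 G \<in> extensional (Cell0 B)"
    and ext_cells: "ext_ftor (Cells B) (PCells G)"
    and ext_comp: "PComp G \<in> extensional (hpairs B)"
    and ext_unit: "PUnit G \<in> extensional (Cell0 B)"
    and src: "\<alpha> \<in> Ob (Cells B) \<Longrightarrow> Src B' (FOb (PCells G) \<alpha>) = P0 G (Src B \<alpha>)"
    and trg: "\<alpha> \<in> Ob (Cells B) \<Longrightarrow> Trg B' (FOb (PCells G) \<alpha>) = P0 G (Trg B \<alpha>)"
    and comp_iso: "(\<beta>, \<alpha>) \<in> hpairs B \<Longrightarrow>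
           cell_iso B' (PComp G (\<beta>, \<alpha>))
             (FOb (PCells G) \<beta> \<star>\<^bsub>B'\<^esub> FOb (PCells G) \<alpha>) (FOb (PCells G) (\<beta> \<star>\<^bsub>B\<^esub> \<alpha>))"
    and comp_natural: "(\<psi>, \<phi>) \<in> hpairs2 B \<Longrightarrow>
           PComp G (Cod (Cells B) \<psi>, Cod (Cells B) \<phi>)
             \<cdot>\<cdot>\<^bsub>B'\<^esub> (FAr (PCells G) \<psi> \<diamondop>\<^bsub>B'\<^esub> FAr (PCells G) \<phi>)
           = FAr (PCells G) (\<psi> \<diamondop>\<^bsub>B\<^esub> \<phi>) \<cdot>\<cdot>\<^bsub>B'\<^esub> PComp G (Dom (Cells B) \<psi>, Dom (Cells B) \<phi>)"
    and unit_iso: "a \<in> Cell0 B \<Longrightarrow>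
           cell_iso B' (PUnit G a) (Unit B' (P0 G a)) (FOb (PCells G) (Unit B a))"
    and asc_coherence: "\<lbrakk>(\<gamma>, \<beta>) \<in> hpairs B; (\<beta>, \<alpha>) \<in> hpairs B\<rbrakk> \<Longrightarrow>
           FAr (PCells G) (BAsc B \<gamma> \<beta> \<alpha>) \<cdot>\<cdot>\<^bsub>B'\<^esub>
             (PComp G (\<gamma> \<star>\<^bsub>B\<^esub> \<beta>, \<alpha>)
               \<cdot>\<cdot>\<^bsub>B'\<^esub> (PComp G (\<gamma>, \<beta>) \<diamondop>\<^bsub>B'\<^esub> Id (Cells B') (FOb (PCells G) \<alpha>)))
           = PComp G (\<gamma>, \<beta> \<star>\<^bsub>B\<^esub> \<alpha>) \<cdot>\<cdot>\<^bsub>B'\<^esub>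
             ((Id (Cells B') (FOb (PCells G) \<gamma>) \<diamondop>\<^bsub>B'\<^esub> PComp G (\<beta>, \<alpha>))
               \<cdot>\<cdot>\<^bsub>B'\<^esub> BAsc B' (FOb (PCells G) \<gamma>) (FOb (PCells G) \<beta>) (FOb (PCells G) \<alpha>))"
    and lun_coherence: "\<lbrakk>\<alpha> \<in> Ob (Cells B); b = Trg B \<alpha>\<rbrakk> \<Longrightarrow>
           FAr (PCells G) (BLUn B \<alpha>) \<cdot>\<cdot>\<^bsub>B'\<^esub>
             (PComp G (Unit B b, \<alpha>)
               \<cdot>\<cdot>\<^bsub>B'\<^esub> (PUnit G b \<diamondop>\<^bsub>B'\<^esub> Id (Cells B') (FOb (PCells G) \<alpha>)))
           = BLUn B' (FOb (PCells G) \<alpha>)"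
    and run_coherence: "\<lbrakk>\<alpha> \<in> Ob (Cells B); a = Src B \<alpha>\<rbrakk> \<Longrightarrow>
           FAr (PCells G) (BRUn B \<alpha>) \<cdot>\<cdot>\<^bsub>B'\<^esub>
             (PComp G (\<alpha>, Unit B a)
               \<cdot>\<cdot>\<^bsub>B'\<^esub> (Id (Cells B') (FOb (PCells G) \<alpha>) \<diamondop>\<^bsub>B'\<^esub> PUnit G a))
           = BRUn B' (FOb (PCells G) \<alpha>)"

record ('o, 'v, 'h, 'c, 'p, 'w, 'k, 'd) decpsfun = "('o, 'h, 'c, 'p, 'k, 'd) psfun" +
  PDec :: "('o, 'v, 'p, 'w) ftor"

locale decorated_pseudofunctor =
  B: decorated_bicategory B + B': decorated_bicategory B' + pseudofunctor B B' G
  for B :: "('o, 'v, 'h, 'c) decbicat" and B' :: "('p, 'w, 'k, 'd) decbicat"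
    and G :: "('o, 'v, 'h, 'c, 'p, 'w, 'k, 'd) decpsfun" +
  assumes functor_dec: "is_functor (Dec B) (Dec B') (PDec G)"
    and ext_dec: "ext_ftor (Dec B) (PDec G)"
    and agree: "a \<in> Cell0 B \<Longrightarrow> FOb (PDec G) a = P0 G a"

definition decpsfun_id ::
  "('o, 'v, 'h, 'c) decbicat \<Rightarrow> ('o, 'v, 'h, 'c, 'o, 'v, 'h, 'c) decpsfun" where
  "decpsfun_id B =
    \<lparr>P0 = (\<lambda>a \<in> Cell0 B. a),
     PCells = ftor_id (Cells B),
     PComp = (\<lambda>(\<beta>, \<alpha>) \<in> hpairs B. Id (Cells B) (\<beta> \<star>\<^bsub>B\<^esub> \<alpha>)),
     PUnit = (\<lambda>a \<in> Cell0 B. Id (Cells B) (Unit B a)),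
     PDec = ftor_id (Dec B)\<rparr>"

definition decpsfun_comp ::
  "('o, 'v, 'h, 'c) decbicat \<Rightarrow> ('p', 'w', 'k', 'd') decbicat
     \<Rightarrow> ('p, 'w, 'k, 'd, 'p', 'w', 'k', 'd') decpsfun
     \<Rightarrow> ('o, 'v, 'h, 'c, 'p, 'w, 'k, 'd) decpsfun
     \<Rightarrow> ('o, 'v, 'h, 'c, 'p', 'w', 'k', 'd') decpsfun" where
  "decpsfun_comp B B' H G =
    \<lparr>P0 = compose (Cell0 B) (P0 H) (P0 G),
     PCells = ftor_comp (Cells B) (PCells H) (PCells G),
     PComp = (\<lambda>(\<beta>, \<alpha>) \<in> hpairs B. FAr (PCells H) (PComp G (\<beta>, \<alpha>))
       \<cdot>\<cdot>\<^bsub>B'\<^esub> PComp H (FOb (PCells G) \<beta>, FOb (PCells G) \<alpha>)),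
     PUnit = (\<lambda>a \<in> Cell0 B. FAr (PCells H) (PUnit G a) \<cdot>\<cdot>\<^bsub>B'\<^esub> PUnit H (P0 G a)),
     PDec = ftor_comp (Dec B) (PDec H) (PDec G)\<rparr>"

text \<open>The category \<open>bCat\<^sup>*\<close>.\<close>

type_synonym ('o, 'v, 'h, 'c) bmor =
  "('o, 'v, 'h, 'c) decbicat \<times> ('o, 'v, 'h, 'c, 'o, 'v, 'h, 'c) decpsfun \<times> ('o, 'v, 'h, 'c) decbicat"

definition bCat :: "(('o, 'v, 'h, 'c) decbicat, ('o, 'v, 'h, 'c) bmor) cat" where
  "bCat =
    \<lparr>Ob = {B. decorated_bicategory B},
     Ar = {(B, G, B'). decorated_pseudofunctor B B' G},
     Dom = (\<lambda>(B, G, B'). B),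
     Cod = (\<lambda>(B, G, B'). B'),
     Id = (\<lambda>B. (B, decpsfun_id B, B)),
     Comp = (\<lambda>(_, H, B'') (B, G, _). (B, decpsfun_comp B B'' H G, B''))\<rparr>"


section \<open>The free globularly generated double category\<close>

datatype ('c, 'v) expr =
  Cell 'c
| HId 'v
| VComp "('c, 'v) expr" "('c, 'v) expr"
| HComp "('c, 'v) expr" "('c, 'v) expr"

primrec top_edge :: "('o, 'v, 'h, 'c) decbicat \<Rightarrow> ('c, 'v) expr \<Rightarrow> 'h" where
  "top_edge B (Cell \<phi>) = Dom (Cells B) \<phi>"
| "top_edge B (HId f) = Unit B (Dom (Dec B) f)"
| "top_edge B (VComp \<Psi> \<Phi>) = top_edge B \<Phi>"
| "top_edge B (HComp \<Psi> \<Phi>) = top_edge B \<Psi> \<star>\<^bsub>B\<^esub> top_edge B \<Phi>"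

primrec bot_edge :: "('o, 'v, 'h, 'c) decbicat \<Rightarrow> ('c, 'v) expr \<Rightarrow> 'h" where
  "bot_edge B (Cell \<phi>) = Cod (Cells B) \<phi>"
| "bot_edge B (HId f) = Unit B (Cod (Dec B) f)"
| "bot_edge B (VComp \<Psi> \<Phi>) = bot_edge B \<Psi>"
| "bot_edge B (HComp \<Psi> \<Phi>) = bot_edge B \<Psi> \<star>\<^bsub>B\<^esub> bot_edge B \<Phi>"

primrec left_edge :: "('o, 'v, 'h, 'c) decbicat \<Rightarrow> ('c, 'v) expr \<Rightarrow> 'v" where
  "left_edge B (Cell \<phi>) = Id (Dec B) (Src B (Dom (Cells B) \<phi>))"
| "left_edge B (HId f) = f"
| "left_edge B (VComp \<Psi> \<Phi>) = left_edge B \<Psi> \<cdot>\<^bsub>Dec B\<^esub> left_edge B \<Phi>"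
| "left_edge B (HComp \<Psi> \<Phi>) = left_edge B \<Phi>"

primrec right_edge :: "('o, 'v, 'h, 'c) decbicat \<Rightarrow> ('c, 'v) expr \<Rightarrow> 'v" where
  "right_edge B (Cell \<phi>) = Id (Dec B) (Trg B (Dom (Cells B) \<phi>))"
| "right_edge B (HId f) = f"
| "right_edge B (VComp \<Psi> \<Phi>) = right_edge B \<Psi> \<cdot>\<^bsub>Dec B\<^esub> right_edge B \<Phi>"
| "right_edge B (HComp \<Psi> \<Phi>) = right_edge B \<Psi>"

primrec wf_expr :: "('o, 'v, 'h, 'c) decbicat \<Rightarrow> ('c, 'v) expr \<Rightarrow> bool" where
  "wf_expr B (Cell \<phi>) \<longleftrightarrow> \<phi> \<in> Ar (Cells B)"
| "wf_expr B (HId f) \<longleftrightarrow> f \<in> Ar (Dec B)"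
| "wf_expr B (VComp \<Psi> \<Phi>) \<longleftrightarrow> wf_expr B \<Psi> \<and> wf_expr B \<Phi> \<and> bot_edge B \<Phi> = top_edge B \<Psi>"
| "wf_expr B (HComp \<Psi> \<Phi>) \<longleftrightarrow> wf_expr B \<Psi> \<and> wf_expr B \<Phi> \<and> right_edge B \<Phi> = left_edge B \<Psi>"

text \<open>
  The basic identifications.  They are only ever used between well-formed expressions.
  The first one makes the generators \<open>i\<^bsub>id a\<^esub>\<close> and \<open>id\<^bsub>i a\<^esub>\<close> equal in the quotient.
\<close>

inductive basic_rel :: "('o, 'v, 'h, 'c) decbicat \<Rightarrow> ('c, 'v) expr \<Rightarrow> ('c, 'v) expr \<Rightarrow> bool"
  for B :: "('o, 'v, 'h, 'c) decbicat" where
  id_gen: "a \<in> Cell0 B \<Longrightarrow> basic_rel B (HId (Id (Dec B) a)) (Cell (Id (Cells B) (Unit B a)))"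
| v_assoc: "basic_rel B (VComp (VComp \<Theta> \<Psi>) \<Phi>) (VComp \<Theta> (VComp \<Psi> \<Phi>))"
| v_id_bot: "basic_rel B (VComp (Cell (Id (Cells B) (bot_edge B \<Phi>))) \<Phi>) \<Phi>"
| v_id_top: "basic_rel B (VComp \<Phi> (Cell (Id (Cells B) (top_edge B \<Phi>)))) \<Phi>"
| interchange: "basic_rel B
    (HComp (VComp \<Psi>' \<Psi>) (VComp \<Phi>' \<Phi>)) (VComp (HComp \<Psi>' \<Phi>') (HComp \<Psi> \<Phi>))"
| v_cell: "basic_rel B (VComp (Cell \<psi>) (Cell \<phi>)) (Cell (\<psi> \<cdot>\<cdot>\<^bsub>B\<^esub> \<phi>))"
| v_hid: "basic_rel B (VComp (HId g) (HId f)) (HId (g \<cdot>\<^bsub>Dec B\<^esub> f))"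
| h_cell: "(\<psi>, \<phi>) \<in> hpairs2 B \<Longrightarrow> basic_rel B (HComp (Cell \<psi>) (Cell \<phi>)) (Cell (\<psi> \<diamondop>\<^bsub>B\<^esub> \<phi>))"
| lun_nat: "basic_rel B
    (VComp (Cell (BLUn B (bot_edge B \<Phi>))) (HComp (HId (right_edge B \<Phi>)) \<Phi>))
    (VComp \<Phi> (Cell (BLUn B (top_edge B \<Phi>))))"
| run_nat: "basic_rel B
    (VComp (Cell (BRUn B (bot_edge B \<Phi>))) (HComp \<Phi> (HId (left_edge B \<Phi>))))
    (VComp \<Phi> (Cell (BRUn B (top_edge B \<Phi>))))"
| asc_nat: "basic_rel B
    (VComp (Cell (BAsc B (bot_edge B \<Theta>) (bot_edge B \<Psi>) (bot_edge B \<Phi>))) (HComp (HComp \<Theta> \<Psi>) \<Phi>))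
    (VComp (HComp \<Theta> (HComp \<Psi> \<Phi>)) (Cell (BAsc B (top_edge B \<Theta>) (top_edge B \<Psi>) (top_edge B \<Phi>))))"

inductive expr_rel :: "('o, 'v, 'h, 'c) decbicat \<Rightarrow> ('c, 'v) expr \<Rightarrow> ('c, 'v) expr \<Rightarrow> bool"
  for B :: "('o, 'v, 'h, 'c) decbicat" where
  basic: "\<lbrakk>basic_rel B \<Phi> \<Psi>; wf_expr B \<Phi>; wf_expr B \<Psi>\<rbrakk> \<Longrightarrow> expr_rel B \<Phi> \<Psi>"
| refl: "wf_expr B \<Phi> \<Longrightarrow> expr_rel B \<Phi> \<Phi>"
| sym: "expr_rel B \<Phi> \<Psi> \<Longrightarrow> expr_rel B \<Psi> \<Phi>"
| trans: "\<lbrakk>expr_rel B \<Phi> \<Psi>; expr_rel B \<Psi> \<Theta>\<rbrakk> \<Longrightarrow> expr_rel B \<Phi> \<Theta>"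
| vert: "\<lbrakk>expr_rel B \<Psi> \<Psi>'; expr_rel B \<Phi> \<Phi>'; wf_expr B (VComp \<Psi> \<Phi>); wf_expr B (VComp \<Psi>' \<Phi>')\<rbrakk>
    \<Longrightarrow> expr_rel B (VComp \<Psi> \<Phi>) (VComp \<Psi>' \<Phi>')"
| hor: "\<lbrakk>expr_rel B \<Psi> \<Psi>'; expr_rel B \<Phi> \<Phi>'; wf_expr B (HComp \<Psi> \<Phi>); wf_expr B (HComp \<Psi>' \<Phi>')\<rbrakk>
    \<Longrightarrow> expr_rel B (HComp \<Psi> \<Phi>) (HComp \<Psi>' \<Phi>')"

definition cls :: "('o, 'v, 'h, 'c) decbicat \<Rightarrow> ('c, 'v) expr \<Rightarrow> ('c, 'v) expr set" where
  "cls B \<Phi> = {\<Psi>. expr_rel B \<Phi> \<Psi>}"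

definition rep :: "('c, 'v) expr set \<Rightarrow> ('c, 'v) expr" where
  "rep X = (SOME \<Phi>. \<Phi> \<in> X)"

definition freeQ :: "('o, 'v, 'h, 'c) decbicat \<Rightarrow> ('o, 'v, 'h, ('c, 'v) expr set) dblcat" where
  "freeQ B =
    \<lparr>C0 = Dec B,
     C1 =
       \<lparr>Ob = Ob (Cells B),
        Ar = {\<Phi>. wf_expr B \<Phi>} // {(\<Phi>, \<Psi>). expr_rel B \<Phi> \<Psi>},
        Dom = (\<lambda>X. top_edge B (rep X)),
        Cod = (\<lambda>X. bot_edge B (rep X)),
        Id = (\<lambda>\<alpha>. cls B (Cell (Id (Cells B) \<alpha>))),
        Comp = (\<lambda>Y X. cls B (VComp (rep Y) (rep X)))\<rparr>,
     SrcF = \<lparr>FOb = Src B, FAr = (\<lambda>X. left_edge B (rep X))\<rparr>,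
     TrgF = \<lparr>FOb = Trg B, FAr = (\<lambda>X. right_edge B (rep X))\<rparr>,
     IdF = \<lparr>FOb = Unit B, FAr = (\<lambda>f. cls B (HId f))\<rparr>,
     HorF = \<lparr>FOb = (\<lambda>(\<beta>, \<alpha>). \<beta> \<star>\<^bsub>B\<^esub> \<alpha>), FAr = (\<lambda>(Y, X). cls B (HComp (rep Y) (rep X)))\<rparr>,
     Asc = (\<lambda>\<gamma> \<beta> \<alpha>. cls B (Cell (BAsc B \<gamma> \<beta> \<alpha>))),
     LUn = (\<lambda>\<alpha>. cls B (Cell (BLUn B \<alpha>))),
     RUn = (\<lambda>\<alpha>. cls B (Cell (BRUn B \<alpha>)))\<rparr>"


section \<open>The free double functor\<close>

text \<open>
  \<open>G\<close> preserves identity 1-cells and horizontal composites only up to its comparison 2-cells, so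
  \<open>i\<^bsub>G f\<^esub>\<close> and the horizontal composite of images are conjugated by these to obtain squares with
  the edges of \<open>G (i\<^bsub>f\<^esub>)\<close> and \<open>G (\<Psi> \<ast> \<Phi>)\<close>.  For strictly unital \<open>G\<close> the second clause amounts to
  \<open>i\<^bsub>f\<^esub> \<mapsto> i\<^bsub>G f\<^esub>\<close>; in general it is forced by naturality of the unit comparison.
\<close>

primrec mapQ ::
  "('o, 'v, 'h, 'c) decbicat \<Rightarrow> ('p, 'w, 'k, 'd) decbicat
     \<Rightarrow> ('o, 'v, 'h, 'c, 'p, 'w, 'k, 'd) decpsfun \<Rightarrow> ('c, 'v) expr \<Rightarrow> ('d, 'w) expr" where
  "mapQ B B' G (Cell \<phi>) = Cell (FAr (PCells G) \<phi>)"
| "mapQ B B' G (HId f) =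
     VComp (Cell (PUnit G (Cod (Dec B) f)))
       (VComp (HId (FAr (PDec G) f))
         (Cell (inv_ar (Cells B') (PUnit G (Dom (Dec B) f)))))"
| "mapQ B B' G (VComp \<Psi> \<Phi>) = VComp (mapQ B B' G \<Psi>) (mapQ B B' G \<Phi>)"
| "mapQ B B' G (HComp \<Psi> \<Phi>) =
     VComp (Cell (PComp G (bot_edge B \<Psi>, bot_edge B \<Phi>)))
       (VComp (HComp (mapQ B B' G \<Psi>) (mapQ B B' G \<Phi>))
         (Cell (inv_ar (Cells B') (PComp G (top_edge B \<Psi>, top_edge B \<Phi>)))))"

definition freeQ_map ::
  "('o, 'v, 'h, 'c) decbicat \<Rightarrow> ('p, 'w, 'k, 'd) decbicat
     \<Rightarrow> ('o, 'v, 'h, 'c, 'p, 'w, 'k, 'd) decpsfun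
     \<Rightarrow> ('o, 'v, 'h, ('c, 'v) expr set, 'p, 'w, 'k, ('d, 'w) expr set) dblfun" where
  "freeQ_map B B' G =
    \<lparr>F0 = PDec G,
     F1 = \<lparr>FOb = FOb (PCells G),
           FAr = (\<lambda>X \<in> Ar (C1 (freeQ B)). cls B' (mapQ B B' G (rep X)))\<rparr>,
     DComp = (\<lambda>p \<in> hpairs B. cls B' (Cell (PComp G p))),
     DUnit = (\<lambda>a \<in> Cell0 B. cls B' (Cell (PUnit G a)))\<rparr>"

definition freeQ_functor ::
  "(('o, 'v, 'h, 'c) decbicat, ('o, 'v, 'h, 'c) bmor,
    ('o, 'v, 'h, ('c, 'v) expr set) dblcat, ('o, 'v, 'h, ('c, 'v) expr set) gmor) ftor" where
  "freeQ_functor =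
    \<lparr>FOb = freeQ, FAr = (\<lambda>(B, G, B'). (freeQ B, freeQ_map B B' G, freeQ B'))\<rparr>"

end

theory Submission
  imports Defs
begin

text \<open>
  The 2-cells of \<open>B\<close> include into \<open>freeQ B\<close>, and a double functor \<open>F\<close> out of \<open>freeQ B\<close> is the same as a
  functor on the decoration together with a pseudofunctor on \<open>B\<close>, the restriction of \<open>F\<close> along the
  inclusion.  Uniqueness holds because naturality of the coherence squares of \<open>F\<close> forces its values
  on \<open>i\<^sub>f\<close> and on horizontal composites; for existence, the same formulas define \<open>F\<close> on expressions,
  and each basic identification is verified after precomposing with an invertible square.  The double
  functor \<open>freeQ_map B B' G\<close> is the extension of \<open>G\<close> followed by the inclusion of \<open>B'\<close>, so
  functoriality follows from uniqueness.
\<close>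

text \<open>A decorated pseudofunctor \<open>G\<close> preserves horizontal units and composites
  only up to its comparison 2-cells, so \<open>mapQ\<close> is not a homomorphism of expressions:
  every nested horizontal composite wraps one more pair of comparison cells around the image.
  Comparing \<open>mapQ\<close> of a composite with the composite of two \<open>mapQ\<close>s
  directly would mean rearranging these layers and their inverses, together with the representatives
  chosen by \<open>rep\<close>. A universal property avoids this, since equality has to be tested
  only on the decoration and on the restriction to 2-cells, comparison data included. To state it,
  pseudofunctors and double functors must be composable with each other. Therefore a bicategory is
  viewed as the double category \<open>vdisc B\<close>, and a pseudofunctor from \<open>B\<close> to
  the horizontal bicategory of \<open>E\<close> becomes a double functor from \<open>vdisc B\<close>
  to \<open>E\<close>. The horizontal bicategory itself is never built, and one proof that
  composites are coherent serves both kinds of functor.\<close>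

section \<open>Categories and double categories\<close>

context category
begin

lemma inverse_arrows_unique:
  assumes "inverse_arrows C f g" "inverse_arrows C f h"
  shows "g = h"
proof -
  have "g = g \<cdot> (f \<cdot> h)"
    using assms comp_id_right[of g] by (simp add: inverse_arrows_def)
  also have "\<dots> = (g \<cdot> f) \<cdot> h"
    using assms comp_assoc[of h f g] by (simp add: inverse_arrows_def)
  also have "\<dots> = h"
    using assms comp_id_left[of h] by (simp add: inverse_arrows_def)
  finally show ?thesis .
qed

lemma inverse_arrows_inv_ar: "invertible C f \<Longrightarrow> inverse_arrows C f (inv_ar C f)"
  unfolding invertible_def inv_ar_def
  by (metis inverse_arrows_unique theI)

lemma invertible_epi:
  assumes "invertible C f" "g \<in> Ar C" "h \<in> Ar C" "Dom C g = Cod C f" "Dom C h = Cod C f"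
    and "g \<cdot> f = h \<cdot> f"
  shows "g = h"
proof -
  obtain k where k: "inverse_arrows C f k"
    using assms(1) by (auto simp: invertible_def)
  have "g = (g \<cdot> f) \<cdot> k"
    using k assms comp_assoc[of k f g] comp_id_right[of g] by (simp add: inverse_arrows_def)
  also have "\<dots> = h"
    using k assms comp_assoc[of k f h] comp_id_right[of h] by (simp add: inverse_arrows_def)
  finally show ?thesis .
qed

lemma invertible_Id: "a \<in> Ob C \<Longrightarrow> invertible C (Id C a)"
  using comp_id_left[of "Id C a"]
  by (auto simp: invertible_def inverse_arrows_def id_ar dom_id cod_id intro!: exI[of _ "Id C a"])

lemma invertible_comp:
  assumes "invertible C f" "invertible C g" "Cod C f = Dom C g"
  shows "invertible C (g \<cdot> f)"
proof -
  obtain h k where h: "inverse_arrows C f h" and k: "inverse_arrows C g k"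
    using assms(1,2) by (auto simp: invertible_def)
  have hk: "h \<in> Ar C" "k \<in> Ar C" "Cod C k = Dom C h" and fg: "f \<in> Ar C" "g \<in> Ar C"
    using h k assms(3) by (auto simp: inverse_arrows_def)
  have "k \<cdot> (g \<cdot> f) = f"
    using h k assms(3) comp_assoc[of f g k] comp_id_left[of f] by (simp add: inverse_arrows_def)
  then have 1: "(h \<cdot> k) \<cdot> (g \<cdot> f) = Id C (Dom C f)"
    using h k assms(3) comp_assoc[of "g \<cdot> f" k h]
    by (simp add: inverse_arrows_def comp_ar dom_comp cod_comp)
  have "f \<cdot> (h \<cdot> k) = k"
    using h k assms(3) comp_assoc[of k h f] comp_id_left[of k] by (simp add: inverse_arrows_def)
  then have "(g \<cdot> f) \<cdot> (h \<cdot> k) = Id C (Cod C g)"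
    using h k assms(3) comp_assoc[of "h \<cdot> k" f g]
    by (simp add: inverse_arrows_def comp_ar dom_comp cod_comp)
  with 1 show ?thesis
    using h k hk fg assms(3) unfolding invertible_def inverse_arrows_def
    by (intro exI[of _ "h \<cdot> k"]) (simp add: comp_ar dom_comp cod_comp)
qed

end

section \<open>Functors and their equality\<close>

lemma (in is_functor) pres_inverse_arrows:
  assumes "inverse_arrows A f g"
  shows "inverse_arrows B (FAr F f) (FAr F g)"
  using assms pres_comp[of f g] pres_comp[of g f] pres_id[of "Dom A f"] pres_id[of "Cod A f"]
  by (auto simp: inverse_arrows_def ar dom cod A.dom_ob A.cod_ob)

lemma (in is_functor) pres_invertible: "invertible A f \<Longrightarrow> invertible B (FAr F f)"
  using pres_inverse_arrows by (auto simp: invertible_def)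

lemma is_functor_ftor_id: "category A \<Longrightarrow> is_functor A A (ftor_id A)"
  by (simp add: is_functor_def is_functor_axioms_def ftor_id_def category.dom_ob category.cod_ob
      category.id_ar category.comp_ar)

lemma is_functor_ftor_comp:
  assumes F: "is_functor A B F" and G: "is_functor B C G"
  shows "is_functor A C (ftor_comp A G F)"
proof -
  interpret F: is_functor A B F by fact
  interpret G: is_functor B C G by fact
  show ?thesis
    by unfold_locales
      (auto simp: ftor_comp_def compose_def F.ob F.ar F.dom F.cod F.pres_id F.pres_comp
        G.ob G.ar G.dom G.cod G.pres_id G.pres_comp F.A.dom_ob F.A.cod_ob F.A.id_ar F.A.comp_ar)
qed

lemma ext_ftor_id: "ext_ftor A (ftor_id A)"
  by (simp add: ext_ftor_def ftor_id_def)

lemma ext_ftor_comp: "ext_ftor A (ftor_comp A G F)"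
  by (simp add: ext_ftor_def ftor_comp_def compose_def)

text \<open>Functors are records of total functions. Extensionality fixes the values outside the
  carriers, so agreement on the objects and arrows of \<open>A\<close> is already equality of
  records.\<close>

lemma ftor_eqI:
  assumes "ext_ftor A F" "ext_ftor A G"
    and "\<And>a. a \<in> Ob A \<Longrightarrow> FOb F a = FOb G a" "\<And>f. f \<in> Ar A \<Longrightarrow> FAr F f = FAr G f"
  shows "F = (G :: ('o, 'a, 'p, 'b) ftor)"
proof -
  have "FOb F = FOb G" "FAr F = FAr G"
    using assms by (auto simp: ext_ftor_def intro: extensionalityI)
  then show ?thesis
    by simp
qed

lemma ftor_id_simps [simp]:
  "a \<in> Ob A \<Longrightarrow> FOb (ftor_id A) a = a" "f \<in> Ar A \<Longrightarrow> FAr (ftor_id A) f = f"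
  by (simp_all add: ftor_id_def)

lemma ftor_comp_simps [simp]:
  "a \<in> Ob A \<Longrightarrow> FOb (ftor_comp A G F) a = FOb G (FOb F a)"
  "f \<in> Ar A \<Longrightarrow> FAr (ftor_comp A G F) f = FAr G (FAr F f)"
  by (simp_all add: ftor_comp_def compose_def)

section \<open>Calculus of squares in a double category\<close>

context double_category
begin

sublocale V0: category "C0 D"
  using id_functor by (simp add: is_functor_def)

sublocale V1: category "C1 D"
  using id_functor by (simp add: is_functor_def)

lemma in_pullback [simp]:
  "(\<beta>, \<alpha>) \<in> Ob (pullback D) \<longleftrightarrow>
    \<beta> \<in> Ob (C1 D) \<and> \<alpha> \<in> Ob (C1 D) \<and> FOb (TrgF D) \<alpha> = FOb (SrcF D) \<beta>"
  "(\<Psi>, \<Phi>) \<in> Ar (pullback D) \<longleftrightarrow>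
    \<Psi> \<in> Ar (C1 D) \<and> \<Phi> \<in> Ar (C1 D) \<and> FAr (TrgF D) \<Phi> = FAr (SrcF D) \<Psi>"
  by (simp_all add: pullback_def)

lemma vsq_simps [simp]:
  assumes "\<Phi> \<in> Ar (C1 D)" "\<Psi> \<in> Ar (C1 D)" "Cod (C1 D) \<Phi> = Dom (C1 D) \<Psi>"
  shows "\<Psi> \<bullet> \<Phi> \<in> Ar (C1 D)"
    and "Dom (C1 D) (\<Psi> \<bullet> \<Phi>) = Dom (C1 D) \<Phi>"
    and "Cod (C1 D) (\<Psi> \<bullet> \<Phi>) = Cod (C1 D) \<Psi>"
    and "FAr (SrcF D) (\<Psi> \<bullet> \<Phi>) = FAr (SrcF D) \<Psi> \<cdot>\<^bsub>C0 D\<^esub> FAr (SrcF D) \<Phi>"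
    and "FAr (TrgF D) (\<Psi> \<bullet> \<Phi>) = FAr (TrgF D) \<Psi> \<cdot>\<^bsub>C0 D\<^esub> FAr (TrgF D) \<Phi>"
  using assms is_functor.pres_comp[OF src_functor] is_functor.pres_comp[OF trg_functor]
  by (auto simp: vsq_def V1.comp_ar V1.dom_comp V1.cod_comp)

lemma vsq_assoc:
  "\<lbrakk>\<Phi> \<in> Ar (C1 D); \<Psi> \<in> Ar (C1 D); \<Theta> \<in> Ar (C1 D); Cod (C1 D) \<Phi> = Dom (C1 D) \<Psi>;
    Cod (C1 D) \<Psi> = Dom (C1 D) \<Theta>\<rbrakk> \<Longrightarrow> (\<Theta> \<bullet> \<Psi>) \<bullet> \<Phi> = \<Theta> \<bullet> (\<Psi> \<bullet> \<Phi>)"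
  unfolding vsq_def by (rule V1.comp_assoc)

lemma vsq_id [simp]:
  "\<lbrakk>\<Phi> \<in> Ar (C1 D); \<beta> = Cod (C1 D) \<Phi>\<rbrakk> \<Longrightarrow> Id (C1 D) \<beta> \<bullet> \<Phi> = \<Phi>"
  "\<lbrakk>\<Phi> \<in> Ar (C1 D); \<alpha> = Dom (C1 D) \<Phi>\<rbrakk> \<Longrightarrow> \<Phi> \<bullet> Id (C1 D) \<alpha> = \<Phi>"
  unfolding vsq_def by (simp_all add: V1.comp_id_left V1.comp_id_right)

lemma v0_id [simp]:
  "\<lbrakk>f \<in> Ar (C0 D); b = Cod (C0 D) f\<rbrakk> \<Longrightarrow> Id (C0 D) b \<cdot>\<^bsub>C0 D\<^esub> f = f"
  "\<lbrakk>f \<in> Ar (C0 D); a = Dom (C0 D) f\<rbrakk> \<Longrightarrow> f \<cdot>\<^bsub>C0 D\<^esub> Id (C0 D) a = f"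
  by (simp_all add: V0.comp_id_left V0.comp_id_right)

lemma hsq_simps [simp]:
  assumes "\<Psi> \<in> Ar (C1 D)" "\<Phi> \<in> Ar (C1 D)" "FAr (TrgF D) \<Phi> = FAr (SrcF D) \<Psi>"
  shows "\<Psi> \<ast> \<Phi> \<in> Ar (C1 D)"
    and "Dom (C1 D) (\<Psi> \<ast> \<Phi>) = Dom (C1 D) \<Psi> \<odot> Dom (C1 D) \<Phi>"
    and "Cod (C1 D) (\<Psi> \<ast> \<Phi>) = Cod (C1 D) \<Psi> \<odot> Cod (C1 D) \<Phi>"
    and "FAr (SrcF D) (\<Psi> \<ast> \<Phi>) = FAr (SrcF D) \<Phi>"
    and "FAr (TrgF D) (\<Psi> \<ast> \<Phi>) = FAr (TrgF D) \<Psi>"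
  using is_functor.ar[OF hor_functor, of "(\<Psi>, \<Phi>)"] is_functor.dom[OF hor_functor, of "(\<Psi>, \<Phi>)"]
    is_functor.cod[OF hor_functor, of "(\<Psi>, \<Phi>)"] src_hor_ar[of \<Psi> \<Phi>] trg_hor_ar[of \<Psi> \<Phi>] assms
  by (simp_all add: hsq_def hmor_def) (simp_all add: pullback_def)

lemma interchange:
  assumes "\<Psi>' \<in> Ar (C1 D)" "\<Phi>' \<in> Ar (C1 D)" "FAr (TrgF D) \<Phi>' = FAr (SrcF D) \<Psi>'"
    "\<Psi> \<in> Ar (C1 D)" "\<Phi> \<in> Ar (C1 D)" "FAr (TrgF D) \<Phi> = FAr (SrcF D) \<Psi>"
    "Cod (C1 D) \<Psi> = Dom (C1 D) \<Psi>'" "Cod (C1 D) \<Phi> = Dom (C1 D) \<Phi>'"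
  shows "(\<Psi>' \<bullet> \<Psi>) \<ast> (\<Phi>' \<bullet> \<Phi>) = (\<Psi>' \<ast> \<Phi>') \<bullet> (\<Psi> \<ast> \<Phi>)"
  using is_functor.pres_comp[OF hor_functor, of "(\<Psi>, \<Phi>)" "(\<Psi>', \<Phi>')"] assms
  by (simp add: hsq_def) (simp add: vsq_def pullback_def)

lemma edge_simps [simp]:
  "\<alpha> \<in> Ob (C1 D) \<Longrightarrow> FOb (SrcF D) \<alpha> \<in> Ob (C0 D)"
  "\<alpha> \<in> Ob (C1 D) \<Longrightarrow> FOb (TrgF D) \<alpha> \<in> Ob (C0 D)"
  "a \<in> Ob (C0 D) \<Longrightarrow> FOb (IdF D) a \<in> Ob (C1 D)"
  "\<Phi> \<in> Ar (C1 D) \<Longrightarrow> FAr (SrcF D) \<Phi> \<in> Ar (C0 D)"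
  "\<Phi> \<in> Ar (C1 D) \<Longrightarrow> FAr (TrgF D) \<Phi> \<in> Ar (C0 D)"
  "f \<in> Ar (C0 D) \<Longrightarrow> FAr (IdF D) f \<in> Ar (C1 D)"
  "\<Phi> \<in> Ar (C1 D) \<Longrightarrow> Dom (C0 D) (FAr (SrcF D) \<Phi>) = FOb (SrcF D) (Dom (C1 D) \<Phi>)"
  "\<Phi> \<in> Ar (C1 D) \<Longrightarrow> Cod (C0 D) (FAr (SrcF D) \<Phi>) = FOb (SrcF D) (Cod (C1 D) \<Phi>)"
  "\<Phi> \<in> Ar (C1 D) \<Longrightarrow> Dom (C0 D) (FAr (TrgF D) \<Phi>) = FOb (TrgF D) (Dom (C1 D) \<Phi>)"
  "\<Phi> \<in> Ar (C1 D) \<Longrightarrow> Cod (C0 D) (FAr (TrgF D) \<Phi>) = FOb (TrgF D) (Cod (C1 D) \<Phi>)"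
  "f \<in> Ar (C0 D) \<Longrightarrow> Dom (C1 D) (FAr (IdF D) f) = FOb (IdF D) (Dom (C0 D) f)"
  "f \<in> Ar (C0 D) \<Longrightarrow> Cod (C1 D) (FAr (IdF D) f) = FOb (IdF D) (Cod (C0 D) f)"
  "\<alpha> \<in> Ob (C1 D) \<Longrightarrow> FAr (SrcF D) (Id (C1 D) \<alpha>) = Id (C0 D) (FOb (SrcF D) \<alpha>)"
  "\<alpha> \<in> Ob (C1 D) \<Longrightarrow> FAr (TrgF D) (Id (C1 D) \<alpha>) = Id (C0 D) (FOb (TrgF D) \<alpha>)"
  "a \<in> Ob (C0 D) \<Longrightarrow> FAr (IdF D) (Id (C0 D) a) = Id (C1 D) (FOb (IdF D) a)"
  using src_functor trg_functor id_functor
  by (simp_all add: is_functor.ob is_functor.ar is_functor.dom is_functor.cod is_functor.pres_id)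

lemmas edge_of_id [simp] = src_id trg_id src_id_ar trg_id_ar

lemmas cat_simps [simp] =
  V1.dom_ob V1.cod_ob V1.id_ar V1.dom_id V1.cod_id V0.dom_ob V0.cod_ob V0.id_ar V0.dom_id V0.cod_id

lemma hmor_simps [simp]:
  assumes "\<beta> \<in> Ob (C1 D)" "\<alpha> \<in> Ob (C1 D)" "FOb (TrgF D) \<alpha> = FOb (SrcF D) \<beta>"
  shows "\<beta> \<odot> \<alpha> \<in> Ob (C1 D)"
    and "FOb (SrcF D) (\<beta> \<odot> \<alpha>) = FOb (SrcF D) \<alpha>"
    and "FOb (TrgF D) (\<beta> \<odot> \<alpha>) = FOb (TrgF D) \<beta>"
    and "Id (C1 D) \<beta> \<ast> Id (C1 D) \<alpha> = Id (C1 D) (\<beta> \<odot> \<alpha>)"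
  using is_functor.ob[OF hor_functor, of "(\<beta>, \<alpha>)"] src_hor[of \<beta> \<alpha>] trg_hor[of \<beta> \<alpha>]
    is_functor.pres_id[OF hor_functor, of "(\<beta>, \<alpha>)"] assms
  by (simp_all add: hmor_def hsq_def) (simp add: pullback_def)

text \<open>Composability of squares is an equation of vertical edges; its domain and codomain give
  composability of tops and bottoms. Comparison squares and associators are indexed by tops and
  bottoms, hence the need for this form.\<close>

lemma hcomposable_objects:
  assumes "\<Psi> \<in> Ar (C1 D)" "\<Phi> \<in> Ar (C1 D)" "FAr (TrgF D) \<Phi> = FAr (SrcF D) \<Psi>"
  shows "FOb (TrgF D) (Dom (C1 D) \<Phi>) = FOb (SrcF D) (Dom (C1 D) \<Psi>)"
    and "FOb (TrgF D) (Cod (C1 D) \<Phi>) = FOb (SrcF D) (Cod (C1 D) \<Psi>)"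
  using assms by (metis edge_simps(7,9), metis edge_simps(8,10))

text \<open>\<open>globular\<close> says only that each edge is the identity of some object. Domain
  and codomain of that identity show which object it is, and that \<alpha> and \<beta> have the same
  ends.\<close>

lemma globular_isoD:
  assumes "globular_iso D \<Phi> \<alpha> \<beta>"
  shows "\<Phi> \<in> Ar (C1 D)" "Dom (C1 D) \<Phi> = \<alpha>" "Cod (C1 D) \<Phi> = \<beta>" "invertible (C1 D) \<Phi>"
    and "FAr (SrcF D) \<Phi> = Id (C0 D) (FOb (SrcF D) \<alpha>)"
    and "FAr (TrgF D) \<Phi> = Id (C0 D) (FOb (TrgF D) \<alpha>)"
    and "\<alpha> \<in> Ob (C1 D)" "\<beta> \<in> Ob (C1 D)"
    and "FOb (SrcF D) \<beta> = FOb (SrcF D) \<alpha>" "FOb (TrgF D) \<beta> = FOb (TrgF D) \<alpha>"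
proof -
  obtain a b where ab: "a \<in> Ob (C0 D)" "b \<in> Ob (C0 D)"
    "FAr (SrcF D) \<Phi> = Id (C0 D) a" "FAr (TrgF D) \<Phi> = Id (C0 D) b"
    using assms by (auto simp: globular_iso_def globular_def)
  show \<Phi>: "\<Phi> \<in> Ar (C1 D)" "Dom (C1 D) \<Phi> = \<alpha>" "Cod (C1 D) \<Phi> = \<beta>" "invertible (C1 D) \<Phi>"
    using assms by (auto simp: globular_iso_def globular_def)
  then show "\<alpha> \<in> Ob (C1 D)" "\<beta> \<in> Ob (C1 D)"
    by auto
  have "FOb (SrcF D) \<alpha> = a" "FOb (SrcF D) \<beta> = a" "FOb (TrgF D) \<alpha> = b" "FOb (TrgF D) \<beta> = b"
    using edge_simps(7-10)[OF \<Phi>(1)] ab \<Phi> by simp_all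
  then show "FAr (SrcF D) \<Phi> = Id (C0 D) (FOb (SrcF D) \<alpha>)"
    "FAr (TrgF D) \<Phi> = Id (C0 D) (FOb (TrgF D) \<alpha>)"
    "FOb (SrcF D) \<beta> = FOb (SrcF D) \<alpha>" "FOb (TrgF D) \<beta> = FOb (TrgF D) \<alpha>"
    using ab by simp_all
qed

lemma globular_isoI:
  assumes "invertible (C1 D) \<Phi>" "Dom (C1 D) \<Phi> = \<alpha>" "Cod (C1 D) \<Phi> = \<beta>"
    and "FAr (SrcF D) \<Phi> = Id (C0 D) (FOb (SrcF D) \<alpha>)"
    and "FAr (TrgF D) \<Phi> = Id (C0 D) (FOb (TrgF D) \<alpha>)"
  shows "globular_iso D \<Phi> \<alpha> \<beta>"
  using assms by (auto simp: globular_iso_def globular_def invertible_def inverse_arrows_def)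

lemma globular_iso_Id: "\<alpha> \<in> Ob (C1 D) \<Longrightarrow> globular_iso D (Id (C1 D) \<alpha>) \<alpha> \<alpha>"
  by (rule globular_isoI) (auto intro: V1.invertible_Id)

lemma globular_iso_vsq:
  assumes \<Phi>: "globular_iso D \<Phi> \<alpha> \<beta>" and \<Psi>: "globular_iso D \<Psi> \<beta> \<gamma>"
  shows "globular_iso D (\<Psi> \<bullet> \<Phi>) \<alpha> \<gamma>"
  using globular_isoD[OF \<Phi>] globular_isoD[OF \<Psi>]
  by (intro globular_isoI) (auto simp: vsq_def[symmetric] intro: V1.invertible_comp[folded vsq_def])

text \<open>The inverses are again horizontally composable: the edge functors preserve inverses, and
  the inverse of the shared edge is unique. The pair of inverses is then an inverse in the pullback,
  which \<open>HorF\<close> preserves.\<close>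

lemma invertible_hsq:
  assumes "invertible (C1 D) \<Psi>" "invertible (C1 D) \<Phi>" "FAr (TrgF D) \<Phi> = FAr (SrcF D) \<Psi>"
    shows "invertible (C1 D) (\<Psi> \<ast> \<Phi>)"
proof -
  interpret H: is_functor "pullback D" "C1 D" "HorF D"
    by (rule hor_functor)
  obtain \<Psi>' \<Phi>' where inv: "inverse_arrows (C1 D) \<Psi> \<Psi>'" "inverse_arrows (C1 D) \<Phi> \<Phi>'"
    using assms by (auto simp: invertible_def)
  have ar: "\<Psi> \<in> Ar (C1 D)" "\<Phi> \<in> Ar (C1 D)" "\<Psi>' \<in> Ar (C1 D)" "\<Phi>' \<in> Ar (C1 D)"
    using inv by (simp_all add: inverse_arrows_def)
  have "inverse_arrows (C0 D) (FAr (SrcF D) \<Psi>) (FAr (SrcF D) \<Psi>')"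
    "inverse_arrows (C0 D) (FAr (TrgF D) \<Phi>) (FAr (TrgF D) \<Phi>')"
    using inv by (auto intro: is_functor.pres_inverse_arrows src_functor trg_functor)
  then have edge: "FAr (TrgF D) \<Phi>' = FAr (SrcF D) \<Psi>'"
    using assms(3) V0.inverse_arrows_unique by simp
  have "inverse_arrows (pullback D) (\<Psi>, \<Phi>) (\<Psi>', \<Phi>')"
    using inv ar edge assms(3) by (auto simp: inverse_arrows_def) (auto simp: pullback_def vsq_def)
  then show ?thesis
    using H.pres_inverse_arrows unfolding hsq_def invertible_def by blast
qed

lemma globular_iso_hsq:
  assumes \<Phi>: "globular_iso D \<Phi> \<alpha> \<beta>" and \<Psi>: "globular_iso D \<Psi> \<gamma> \<delta>"
    and "FOb (TrgF D) \<alpha> = FOb (SrcF D) \<gamma>"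
  shows "globular_iso D (\<Psi> \<ast> \<Phi>) (\<gamma> \<odot> \<alpha>) (\<delta> \<odot> \<beta>)"
  using globular_isoD[OF \<Phi>] globular_isoD[OF \<Psi>] assms(3)
  by (intro globular_isoI invertible_hsq) auto

lemma vsq_cancel:
  assumes "globular_iso D \<Phi> \<alpha> \<beta>" "X \<in> Ar (C1 D)" "Y \<in> Ar (C1 D)" "Dom (C1 D) X = \<beta>"
    "Dom (C1 D) Y = \<beta>" "X \<bullet> \<Phi> = Y \<bullet> \<Phi>"
  shows "X = Y"
  using V1.invertible_epi[of \<Phi> X Y] assms globular_isoD[OF assms(1)] by (simp add: vsq_def)

lemma globular_iso_inv_ar:
  assumes "globular_iso D \<Phi> \<alpha> \<beta>"
  shows "globular_iso D (inv_ar (C1 D) \<Phi>) \<beta> \<alpha>" "inv_ar (C1 D) \<Phi> \<bullet> \<Phi> = Id (C1 D) \<alpha>"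
    "\<Phi> \<bullet> inv_ar (C1 D) \<Phi> = Id (C1 D) \<beta>"
proof -
  note \<Phi> = globular_isoD[OF assms]
  have inv: "inverse_arrows (C1 D) \<Phi> (inv_ar (C1 D) \<Phi>)"
    by (rule V1.inverse_arrows_inv_ar[OF \<Phi>(4)])
  then show 1: "inv_ar (C1 D) \<Phi> \<bullet> \<Phi> = Id (C1 D) \<alpha>" "\<Phi> \<bullet> inv_ar (C1 D) \<Phi> = Id (C1 D) \<beta>"
    using \<Phi> by (simp_all add: inverse_arrows_def vsq_def)
  let ?\<Psi> = "inv_ar (C1 D) \<Phi>"
  have \<Psi>: "?\<Psi> \<in> Ar (C1 D)" "Dom (C1 D) ?\<Psi> = \<beta>" "Cod (C1 D) ?\<Psi> = \<alpha>"
    using inv \<Phi> by (simp_all add: inverse_arrows_def)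
  show "globular_iso D ?\<Psi> \<beta> \<alpha>"
  proof (rule globular_isoI)
    show "invertible (C1 D) ?\<Psi>"
      using inv by (auto simp: invertible_def inverse_arrows_def)
    \<comment> \<open>The left edge of the identity square
      \<open>inv_ar (C1 D) \<Phi> \<bullet> \<Phi>\<close> is the left edge of the inverse composed
      with an identity, so the former is an identity too. The right edge is treated alike.\<close>
    show "FAr (SrcF D) ?\<Psi> = Id (C0 D) (FOb (SrcF D) \<beta>)"
      using vsq_simps(4)[of \<Phi> ?\<Psi>] \<Phi> \<Psi> 1 by simp
    show "FAr (TrgF D) ?\<Psi> = Id (C0 D) (FOb (TrgF D) \<beta>)"
      using vsq_simps(5)[of \<Phi> ?\<Psi>] \<Phi> \<Psi> 1 by simp
  qed (rule \<Psi>)+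
qed

end


section \<open>Composition of double functors\<close>

context double_category
begin

text \<open>Vertical composites are kept nested to the right. This form rewrites the two factors at
  the head of such a nest, the rest \<open>R\<close> staying in place.\<close>

lemma vsq_shift:
  assumes "A \<bullet> B = X \<bullet> Y"
    and "R \<in> Ar (C1 D)" "B \<in> Ar (C1 D)" "A \<in> Ar (C1 D)" "Y \<in> Ar (C1 D)" "X \<in> Ar (C1 D)"
    and "Cod (C1 D) R = Dom (C1 D) B" "Cod (C1 D) B = Dom (C1 D) A"
    and "Cod (C1 D) R = Dom (C1 D) Y" "Cod (C1 D) Y = Dom (C1 D) X"
  shows "A \<bullet> (B \<bullet> R) = X \<bullet> (Y \<bullet> R)"
  using assms by (metis vsq_assoc)

lemma asc_simps [simp]:
  assumes "\<gamma> \<in> Ob (C1 D)" "\<beta> \<in> Ob (C1 D)" "\<alpha> \<in> Ob (C1 D)"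
    and "FOb (TrgF D) \<beta> = FOb (SrcF D) \<gamma>" "FOb (TrgF D) \<alpha> = FOb (SrcF D) \<beta>"
  shows "Asc D \<gamma> \<beta> \<alpha> \<in> Ar (C1 D)"
    and "Dom (C1 D) (Asc D \<gamma> \<beta> \<alpha>) = (\<gamma> \<odot> \<beta>) \<odot> \<alpha>"
    and "Cod (C1 D) (Asc D \<gamma> \<beta> \<alpha>) = \<gamma> \<odot> (\<beta> \<odot> \<alpha>)"
    and "FAr (SrcF D) (Asc D \<gamma> \<beta> \<alpha>) = Id (C0 D) (FOb (SrcF D) \<alpha>)"
    and "FAr (TrgF D) (Asc D \<gamma> \<beta> \<alpha>) = Id (C0 D) (FOb (TrgF D) \<gamma>)"
  using assms globular_isoD(1-3,5-6)[OF asc_iso, of \<gamma> \<beta> \<alpha>] by simp_all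

lemma lun_simps [simp]:
  assumes "\<alpha> \<in> Ob (C1 D)"
  shows "LUn D \<alpha> \<in> Ar (C1 D)"
    and "Dom (C1 D) (LUn D \<alpha>) = FOb (IdF D) (FOb (TrgF D) \<alpha>) \<odot> \<alpha>"
    and "Cod (C1 D) (LUn D \<alpha>) = \<alpha>"
    and "FAr (SrcF D) (LUn D \<alpha>) = Id (C0 D) (FOb (SrcF D) \<alpha>)"
    and "FAr (TrgF D) (LUn D \<alpha>) = Id (C0 D) (FOb (TrgF D) \<alpha>)"
  using assms globular_isoD(1-3,5-6)[OF lun_iso, of \<alpha>] by simp_all

lemma run_simps [simp]:
  assumes "\<alpha> \<in> Ob (C1 D)"
  shows "RUn D \<alpha> \<in> Ar (C1 D)"
    and "Dom (C1 D) (RUn D \<alpha>) = \<alpha> \<odot> FOb (IdF D) (FOb (SrcF D) \<alpha>)"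
    and "Cod (C1 D) (RUn D \<alpha>) = \<alpha>"
    and "FAr (SrcF D) (RUn D \<alpha>) = Id (C0 D) (FOb (SrcF D) \<alpha>)"
    and "FAr (TrgF D) (RUn D \<alpha>) = Id (C0 D) (FOb (TrgF D) \<alpha>)"
  using assms globular_isoD(1-3,5-6)[OF run_iso, of \<alpha>] by simp_all

text \<open>Whiskering is compatible with vertical composition because the identity square splits as
  the composite of two copies of itself. Interchange applies since the facing edges are
  identities.\<close>

lemma interchange_id_right:
  assumes "\<Psi> \<in> Ar (C1 D)" "\<Psi>' \<in> Ar (C1 D)" "Cod (C1 D) \<Psi> = Dom (C1 D) \<Psi>'" "\<alpha> \<in> Ob (C1 D)"
    and "FAr (SrcF D) \<Psi> = Id (C0 D) (FOb (TrgF D) \<alpha>)"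
    and "FAr (SrcF D) \<Psi>' = Id (C0 D) (FOb (TrgF D) \<alpha>)"
  shows "(\<Psi>' \<bullet> \<Psi>) \<ast> Id (C1 D) \<alpha> = (\<Psi>' \<ast> Id (C1 D) \<alpha>) \<bullet> (\<Psi> \<ast> Id (C1 D) \<alpha>)"
  using interchange[of \<Psi>' "Id (C1 D) \<alpha>" \<Psi> "Id (C1 D) \<alpha>"] assms by simp

lemma interchange_id_left:
  assumes "\<Phi> \<in> Ar (C1 D)" "\<Phi>' \<in> Ar (C1 D)" "Cod (C1 D) \<Phi> = Dom (C1 D) \<Phi>'" "\<beta> \<in> Ob (C1 D)"
    and "FAr (TrgF D) \<Phi> = Id (C0 D) (FOb (SrcF D) \<beta>)"
    and "FAr (TrgF D) \<Phi>' = Id (C0 D) (FOb (SrcF D) \<beta>)"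
  shows "Id (C1 D) \<beta> \<ast> (\<Phi>' \<bullet> \<Phi>) = (Id (C1 D) \<beta> \<ast> \<Phi>') \<bullet> (Id (C1 D) \<beta> \<ast> \<Phi>)"
  using interchange[of "Id (C1 D) \<beta>" \<Phi>' "Id (C1 D) \<beta>" \<Phi>] assms by simp

end

context double_functor
begin

lemma functor_simps [simp]:
  "\<alpha> \<in> Ob (C1 D) \<Longrightarrow> FOb (F1 F) \<alpha> \<in> Ob (C1 E)"
  "\<Phi> \<in> Ar (C1 D) \<Longrightarrow> FAr (F1 F) \<Phi> \<in> Ar (C1 E)"
  "\<Phi> \<in> Ar (C1 D) \<Longrightarrow> Dom (C1 E) (FAr (F1 F) \<Phi>) = FOb (F1 F) (Dom (C1 D) \<Phi>)"
  "\<Phi> \<in> Ar (C1 D) \<Longrightarrow> Cod (C1 E) (FAr (F1 F) \<Phi>) = FOb (F1 F) (Cod (C1 D) \<Phi>)"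
  "\<alpha> \<in> Ob (C1 D) \<Longrightarrow> FAr (F1 F) (Id (C1 D) \<alpha>) = Id (C1 E) (FOb (F1 F) \<alpha>)"
  "a \<in> Ob (C0 D) \<Longrightarrow> FOb (F0 F) a \<in> Ob (C0 E)"
  "f \<in> Ar (C0 D) \<Longrightarrow> FAr (F0 F) f \<in> Ar (C0 E)"
  "f \<in> Ar (C0 D) \<Longrightarrow> Dom (C0 E) (FAr (F0 F) f) = FOb (F0 F) (Dom (C0 D) f)"
  "f \<in> Ar (C0 D) \<Longrightarrow> Cod (C0 E) (FAr (F0 F) f) = FOb (F0 F) (Cod (C0 D) f)"
  "a \<in> Ob (C0 D) \<Longrightarrow> FAr (F0 F) (Id (C0 D) a) = Id (C0 E) (FOb (F0 F) a)"
  using functor0 functor1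
  by (simp_all add: is_functor.ob is_functor.ar is_functor.dom is_functor.cod is_functor.pres_id)

lemmas edge_simps [simp] = src trg src_ar trg_ar

lemma pres_vsq [simp]:
  "\<lbrakk>\<Phi> \<in> Ar (C1 D); \<Psi> \<in> Ar (C1 D); Cod (C1 D) \<Phi> = Dom (C1 D) \<Psi>\<rbrakk>
    \<Longrightarrow> FAr (F1 F) (\<Psi> \<bullet>\<^bsub>D\<^esub> \<Phi>) = FAr (F1 F) \<Psi> \<bullet>\<^bsub>E\<^esub> FAr (F1 F) \<Phi>"
  unfolding vsq_def by (rule is_functor.pres_comp[OF functor1])

lemma pres_globular_iso:
  assumes "globular_iso D \<Phi> \<alpha> \<beta>"
  shows "globular_iso E (FAr (F1 F) \<Phi>) (FOb (F1 F) \<alpha>) (FOb (F1 F) \<beta>)"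
  using D.globular_isoD[OF assms]
  by (intro E.globular_isoI) (auto intro: is_functor.pres_invertible[OF functor1])

lemma comp_simps [simp]:
  assumes "\<beta> \<in> Ob (C1 D)" "\<alpha> \<in> Ob (C1 D)" "FOb (TrgF D) \<alpha> = FOb (SrcF D) \<beta>"
  shows "DComp F (\<beta>, \<alpha>) \<in> Ar (C1 E)"
    and "Dom (C1 E) (DComp F (\<beta>, \<alpha>)) = FOb (F1 F) \<beta> \<odot>\<^bsub>E\<^esub> FOb (F1 F) \<alpha>"
    and "Cod (C1 E) (DComp F (\<beta>, \<alpha>)) = FOb (F1 F) (\<beta> \<odot>\<^bsub>D\<^esub> \<alpha>)"
    and "FAr (SrcF E) (DComp F (\<beta>, \<alpha>)) = Id (C0 E) (FOb (F0 F) (FOb (SrcF D) \<alpha>))"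
    and "FAr (TrgF E) (DComp F (\<beta>, \<alpha>)) = Id (C0 E) (FOb (F0 F) (FOb (TrgF D) \<beta>))"
  using E.globular_isoD[OF comp_iso, of \<beta> \<alpha>] assms by simp_all

lemma unit_simps [simp]:
  assumes "a \<in> Ob (C0 D)"
  shows "DUnit F a \<in> Ar (C1 E)"
    and "Dom (C1 E) (DUnit F a) = FOb (IdF E) (FOb (F0 F) a)"
    and "Cod (C1 E) (DUnit F a) = FOb (F1 F) (FOb (IdF D) a)"
    and "FAr (SrcF E) (DUnit F a) = Id (C0 E) (FOb (F0 F) a)"
    and "FAr (TrgF E) (DUnit F a) = Id (C0 E) (FOb (F0 F) a)"
  using E.globular_isoD[OF unit_iso, of a] assms by simp_all

end

lemma dblfun_comp_simps:
  "F0 (dblfun_comp D E G F) = ftor_comp (C0 D) (F0 G) (F0 F)"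
  "F1 (dblfun_comp D E G F) = ftor_comp (C1 D) (F1 G) (F1 F)"
  "(\<beta>, \<alpha>) \<in> Ob (pullback D) \<Longrightarrow> DComp (dblfun_comp D E G F) (\<beta>, \<alpha>) =
    FAr (F1 G) (DComp F (\<beta>, \<alpha>)) \<bullet>\<^bsub>E\<^esub> DComp G (FOb (F1 F) \<beta>, FOb (F1 F) \<alpha>)"
  "a \<in> Ob (C0 D) \<Longrightarrow> DUnit (dblfun_comp D E G F) a =
    FAr (F1 G) (DUnit F a) \<bullet>\<^bsub>E\<^esub> DUnit G (FOb (F0 F) a)"
  by (simp_all add: dblfun_comp_def)

text \<open>Each coherence axiom of the composite is the \<open>G\<close>-image of the axiom for
  \<open>F\<close>, pasted with the axiom for \<open>G\<close> at objects in the image of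
  \<open>F\<close>. Naturality of the comparison squares of \<open>G\<close>, applied to comparison
  squares of \<open>F\<close>, brings the factors into the order in which the two axioms can be
  used.\<close>

lemma double_functor_dblfun_comp:
  assumes F: "double_functor D E F" and G: "double_functor E K G"
  shows "double_functor D K (dblfun_comp D K G F)"
proof -
  interpret F: double_functor D E F by fact
  interpret G: double_functor E K G by fact
  let ?f = "FAr (F1 F)" and ?g = "FAr (F1 G)" and ?fo = "FOb (F1 F)" and ?go = "FOb (F1 G)"
  let ?id = "Id (C1 K)"
  show ?thesis
  proof (intro double_functor.intro double_functor_axioms.intro, unfold dblfun_comp_simps(1,2))
    show "double_category D" "double_category K"
      by (rule F.D.double_category_axioms G.E.double_category_axioms)+
    show "is_functor (C0 D) (C0 K) (ftor_comp (C0 D) (F0 G) (F0 F))"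
      "is_functor (C1 D) (C1 K) (ftor_comp (C1 D) (F1 G) (F1 F))"
      by (blast intro: is_functor_ftor_comp F.functor0 F.functor1 G.functor0 G.functor1)+
    show "DComp (dblfun_comp D K G F) \<in> extensional (Ob (pullback D))"
      "DUnit (dblfun_comp D K G F) \<in> extensional (Ob (C0 D))"
      by (simp_all add: dblfun_comp_def split_def)
  next
    fix \<alpha> \<beta> assume *: "(\<beta>, \<alpha>) \<in> Ob (pullback D)"
    show "globular_iso K (DComp (dblfun_comp D K G F) (\<beta>, \<alpha>))
      (FOb (ftor_comp (C1 D) (F1 G) (F1 F)) \<beta> \<odot>\<^bsub>K\<^esub> FOb (ftor_comp (C1 D) (F1 G) (F1 F)) \<alpha>)
      (FOb (ftor_comp (C1 D) (F1 G) (F1 F)) (\<beta> \<odot>\<^bsub>D\<^esub> \<alpha>))"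
      using * G.comp_iso[of "?fo \<beta>" "?fo \<alpha>"] G.pres_globular_iso[OF F.comp_iso[OF *]]
      by (simp add: dblfun_comp_simps G.E.globular_iso_vsq)
  next
    fix a assume *: "a \<in> Ob (C0 D)"
    then show "globular_iso K (DUnit (dblfun_comp D K G F) a)
      (FOb (IdF K) (FOb (ftor_comp (C0 D) (F0 G) (F0 F)) a))
      (FOb (ftor_comp (C1 D) (F1 G) (F1 F)) (FOb (IdF D) a))"
      using G.unit_iso[of "FOb (F0 F) a"] G.pres_globular_iso[OF F.unit_iso[OF *]]
      by (simp add: dblfun_comp_simps G.E.globular_iso_vsq)
  next
    fix \<Psi> \<Phi> assume *: "(\<Psi>, \<Phi>) \<in> Ar (pullback D)"
    note ob = F.D.hcomposable_objects[of \<Psi> \<Phi>]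
    have "?g (?f (\<Psi> \<ast>\<^bsub>D\<^esub> \<Phi>)) \<bullet>\<^bsub>K\<^esub> ?g (DComp F (Dom (C1 D) \<Psi>, Dom (C1 D) \<Phi>)) =
      ?g (DComp F (Cod (C1 D) \<Psi>, Cod (C1 D) \<Phi>)) \<bullet>\<^bsub>K\<^esub> ?g (?f \<Psi> \<ast>\<^bsub>E\<^esub> ?f \<Phi>)"
      using arg_cong[OF F.comp_natural[OF *], of ?g] * ob by simp
    then show "DComp (dblfun_comp D K G F) (Cod (C1 D) \<Psi>, Cod (C1 D) \<Phi>) \<bullet>\<^bsub>K\<^esub>
      (FAr (ftor_comp (C1 D) (F1 G) (F1 F)) \<Psi> \<ast>\<^bsub>K\<^esub> FAr (ftor_comp (C1 D) (F1 G) (F1 F)) \<Phi>) =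
      FAr (ftor_comp (C1 D) (F1 G) (F1 F)) (\<Psi> \<ast>\<^bsub>D\<^esub> \<Phi>) \<bullet>\<^bsub>K\<^esub>
      DComp (dblfun_comp D K G F) (Dom (C1 D) \<Psi>, Dom (C1 D) \<Phi>)"
      using * ob G.comp_natural[of "?f \<Psi>" "?f \<Phi>"]
        G.E.vsq_assoc[of "DComp G (?fo (Dom (C1 D) \<Psi>), ?fo (Dom (C1 D) \<Phi>))"
          "?g (DComp F (Dom (C1 D) \<Psi>, Dom (C1 D) \<Phi>))" "?g (?f (\<Psi> \<ast>\<^bsub>D\<^esub> \<Phi>))", symmetric]
      by (simp add: dblfun_comp_simps G.E.vsq_assoc)
  next
    fix h assume *: "h \<in> Ar (C0 D)"
    have "?g (?f (FAr (IdF D) h)) \<bullet>\<^bsub>K\<^esub> ?g (DUnit F (Dom (C0 D) h)) =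
      ?g (DUnit F (Cod (C0 D) h)) \<bullet>\<^bsub>K\<^esub> ?g (FAr (IdF E) (FAr (F0 F) h))"
      using arg_cong[OF F.unit_natural[OF *], of ?g] * by simp
    then show "DUnit (dblfun_comp D K G F) (Cod (C0 D) h) \<bullet>\<^bsub>K\<^esub>
      FAr (IdF K) (FAr (ftor_comp (C0 D) (F0 G) (F0 F)) h) =
      FAr (ftor_comp (C1 D) (F1 G) (F1 F)) (FAr (IdF D) h) \<bullet>\<^bsub>K\<^esub>
      DUnit (dblfun_comp D K G F) (Dom (C0 D) h)"
      using * G.unit_natural[of "FAr (F0 F) h"]
        G.E.vsq_assoc[of "DUnit G (FOb (F0 F) (Dom (C0 D) h))"
          "?g (DUnit F (Dom (C0 D) h))" "?g (?f (FAr (IdF D) h))", symmetric]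
      by (simp add: dblfun_comp_simps G.E.vsq_assoc)
  next
    fix \<alpha> \<beta> \<gamma> assume "(\<gamma>, \<beta>) \<in> Ob (pullback D)" "(\<beta>, \<alpha>) \<in> Ob (pullback D)"
    then have *: "\<gamma> \<in> Ob (C1 D)" "\<beta> \<in> Ob (C1 D)" "\<alpha> \<in> Ob (C1 D)"
      "FOb (TrgF D) \<beta> = FOb (SrcF D) \<gamma>" "FOb (TrgF D) \<alpha> = FOb (SrcF D) \<beta>"
      by simp_all
    \<comment> \<open>\<open>nat1\<close> and \<open>nat2\<close> exchange a comparison square of
      \<open>G\<close> with the \<open>G\<close>-image of a whiskered comparison square of
      \<open>F\<close>. \<open>cF\<close> is the associativity coherence of \<open>F\<close> after
      applying \<open>G\<close>, and \<open>cG\<close> is that of \<open>G\<close> at the images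
      under \<open>F\<close>.\<close>
    have nat1: "DComp G (?fo (\<gamma> \<odot>\<^bsub>D\<^esub> \<beta>), ?fo \<alpha>) \<bullet>\<^bsub>K\<^esub> (?g (DComp F (\<gamma>, \<beta>)) \<ast>\<^bsub>K\<^esub> ?id (?go (?fo \<alpha>)))
      = ?g (DComp F (\<gamma>, \<beta>) \<ast>\<^bsub>E\<^esub> Id (C1 E) (?fo \<alpha>)) \<bullet>\<^bsub>K\<^esub> DComp G (?fo \<gamma> \<odot>\<^bsub>E\<^esub> ?fo \<beta>, ?fo \<alpha>)"
      using G.comp_natural[of "DComp F (\<gamma>, \<beta>)" "Id (C1 E) (?fo \<alpha>)"] * by simp
    have nat2: "DComp G (?fo \<gamma>, ?fo (\<beta> \<odot>\<^bsub>D\<^esub> \<alpha>)) \<bullet>\<^bsub>K\<^esub> (?id (?go (?fo \<gamma>)) \<ast>\<^bsub>K\<^esub> ?g (DComp F (\<beta>, \<alpha>)))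
      = ?g (Id (C1 E) (?fo \<gamma>) \<ast>\<^bsub>E\<^esub> DComp F (\<beta>, \<alpha>)) \<bullet>\<^bsub>K\<^esub> DComp G (?fo \<gamma>, ?fo \<beta> \<odot>\<^bsub>E\<^esub> ?fo \<alpha>)"
      using G.comp_natural[of "Id (C1 E) (?fo \<gamma>)" "DComp F (\<beta>, \<alpha>)"] * by simp
    have cF: "?g (?f (Asc D \<gamma> \<beta> \<alpha>)) \<bullet>\<^bsub>K\<^esub> (?g (DComp F (\<gamma> \<odot>\<^bsub>D\<^esub> \<beta>, \<alpha>)) \<bullet>\<^bsub>K\<^esub>
        ?g (DComp F (\<gamma>, \<beta>) \<ast>\<^bsub>E\<^esub> Id (C1 E) (?fo \<alpha>)))
      = ?g (DComp F (\<gamma>, \<beta> \<odot>\<^bsub>D\<^esub> \<alpha>)) \<bullet>\<^bsub>K\<^esub> (?g (Id (C1 E) (?fo \<gamma>) \<ast>\<^bsub>E\<^esub> DComp F (\<beta>, \<alpha>)) \<bullet>\<^bsub>K\<^esub>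
        ?g (Asc E (?fo \<gamma>) (?fo \<beta>) (?fo \<alpha>)))"
      using arg_cong[OF F.asc_coherence[of \<gamma> \<beta> \<alpha>], of ?g] * by simp
    have cG: "?g (Asc E (?fo \<gamma>) (?fo \<beta>) (?fo \<alpha>)) \<bullet>\<^bsub>K\<^esub> (DComp G (?fo \<gamma> \<odot>\<^bsub>E\<^esub> ?fo \<beta>, ?fo \<alpha>) \<bullet>\<^bsub>K\<^esub>
        (DComp G (?fo \<gamma>, ?fo \<beta>) \<ast>\<^bsub>K\<^esub> ?id (?go (?fo \<alpha>))))
      = DComp G (?fo \<gamma>, ?fo \<beta> \<odot>\<^bsub>E\<^esub> ?fo \<alpha>) \<bullet>\<^bsub>K\<^esub> ((?id (?go (?fo \<gamma>)) \<ast>\<^bsub>K\<^esub> DComp G (?fo \<beta>, ?fo \<alpha>))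
        \<bullet>\<^bsub>K\<^esub> Asc K (?go (?fo \<gamma>)) (?go (?fo \<beta>)) (?go (?fo \<alpha>)))"
      using G.asc_coherence[of "?fo \<gamma>" "?fo \<beta>" "?fo \<alpha>"] * by simp
    let ?R = "DComp G (?fo \<gamma> \<odot>\<^bsub>E\<^esub> ?fo \<beta>, ?fo \<alpha>) \<bullet>\<^bsub>K\<^esub>
        (DComp G (?fo \<gamma>, ?fo \<beta>) \<ast>\<^bsub>K\<^esub> ?id (?go (?fo \<alpha>)))"
    let ?A = "Asc K (?go (?fo \<gamma>)) (?go (?fo \<beta>)) (?go (?fo \<alpha>))"
    let ?u = "?g (DComp F (\<gamma> \<odot>\<^bsub>D\<^esub> \<beta>, \<alpha>))" and ?v = "?g (DComp F (\<gamma>, \<beta> \<odot>\<^bsub>D\<^esub> \<alpha>))"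
    have "?g (?f (Asc D \<gamma> \<beta> \<alpha>)) \<bullet>\<^bsub>K\<^esub> ((?u \<bullet>\<^bsub>K\<^esub> DComp G (?fo (\<gamma> \<odot>\<^bsub>D\<^esub> \<beta>), ?fo \<alpha>)) \<bullet>\<^bsub>K\<^esub>
        ((?g (DComp F (\<gamma>, \<beta>)) \<bullet>\<^bsub>K\<^esub> DComp G (?fo \<gamma>, ?fo \<beta>)) \<ast>\<^bsub>K\<^esub> ?id (?go (?fo \<alpha>))))
      = ?g (?f (Asc D \<gamma> \<beta> \<alpha>)) \<bullet>\<^bsub>K\<^esub> (?u \<bullet>\<^bsub>K\<^esub> (DComp G (?fo (\<gamma> \<odot>\<^bsub>D\<^esub> \<beta>), ?fo \<alpha>) \<bullet>\<^bsub>K\<^esub>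
        ((?g (DComp F (\<gamma>, \<beta>)) \<ast>\<^bsub>K\<^esub> ?id (?go (?fo \<alpha>))) \<bullet>\<^bsub>K\<^esub>
          (DComp G (?fo \<gamma>, ?fo \<beta>) \<ast>\<^bsub>K\<^esub> ?id (?go (?fo \<alpha>))))))"
      using * by (simp add: G.E.vsq_assoc G.E.interchange_id_right)
    also have "\<dots> = ?g (?f (Asc D \<gamma> \<beta> \<alpha>)) \<bullet>\<^bsub>K\<^esub> (?u \<bullet>\<^bsub>K\<^esub>
        (?g (DComp F (\<gamma>, \<beta>) \<ast>\<^bsub>E\<^esub> Id (C1 E) (?fo \<alpha>)) \<bullet>\<^bsub>K\<^esub> ?R))"
      using * by (subst G.E.vsq_shift[OF nat1]) simp_all
    also have "\<dots> = (?g (?f (Asc D \<gamma> \<beta> \<alpha>)) \<bullet>\<^bsub>K\<^esub> (?u \<bullet>\<^bsub>K\<^esub>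
        ?g (DComp F (\<gamma>, \<beta>) \<ast>\<^bsub>E\<^esub> Id (C1 E) (?fo \<alpha>)))) \<bullet>\<^bsub>K\<^esub> ?R"
      using * by (simp add: G.E.vsq_assoc)
    \<comment> \<open>Rewriting with \<open>cF\<close> leaves the image of the associator of
      \<open>E\<close> directly in front of \<open>?R\<close>; this is the left side of
      \<open>cG\<close>, used in the next step.\<close>
    also have "\<dots> = ?v \<bullet>\<^bsub>K\<^esub> (?g (Id (C1 E) (?fo \<gamma>) \<ast>\<^bsub>E\<^esub> DComp F (\<beta>, \<alpha>)) \<bullet>\<^bsub>K\<^esub>
        (?g (Asc E (?fo \<gamma>) (?fo \<beta>) (?fo \<alpha>)) \<bullet>\<^bsub>K\<^esub> ?R))"
      unfolding cF using * by (simp add: G.E.vsq_assoc)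
    also have "\<dots> = ?v \<bullet>\<^bsub>K\<^esub> (DComp G (?fo \<gamma>, ?fo (\<beta> \<odot>\<^bsub>D\<^esub> \<alpha>)) \<bullet>\<^bsub>K\<^esub>
        ((?id (?go (?fo \<gamma>)) \<ast>\<^bsub>K\<^esub> ?g (DComp F (\<beta>, \<alpha>))) \<bullet>\<^bsub>K\<^esub>
          ((?id (?go (?fo \<gamma>)) \<ast>\<^bsub>K\<^esub> DComp G (?fo \<beta>, ?fo \<alpha>)) \<bullet>\<^bsub>K\<^esub> ?A)))"
      unfolding cG using * by (subst G.E.vsq_shift[OF nat2[symmetric]]) simp_all
    finally show "FAr (ftor_comp (C1 D) (F1 G) (F1 F)) (Asc D \<gamma> \<beta> \<alpha>) \<bullet>\<^bsub>K\<^esub>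
      (DComp (dblfun_comp D K G F) (\<gamma> \<odot>\<^bsub>D\<^esub> \<beta>, \<alpha>) \<bullet>\<^bsub>K\<^esub>
        (DComp (dblfun_comp D K G F) (\<gamma>, \<beta>) \<ast>\<^bsub>K\<^esub> ?id (FOb (ftor_comp (C1 D) (F1 G) (F1 F)) \<alpha>)))
      = DComp (dblfun_comp D K G F) (\<gamma>, \<beta> \<odot>\<^bsub>D\<^esub> \<alpha>) \<bullet>\<^bsub>K\<^esub>
      ((?id (FOb (ftor_comp (C1 D) (F1 G) (F1 F)) \<gamma>) \<ast>\<^bsub>K\<^esub> DComp (dblfun_comp D K G F) (\<beta>, \<alpha>)) \<bullet>\<^bsub>K\<^esub>
        Asc K (FOb (ftor_comp (C1 D) (F1 G) (F1 F)) \<gamma>) (FOb (ftor_comp (C1 D) (F1 G) (F1 F)) \<beta>)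
          (FOb (ftor_comp (C1 D) (F1 G) (F1 F)) \<alpha>))"
      using * by (simp add: dblfun_comp_simps G.E.vsq_assoc G.E.interchange_id_left)
  next
    fix \<alpha> b assume *: "\<alpha> \<in> Ob (C1 D)" "b = FOb (TrgF D) \<alpha>"
    have nat: "DComp G (?fo (FOb (IdF D) b), ?fo \<alpha>) \<bullet>\<^bsub>K\<^esub> (?g (DUnit F b) \<ast>\<^bsub>K\<^esub> ?id (?go (?fo \<alpha>)))
      = ?g (DUnit F b \<ast>\<^bsub>E\<^esub> Id (C1 E) (?fo \<alpha>)) \<bullet>\<^bsub>K\<^esub> DComp G (FOb (IdF E) (FOb (F0 F) b), ?fo \<alpha>)"
      using G.comp_natural[of "DUnit F b" "Id (C1 E) (?fo \<alpha>)"] * by simp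
    \<comment> \<open>The unit coherence of \<open>F\<close> collapses the first bracket to the
      \<open>G\<close>-image of the unitor of \<open>E\<close>, which is where the unit coherence of
      \<open>G\<close> begins.\<close>
    have cF: "?g (?f (LUn D \<alpha>)) \<bullet>\<^bsub>K\<^esub> (?g (DComp F (FOb (IdF D) b, \<alpha>)) \<bullet>\<^bsub>K\<^esub>
        ?g (DUnit F b \<ast>\<^bsub>E\<^esub> Id (C1 E) (?fo \<alpha>))) = ?g (LUn E (?fo \<alpha>))"
      using arg_cong[OF F.lun_coherence[of \<alpha> b], of ?g] * by simp
    have cG: "?g (LUn E (?fo \<alpha>)) \<bullet>\<^bsub>K\<^esub> (DComp G (FOb (IdF E) (FOb (F0 F) b), ?fo \<alpha>) \<bullet>\<^bsub>K\<^esub>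
        (DUnit G (FOb (F0 F) b) \<ast>\<^bsub>K\<^esub> ?id (?go (?fo \<alpha>)))) = LUn K (?go (?fo \<alpha>))"
      using G.lun_coherence[of "?fo \<alpha>"] * by simp
    let ?R = "DUnit G (FOb (F0 F) b) \<ast>\<^bsub>K\<^esub> ?id (?go (?fo \<alpha>))"
    let ?u = "?g (DComp F (FOb (IdF D) b, \<alpha>))"
    have "?g (?f (LUn D \<alpha>)) \<bullet>\<^bsub>K\<^esub> ((?u \<bullet>\<^bsub>K\<^esub> DComp G (?fo (FOb (IdF D) b), ?fo \<alpha>)) \<bullet>\<^bsub>K\<^esub>
        ((?g (DUnit F b) \<bullet>\<^bsub>K\<^esub> DUnit G (FOb (F0 F) b)) \<ast>\<^bsub>K\<^esub> ?id (?go (?fo \<alpha>))))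
      = ?g (?f (LUn D \<alpha>)) \<bullet>\<^bsub>K\<^esub> (?u \<bullet>\<^bsub>K\<^esub> (DComp G (?fo (FOb (IdF D) b), ?fo \<alpha>) \<bullet>\<^bsub>K\<^esub>
        ((?g (DUnit F b) \<ast>\<^bsub>K\<^esub> ?id (?go (?fo \<alpha>))) \<bullet>\<^bsub>K\<^esub> ?R)))"
      using * by (simp add: G.E.vsq_assoc G.E.interchange_id_right)
    also have "\<dots> = ?g (?f (LUn D \<alpha>)) \<bullet>\<^bsub>K\<^esub> (?u \<bullet>\<^bsub>K\<^esub> (?g (DUnit F b \<ast>\<^bsub>E\<^esub> Id (C1 E) (?fo \<alpha>))
        \<bullet>\<^bsub>K\<^esub> (DComp G (FOb (IdF E) (FOb (F0 F) b), ?fo \<alpha>) \<bullet>\<^bsub>K\<^esub> ?R)))"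
      using * by (subst G.E.vsq_shift[OF nat]) simp_all
    also have "\<dots> = (?g (?f (LUn D \<alpha>)) \<bullet>\<^bsub>K\<^esub> (?u \<bullet>\<^bsub>K\<^esub> ?g (DUnit F b \<ast>\<^bsub>E\<^esub> Id (C1 E) (?fo \<alpha>))))
        \<bullet>\<^bsub>K\<^esub> (DComp G (FOb (IdF E) (FOb (F0 F) b), ?fo \<alpha>) \<bullet>\<^bsub>K\<^esub> ?R)"
      using * by (simp add: G.E.vsq_assoc)
    also have "\<dots> = LUn K (?go (?fo \<alpha>))"
      unfolding cF cG ..
    finally show "FAr (ftor_comp (C1 D) (F1 G) (F1 F)) (LUn D \<alpha>) \<bullet>\<^bsub>K\<^esub>
      (DComp (dblfun_comp D K G F) (FOb (IdF D) b, \<alpha>) \<bullet>\<^bsub>K\<^esub>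
        (DUnit (dblfun_comp D K G F) b \<ast>\<^bsub>K\<^esub> ?id (FOb (ftor_comp (C1 D) (F1 G) (F1 F)) \<alpha>)))
      = LUn K (FOb (ftor_comp (C1 D) (F1 G) (F1 F)) \<alpha>)"
      using * by (simp add: dblfun_comp_simps)
  next
    fix \<alpha> a assume *: "\<alpha> \<in> Ob (C1 D)" "a = FOb (SrcF D) \<alpha>"
    have nat: "DComp G (?fo \<alpha>, ?fo (FOb (IdF D) a)) \<bullet>\<^bsub>K\<^esub> (?id (?go (?fo \<alpha>)) \<ast>\<^bsub>K\<^esub> ?g (DUnit F a))
      = ?g (Id (C1 E) (?fo \<alpha>) \<ast>\<^bsub>E\<^esub> DUnit F a) \<bullet>\<^bsub>K\<^esub> DComp G (?fo \<alpha>, FOb (IdF E) (FOb (F0 F) a))"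
      using G.comp_natural[of "Id (C1 E) (?fo \<alpha>)" "DUnit F a"] * by simp
    have cF: "?g (?f (RUn D \<alpha>)) \<bullet>\<^bsub>K\<^esub> (?g (DComp F (\<alpha>, FOb (IdF D) a)) \<bullet>\<^bsub>K\<^esub>
        ?g (Id (C1 E) (?fo \<alpha>) \<ast>\<^bsub>E\<^esub> DUnit F a)) = ?g (RUn E (?fo \<alpha>))"
      using arg_cong[OF F.run_coherence[of \<alpha> a], of ?g] * by simp
    have cG: "?g (RUn E (?fo \<alpha>)) \<bullet>\<^bsub>K\<^esub> (DComp G (?fo \<alpha>, FOb (IdF E) (FOb (F0 F) a)) \<bullet>\<^bsub>K\<^esub>
        (?id (?go (?fo \<alpha>)) \<ast>\<^bsub>K\<^esub> DUnit G (FOb (F0 F) a))) = RUn K (?go (?fo \<alpha>))"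
      using G.run_coherence[of "?fo \<alpha>"] * by simp
    let ?R = "?id (?go (?fo \<alpha>)) \<ast>\<^bsub>K\<^esub> DUnit G (FOb (F0 F) a)"
    let ?u = "?g (DComp F (\<alpha>, FOb (IdF D) a))"
    have "?g (?f (RUn D \<alpha>)) \<bullet>\<^bsub>K\<^esub> ((?u \<bullet>\<^bsub>K\<^esub> DComp G (?fo \<alpha>, ?fo (FOb (IdF D) a))) \<bullet>\<^bsub>K\<^esub>
        (?id (?go (?fo \<alpha>)) \<ast>\<^bsub>K\<^esub> (?g (DUnit F a) \<bullet>\<^bsub>K\<^esub> DUnit G (FOb (F0 F) a))))
      = ?g (?f (RUn D \<alpha>)) \<bullet>\<^bsub>K\<^esub> (?u \<bullet>\<^bsub>K\<^esub> (DComp G (?fo \<alpha>, ?fo (FOb (IdF D) a)) \<bullet>\<^bsub>K\<^esub>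
        ((?id (?go (?fo \<alpha>)) \<ast>\<^bsub>K\<^esub> ?g (DUnit F a)) \<bullet>\<^bsub>K\<^esub> ?R)))"
      using * by (simp add: G.E.vsq_assoc G.E.interchange_id_left)
    also have "\<dots> = ?g (?f (RUn D \<alpha>)) \<bullet>\<^bsub>K\<^esub> (?u \<bullet>\<^bsub>K\<^esub> (?g (Id (C1 E) (?fo \<alpha>) \<ast>\<^bsub>E\<^esub> DUnit F a)
        \<bullet>\<^bsub>K\<^esub> (DComp G (?fo \<alpha>, FOb (IdF E) (FOb (F0 F) a)) \<bullet>\<^bsub>K\<^esub> ?R)))"
      using * by (subst G.E.vsq_shift[OF nat]) simp_all
    also have "\<dots> = (?g (?f (RUn D \<alpha>)) \<bullet>\<^bsub>K\<^esub> (?u \<bullet>\<^bsub>K\<^esub> ?g (Id (C1 E) (?fo \<alpha>) \<ast>\<^bsub>E\<^esub> DUnit F a)))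
        \<bullet>\<^bsub>K\<^esub> (DComp G (?fo \<alpha>, FOb (IdF E) (FOb (F0 F) a)) \<bullet>\<^bsub>K\<^esub> ?R)"
      using * by (simp add: G.E.vsq_assoc)
    also have "\<dots> = RUn K (?go (?fo \<alpha>))"
      unfolding cF cG ..
    finally show "FAr (ftor_comp (C1 D) (F1 G) (F1 F)) (RUn D \<alpha>) \<bullet>\<^bsub>K\<^esub>
      (DComp (dblfun_comp D K G F) (\<alpha>, FOb (IdF D) a) \<bullet>\<^bsub>K\<^esub>
        (?id (FOb (ftor_comp (C1 D) (F1 G) (F1 F)) \<alpha>) \<ast>\<^bsub>K\<^esub> DUnit (dblfun_comp D K G F) a))
      = RUn K (FOb (ftor_comp (C1 D) (F1 G) (F1 F)) \<alpha>)"
      using * by (simp add: dblfun_comp_simps)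
  qed (simp_all add: ext_ftor_comp)
qed


section \<open>The categories of double categories and of decorated bicategories\<close>

lemma dblfun_eqI:
  assumes F: "double_functor D E F" and G: "double_functor D E G"
    and "\<And>a. a \<in> Ob (C0 D) \<Longrightarrow> FOb (F0 F) a = FOb (F0 G) a"
    and "\<And>f. f \<in> Ar (C0 D) \<Longrightarrow> FAr (F0 F) f = FAr (F0 G) f"
    and "\<And>\<alpha>. \<alpha> \<in> Ob (C1 D) \<Longrightarrow> FOb (F1 F) \<alpha> = FOb (F1 G) \<alpha>"
    and "\<And>\<Phi>. \<Phi> \<in> Ar (C1 D) \<Longrightarrow> FAr (F1 F) \<Phi> = FAr (F1 G) \<Phi>"
    and comp: "\<And>\<beta> \<alpha>. (\<beta>, \<alpha>) \<in> Ob (pullback D) \<Longrightarrow> DComp F (\<beta>, \<alpha>) = DComp G (\<beta>, \<alpha>)"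
    and unit: "\<And>a. a \<in> Ob (C0 D) \<Longrightarrow> DUnit F a = DUnit G a"
  shows "F = G"
proof -
  have "F0 F = F0 G" "F1 F = F1 G"
    using assms double_functor.ext0[OF F] double_functor.ext0[OF G]
      double_functor.ext1[OF F] double_functor.ext1[OF G]
    by (auto intro: ftor_eqI)
  moreover have "DComp F = DComp G"
    using comp by (intro extensionalityI[OF double_functor.ext_comp[OF F] double_functor.ext_comp[OF G]])
      auto
  moreover have "DUnit F = DUnit G"
    using unit by (intro extensionalityI[OF double_functor.ext_unit[OF F] double_functor.ext_unit[OF G]])
      auto
  ultimately show ?thesis
    by simp
qed

lemma dblfun_id_simps:
  "F0 (dblfun_id D) = ftor_id (C0 D)"
  "F1 (dblfun_id D) = ftor_id (C1 D)"
  "(\<beta>, \<alpha>) \<in> Ob (pullback D) \<Longrightarrow> DComp (dblfun_id D) (\<beta>, \<alpha>) = Id (C1 D) (\<beta> \<odot>\<^bsub>D\<^esub> \<alpha>)"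
  "a \<in> Ob (C0 D) \<Longrightarrow> DUnit (dblfun_id D) a = Id (C1 D) (FOb (IdF D) a)"
  by (simp_all add: dblfun_id_def)

lemma (in double_category) double_functor_dblfun_id: "double_functor D D (dblfun_id D)"
proof (intro double_functor.intro double_functor_axioms.intro, unfold dblfun_id_simps(1,2))
  show "DComp (dblfun_id D) \<in> extensional (Ob (pullback D))"
    "DUnit (dblfun_id D) \<in> extensional (Ob (C0 D))"
    by (simp_all add: dblfun_id_def split_def)
next
  fix \<Psi> \<Phi> assume *: "(\<Psi>, \<Phi>) \<in> Ar (pullback D)"
  then show "DComp (dblfun_id D) (Cod (C1 D) \<Psi>, Cod (C1 D) \<Phi>) \<bullet>
      (FAr (ftor_id (C1 D)) \<Psi> \<ast> FAr (ftor_id (C1 D)) \<Phi>)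
    = FAr (ftor_id (C1 D)) (\<Psi> \<ast> \<Phi>) \<bullet> DComp (dblfun_id D) (Dom (C1 D) \<Psi>, Dom (C1 D) \<Phi>)"
    using hcomposable_objects[of \<Psi> \<Phi>] by (simp add: dblfun_id_simps)
qed (auto simp: dblfun_id_simps is_functor_ftor_id ext_ftor_id globular_iso_Id
      V0.category_axioms V1.category_axioms double_category_axioms)

lemma dblfun_comp_id_left:
  assumes F: "double_functor D E F"
  shows "dblfun_comp D E (dblfun_id E) F = F"
proof -
  interpret double_functor D E F by fact
  show ?thesis
    by (rule dblfun_eqI[OF double_functor_dblfun_comp[OF F E.double_functor_dblfun_id] F])
      (simp_all add: dblfun_comp_simps dblfun_id_simps)
qed

lemma dblfun_comp_id_right:
  assumes F: "double_functor D E F"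
  shows "dblfun_comp D E F (dblfun_id D) = F"
proof -
  interpret double_functor D E F by fact
  show ?thesis
    by (rule dblfun_eqI[OF double_functor_dblfun_comp[OF D.double_functor_dblfun_id F] F])
      (simp_all add: dblfun_comp_simps dblfun_id_simps)
qed

lemma dblfun_comp_assoc:
  assumes F: "double_functor A B F" and G: "double_functor B C G" and H: "double_functor C D H"
  shows "dblfun_comp A D (dblfun_comp B D H G) F = dblfun_comp A D H (dblfun_comp A C G F)"
proof -
  interpret F: double_functor A B F by fact
  interpret G: double_functor B C G by fact
  interpret H: double_functor C D H by fact
  note FG = double_functor_dblfun_comp[OF F G] and GH = double_functor_dblfun_comp[OF G H]
  show ?thesis
    by (rule dblfun_eqI[OF double_functor_dblfun_comp[OF F GH] double_functor_dblfun_comp[OF FG H]])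
      (simp_all add: dblfun_comp_simps H.E.vsq_assoc)
qed

lemma category_gCat: "category gCat"
  by unfold_locales
    (auto simp: gCat_def double_category.double_functor_dblfun_id double_functor_dblfun_comp
      dblfun_comp_id_left dblfun_comp_id_right dblfun_comp_assoc dest: double_functor.axioms(1,2))

section \<open>The category of horizontally composable pairs\<close>

lemma pullback_simps [simp]:
  "Dom (pullback D) (\<Psi>, \<Phi>) = (Dom (C1 D) \<Psi>, Dom (C1 D) \<Phi>)"
  "Cod (pullback D) (\<Psi>, \<Phi>) = (Cod (C1 D) \<Psi>, Cod (C1 D) \<Phi>)"
  "Id (pullback D) (\<beta>, \<alpha>) = (Id (C1 D) \<beta>, Id (C1 D) \<alpha>)"
  "(\<Psi>', \<Phi>') \<cdot>\<^bsub>pullback D\<^esub> (\<Psi>, \<Phi>) = (\<Psi>' \<bullet>\<^bsub>D\<^esub> \<Psi>, \<Phi>' \<bullet>\<^bsub>D\<^esub> \<Phi>)"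
  by (simp_all add: pullback_def)

text \<open>Only the two edge functors are assumed, because the result is used while
  \<open>vdisc B\<close> and \<open>freeQ B\<close> are still being shown to be double categories:
  functoriality of \<open>HorF\<close> presupposes it. Functoriality of the edges keeps identities
  and composites of composable pairs composable.\<close>

lemma category_pullback:
  assumes "is_functor (C1 D) (C0 D) (SrcF D)" and "is_functor (C1 D) (C0 D) (TrgF D)"
  shows "category (pullback D)"
proof -
  interpret S: is_functor "C1 D" "C0 D" "SrcF D" by fact
  interpret T: is_functor "C1 D" "C0 D" "TrgF D" by fact
  have ob: "(\<beta>, \<alpha>) \<in> Ob (pullback D) \<longleftrightarrow>
    \<beta> \<in> Ob (C1 D) \<and> \<alpha> \<in> Ob (C1 D) \<and> FOb (TrgF D) \<alpha> = FOb (SrcF D) \<beta>" for \<alpha> \<beta>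
    by (simp add: pullback_def)
  have ar: "(\<Psi>, \<Phi>) \<in> Ar (pullback D) \<longleftrightarrow>
    \<Psi> \<in> Ar (C1 D) \<and> \<Phi> \<in> Ar (C1 D) \<and> FAr (TrgF D) \<Phi> = FAr (SrcF D) \<Psi>" for \<Phi> \<Psi>
    by (simp add: pullback_def)
  note C = S.A.dom_ob S.A.cod_ob S.A.id_ar S.A.dom_id S.A.cod_id S.A.comp_ar S.A.dom_comp
    S.A.cod_comp S.A.comp_id_left S.A.comp_id_right S.A.comp_assoc
  show ?thesis
  proof
    fix f assume f: "f \<in> Ar (pullback D)"
    then show "Dom (pullback D) f \<in> Ob (pullback D)" "Cod (pullback D) f \<in> Ob (pullback D)"
      by (cases f; simp add: ob ar C S.dom[symmetric] T.dom[symmetric] S.cod[symmetric]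
          T.cod[symmetric])+
    show "Id (pullback D) (Cod (pullback D) f) \<cdot>\<^bsub>pullback D\<^esub> f = f"
      "f \<cdot>\<^bsub>pullback D\<^esub> Id (pullback D) (Dom (pullback D) f) = f"
      using f by (cases f; simp add: ar C vsq_def)+
  next
    fix f g assume "f \<in> Ar (pullback D)" "g \<in> Ar (pullback D)"
      "Cod (pullback D) f = Dom (pullback D) g"
    then show "g \<cdot>\<^bsub>pullback D\<^esub> f \<in> Ar (pullback D)"
      "Dom (pullback D) (g \<cdot>\<^bsub>pullback D\<^esub> f) = Dom (pullback D) f"
      "Cod (pullback D) (g \<cdot>\<^bsub>pullback D\<^esub> f) = Cod (pullback D) g"
      by (cases f, cases g, simp add: ar C vsq_def S.pres_comp T.pres_comp)+
  next
    fix f g h assume "f \<in> Ar (pullback D)" "g \<in> Ar (pullback D)" "h \<in> Ar (pullback D)"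
      "Cod (pullback D) f = Dom (pullback D) g" "Cod (pullback D) g = Dom (pullback D) h"
    then show "(h \<cdot>\<^bsub>pullback D\<^esub> g) \<cdot>\<^bsub>pullback D\<^esub> f = h \<cdot>\<^bsub>pullback D\<^esub> (g \<cdot>\<^bsub>pullback D\<^esub> f)"
      by (cases f, cases g, cases h) (simp add: ar C vsq_def)
  next
    fix a assume "a \<in> Ob (pullback D)"
    then show "Id (pullback D) a \<in> Ar (pullback D)"
      "Dom (pullback D) (Id (pullback D) a) = a" "Cod (pullback D) (Id (pullback D) a) = a"
      by (cases a, simp add: ob ar C S.pres_id T.pres_id)+
  qed
qed

text \<open>
  A bicategory is a double category with only identity vertical morphisms.  Composites and
  coherence of pseudofunctors are thereby obtained from those of double functors.
\<close>

definition vdisc :: "('o, 'h, 'c, 'x) bicat_scheme \<Rightarrow> ('o, 'o, 'h, 'c) dblcat" where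
  "vdisc B =
    \<lparr>C0 = \<lparr>Ob = Cell0 B, Ar = Cell0 B, Dom = (\<lambda>a. a), Cod = (\<lambda>a. a), Id = (\<lambda>a. a),
       Comp = (\<lambda>b a. a)\<rparr>,
     C1 = Cells B,
     SrcF = \<lparr>FOb = Src B, FAr = (\<lambda>\<phi>. Src B (Dom (Cells B) \<phi>))\<rparr>,
     TrgF = \<lparr>FOb = Trg B, FAr = (\<lambda>\<phi>. Trg B (Dom (Cells B) \<phi>))\<rparr>,
     IdF = \<lparr>FOb = Unit B, FAr = (\<lambda>a. Id (Cells B) (Unit B a))\<rparr>,
     HorF = \<lparr>FOb = (\<lambda>(\<beta>, \<alpha>). \<beta> \<star>\<^bsub>B\<^esub> \<alpha>), FAr = (\<lambda>(\<psi>, \<phi>). \<psi> \<diamondop>\<^bsub>B\<^esub> \<phi>)\<rparr>,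
     Asc = BAsc B, LUn = BLUn B, RUn = BRUn B\<rparr>"

lemma vdisc_simps [simp]:
  "C1 (vdisc B) = Cells B" "Ob (C0 (vdisc B)) = Cell0 B" "Ar (C0 (vdisc B)) = Cell0 B"
  "Dom (C0 (vdisc B)) a = a" "Cod (C0 (vdisc B)) a = a" "Id (C0 (vdisc B)) a = a"
  "b \<cdot>\<^bsub>C0 (vdisc B)\<^esub> a = a"
  "FOb (SrcF (vdisc B)) = Src B" "FAr (SrcF (vdisc B)) \<phi> = Src B (Dom (Cells B) \<phi>)"
  "FOb (TrgF (vdisc B)) = Trg B" "FAr (TrgF (vdisc B)) \<phi> = Trg B (Dom (Cells B) \<phi>)"
  "FOb (IdF (vdisc B)) = Unit B" "FAr (IdF (vdisc B)) a = Id (Cells B) (Unit B a)"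
  "FOb (HorF (vdisc B)) (\<beta>, \<alpha>) = \<beta> \<star>\<^bsub>B\<^esub> \<alpha>" "FAr (HorF (vdisc B)) (\<psi>, \<phi>) = \<psi> \<diamondop>\<^bsub>B\<^esub> \<phi>"
  "\<beta> \<odot>\<^bsub>vdisc B\<^esub> \<alpha> = \<beta> \<star>\<^bsub>B\<^esub> \<alpha>" "\<psi> \<ast>\<^bsub>vdisc B\<^esub> \<phi> = \<psi> \<diamondop>\<^bsub>B\<^esub> \<phi>" "\<psi> \<bullet>\<^bsub>vdisc B\<^esub> \<phi> = \<psi> \<cdot>\<cdot>\<^bsub>B\<^esub> \<phi>"
  "Asc (vdisc B) = BAsc B" "LUn (vdisc B) = BLUn B" "RUn (vdisc B) = BRUn B"
  by (simp_all add: vdisc_def hmor_def hsq_def vsq_def vcell_def)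

lemma pullback_vdisc [simp]:
  "Ob (pullback (vdisc B)) = hpairs B" "Ar (pullback (vdisc B)) = hpairs2 B"
  by (simp_all add: pullback_def hpairs_def hpairs2_def)

context bicategory
begin

text \<open>Every vertical morphism of \<open>vdisc B\<close> is an identity, so globularity is
  automatic for its squares.\<close>

lemma globular_iso_vdisc: "globular_iso (vdisc B) \<phi> \<alpha> \<beta> \<longleftrightarrow> cell_iso B \<phi> \<alpha> \<beta>"
  by (auto simp: globular_iso_def globular_def cell_iso_def invertible_def inverse_arrows_def
      src_cell0 trg_cell0 category.dom_ob[OF cells])

lemma hpairs2_Dom: "(\<psi>, \<phi>) \<in> hpairs2 B \<Longrightarrow> (Dom (Cells B) \<psi>, Dom (Cells B) \<phi>) \<in> hpairs B"
  by (simp add: hpairs_def hpairs2_def category.dom_ob[OF cells])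

text \<open>Vertical arrows compose only when they are equal, so returning one of the two is their
  composite. Functoriality of the edges amounts to 2-cells having parallel 1-cells as domain and
  codomain; the remaining axioms are those of the bicategory.\<close>

lemma double_category_vdisc: "double_category (vdisc B)"
proof -
  interpret V: category "Cells B" by (rule cells)
  note V = V.dom_ob V.cod_ob V.id_ar V.dom_id V.cod_id V.comp_ar V.dom_comp V.cod_comp
    V.comp_id_left V.comp_id_right
  have [simp]: "category (Cells B)" by (rule cells)
  have [simp]: "category (C0 (vdisc B))"
    by unfold_locales simp_all
  have src: "is_functor (C1 (vdisc B)) (C0 (vdisc B)) (SrcF (vdisc B))"
    by (simp add: is_functor_def is_functor_axioms_def src_cell0 V src_parallel[symmetric])
  have trg: "is_functor (C1 (vdisc B)) (C0 (vdisc B)) (TrgF (vdisc B))"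
    by (simp add: is_functor_def is_functor_axioms_def trg_cell0 V trg_parallel[symmetric])
  show ?thesis
  proof (rule double_category.intro[OF src trg])
    show "is_functor (C0 (vdisc B)) (C1 (vdisc B)) (IdF (vdisc B))"
      using V.comp_id_left[OF V.id_ar]
      by (simp add: is_functor_def is_functor_axioms_def unit_cell V)
    show "is_functor (pullback (vdisc B)) (C1 (vdisc B)) (HorF (vdisc B))"
    proof (intro is_functor.intro is_functor_axioms.intro category_pullback[OF src trg])
      fix f g assume "f \<in> Ar (pullback (vdisc B))" "g \<in> Ar (pullback (vdisc B))"
        "Cod (pullback (vdisc B)) f = Dom (pullback (vdisc B)) g"
      then show "FAr (HorF (vdisc B)) (g \<cdot>\<^bsub>pullback (vdisc B)\<^esub> f)
        = FAr (HorF (vdisc B)) g \<cdot>\<^bsub>C1 (vdisc B)\<^esub> FAr (HorF (vdisc B)) f"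
        using interchange[of "fst g" "snd g" "fst f" "snd f"]
        by (cases f; cases g) (simp add: pullback_def vdisc_def vsq_def vcell_def hpairs2_def)
    qed (auto simp: hcomp1_cell hcomp2_cell dom_hcomp2 cod_hcomp2 hcomp2_id)
  qed (auto simp: V.dom_id unit_cell dom_hcomp2 hpairs2_Dom src_unit trg_unit src_hcomp1 trg_hcomp1 globular_iso_vdisc asc_iso lun_iso run_iso
      asc_natural lun_natural run_natural pentagon triangle)
qed

end

text \<open>The vertical arrows of \<open>vdisc B\<close> are the 0-cells themselves, so
  \<open>P0 G\<close> acts both on objects and on arrows. Record extensions are accepted so that
  decorated pseudofunctors are covered, their functor on the decoration being forgotten.\<close>

definition vdisc_fun :: "('o, 'h, 'c, 'p, 'k, 'd, 'z) psfun_scheme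
    \<Rightarrow> ('o, 'o, 'h, 'c, 'p, 'p, 'k, 'd) dblfun" where
  "vdisc_fun G = \<lparr>F0 = \<lparr>FOb = P0 G, FAr = P0 G\<rparr>, F1 = PCells G, DComp = PComp G, DUnit = PUnit G\<rparr>"

lemma vdisc_fun_simps [simp]:
  "FOb (F0 (vdisc_fun G)) = P0 G" "FAr (F0 (vdisc_fun G)) = P0 G"
  "F1 (vdisc_fun G) = PCells G" "DComp (vdisc_fun G) = PComp G" "DUnit (vdisc_fun G) = PUnit G"
  by (simp_all add: vdisc_fun_def)

text \<open>The coherence axioms correspond one to one. A double functor has in addition conditions
  on vertical morphisms, notably naturality of the unit comparison, and these hold automatically at
  identities.\<close>

lemma pseudofunctor_iff_double_functor:
  "pseudofunctor B B' G \<longleftrightarrow>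
    bicategory B \<and> bicategory B' \<and> double_functor (vdisc B) (vdisc B') (vdisc_fun G)"
proof safe
  assume "pseudofunctor B B' G"
  then interpret pseudofunctor B B' G .
  interpret D: double_category "vdisc B" by (rule B.double_category_vdisc)
  interpret E: double_category "vdisc B'" by (rule B'.double_category_vdisc)
  interpret F: is_functor "Cells B" "Cells B'" "PCells G" by (rule functor_cells)
  show "bicategory B" "bicategory B'"
    by unfold_locales
  show "double_functor (vdisc B) (vdisc B') (vdisc_fun G)"
  proof (intro double_functor.intro double_functor_axioms.intro)
    show "is_functor (C0 (vdisc B)) (C0 (vdisc B')) (F0 (vdisc_fun G))"
      by (simp add: is_functor_def is_functor_axioms_def D.V0.category_axioms E.V0.category_axioms
          zero_cell)
  next
    \<comment> \<open>The vertical arrow \<open>f\<close> is the identity of a 0-cell, so both sides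
      of the naturality equation reduce to \<open>PUnit G f\<close>.\<close>
    fix f assume f: "f \<in> Ar (C0 (vdisc B))"
    then have "PUnit G f \<in> Ar (Cells B')" "Dom (Cells B') (PUnit G f) = Unit B' (P0 G f)"
      "Cod (Cells B') (PUnit G f) = FOb (PCells G) (Unit B f)"
      using unit_iso[of f] by (auto simp: cell_iso_def invertible_def inverse_arrows_def)
    with f show "DUnit (vdisc_fun G) (Cod (C0 (vdisc B)) f) \<bullet>\<^bsub>vdisc B'\<^esub>
        FAr (IdF (vdisc B')) (FAr (F0 (vdisc_fun G)) f)
      = FAr (F1 (vdisc_fun G)) (FAr (IdF (vdisc B)) f) \<bullet>\<^bsub>vdisc B'\<^esub>
        DUnit (vdisc_fun G) (Dom (C0 (vdisc B)) f)"
      using F.B.comp_id_left[of "PUnit G f"] F.B.comp_id_right[of "PUnit G f"]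
      by (simp add: F.pres_id B.unit_cell vcell_def)
  qed (simp_all add: D.double_category_axioms E.double_category_axioms functor_cells ext0 ext_cells
      ext_comp ext_unit ext_ftor_def[of "C0 (vdisc B)"] F.A.dom_ob src trg F.dom comp_iso comp_natural unit_iso
      asc_coherence lun_coherence run_coherence B'.globular_iso_vdisc)
next
  assume B: "bicategory B" "bicategory B'" and "double_functor (vdisc B) (vdisc B') (vdisc_fun G)"
  then interpret F: double_functor "vdisc B" "vdisc B'" "vdisc_fun G"
    by simp
  note B' = bicategory.globular_iso_vdisc[OF B(2), symmetric]
  show "pseudofunctor B B' G"
    using B F.functor_simps(6) F.functor1 F.ext0 F.ext1 F.ext_comp F.ext_unit F.src F.trg F.comp_iso
      F.comp_natural F.unit_iso F.asc_coherence F.lun_coherence F.run_coherence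
    by (intro pseudofunctor.intro pseudofunctor_axioms.intro) (simp_all add: ext_ftor_def B')
qed

text \<open>\<open>vdisc_fun\<close> retains every field except \<open>PDec\<close>. The type
  annotation excludes further record fields, on which nothing is assumed.\<close>

lemma decpsfun_eqI:
  assumes "vdisc_fun G = vdisc_fun H" "PDec G = PDec H"
  shows "G = (H :: ('o, 'v, 'h, 'c, 'p, 'w, 'k, 'd) decpsfun)"
  using assms by (simp add: vdisc_fun_def)

text \<open>Composites of pseudofunctors are given by the formulas for composites of double
  functors. This transfers closure under composition, the unit laws and associativity to decorated
  pseudofunctors, leaving only the functor on the decoration to be treated.\<close>

lemma vdisc_fun_comp:
  "vdisc_fun (decpsfun_comp B B' H G) = dblfun_comp (vdisc B) (vdisc B') (vdisc_fun H) (vdisc_fun G)"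
  by (simp add: vdisc_fun_def decpsfun_comp_def dblfun_comp_def ftor_comp_def)

lemma vdisc_fun_id: "vdisc_fun (decpsfun_id B) = dblfun_id (vdisc B)"
  by (simp add: vdisc_fun_def decpsfun_id_def dblfun_id_def ftor_id_def)

lemma decorated_pseudofunctorD:
  assumes "decorated_pseudofunctor B B' G"
  shows "decorated_bicategory B" "decorated_bicategory B'"
    and "double_functor (vdisc B) (vdisc B') (vdisc_fun G)"
    and "is_functor (Dec B) (Dec B') (PDec G)" "ext_ftor (Dec B) (PDec G)"
  using assms by (auto simp: decorated_pseudofunctor_def decorated_pseudofunctor_axioms_def
      pseudofunctor_iff_double_functor)

lemma decorated_pseudofunctor_id:
  assumes "decorated_bicategory B"
  shows "decorated_pseudofunctor B B (decpsfun_id B)"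
proof -
  interpret decorated_bicategory B by fact
  show ?thesis
    using assms double_category.double_functor_dblfun_id[OF double_category_vdisc] dec ob_dec
    by (auto simp: decorated_pseudofunctor_def decorated_pseudofunctor_axioms_def
        pseudofunctor_iff_double_functor vdisc_fun_id bicategory_axioms)
      (auto simp: decpsfun_id_def is_functor_ftor_id ext_ftor_id)
qed

lemma decorated_pseudofunctor_comp:
  assumes G: "decorated_pseudofunctor B B' G" and H: "decorated_pseudofunctor B' B'' H"
  shows "decorated_pseudofunctor B B'' (decpsfun_comp B B'' H G)"
proof -
  interpret G: decorated_pseudofunctor B B' G by fact
  interpret H: decorated_pseudofunctor B' B'' H by fact
  show ?thesis
    using double_functor_dblfun_comp[OF decorated_pseudofunctorD(3)[OF G]
        decorated_pseudofunctorD(3)[OF H]] G.B.ob_dec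
      is_functor_ftor_comp[OF G.functor_dec H.functor_dec] G.agree H.agree G.zero_cell
    by (auto simp: decorated_pseudofunctor_def decorated_pseudofunctor_axioms_def
        pseudofunctor_iff_double_functor vdisc_fun_comp G.B.decorated_bicategory_axioms
        H.B'.decorated_bicategory_axioms G.B.bicategory_axioms H.B'.bicategory_axioms)
      (auto simp: decpsfun_comp_def ext_ftor_comp compose_def)
qed

lemma ftor_comp_id:
  assumes "is_functor A B F" "ext_ftor A F"
  shows "ftor_comp A (ftor_id B) F = F" "ftor_comp A F (ftor_id A) = F"
  using assms by (auto intro!: ftor_eqI[of A] ext_ftor_comp simp: is_functor.ob is_functor.ar)

lemma ftor_comp_assoc:
  assumes "is_functor A B F"
  shows "ftor_comp A (ftor_comp B H G) F = ftor_comp A H (ftor_comp A G F)"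
  using assms by (auto intro!: ftor_eqI[of A] ext_ftor_comp simp: is_functor.ob is_functor.ar)

lemma category_bCat: "category bCat"
proof -
  have "decpsfun_comp B B' (decpsfun_id B') G = G" "decpsfun_comp B B' G (decpsfun_id B) = G"
    if "decorated_pseudofunctor B B' G"
    for B B' :: "('o, 'v, 'h, 'c) decbicat" and G :: "('o, 'v, 'h, 'c, 'o, 'v, 'h, 'c) decpsfun"
    using decorated_pseudofunctorD[OF that]
    by (auto intro!: decpsfun_eqI simp: vdisc_fun_comp vdisc_fun_id dblfun_comp_id_left
        dblfun_comp_id_right)
      (auto simp: decpsfun_comp_def decpsfun_id_def ftor_comp_id)
  moreover have "decpsfun_comp A D (decpsfun_comp B D H G) F = decpsfun_comp A D H (decpsfun_comp A C G F)"
    if "decorated_pseudofunctor A B F" "decorated_pseudofunctor B C G" "decorated_pseudofunctor C D H"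
    for A B C D :: "('o, 'v, 'h, 'c) decbicat" and F G H :: "('o, 'v, 'h, 'c, 'o, 'v, 'h, 'c) decpsfun"
    using that[THEN decorated_pseudofunctorD(3)] that(1)[THEN decorated_pseudofunctorD(4)]
    by (auto intro!: decpsfun_eqI simp: vdisc_fun_comp dblfun_comp_assoc)
      (auto simp: decpsfun_comp_def ftor_comp_assoc)
  ultimately show ?thesis
    by unfold_locales
      (auto simp: bCat_def decorated_pseudofunctor_id decorated_pseudofunctor_comp
        dest: decorated_pseudofunctorD)
qed


section \<open>The free globularly generated double category\<close>

context decorated_bicategory
begin

sublocale Cat: category "Cells B"
  by (rule cells)

sublocale Dc: category "Dec B"
  by (rule dec)

lemma cells_simps [simp]:
  "\<alpha> \<in> Ob (Cells B) \<Longrightarrow> Src B \<alpha> \<in> Cell0 B" "\<alpha> \<in> Ob (Cells B) \<Longrightarrow> Trg B \<alpha> \<in> Cell0 B"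
  "\<phi> \<in> Ar (Cells B) \<Longrightarrow> Src B (Cod (Cells B) \<phi>) = Src B (Dom (Cells B) \<phi>)"
  "\<phi> \<in> Ar (Cells B) \<Longrightarrow> Trg B (Cod (Cells B) \<phi>) = Trg B (Dom (Cells B) \<phi>)"
  "a \<in> Cell0 B \<Longrightarrow> Unit B a \<in> Ob (Cells B)"
  "a \<in> Cell0 B \<Longrightarrow> Src B (Unit B a) = a" "a \<in> Cell0 B \<Longrightarrow> Trg B (Unit B a) = a"
  by (simp_all add: src_cell0 trg_cell0 src_parallel trg_parallel unit_cell src_unit trg_unit)

lemma cells_cat_simps [simp]:
  "\<phi> \<in> Ar (Cells B) \<Longrightarrow> Dom (Cells B) \<phi> \<in> Ob (Cells B)"
  "\<phi> \<in> Ar (Cells B) \<Longrightarrow> Cod (Cells B) \<phi> \<in> Ob (Cells B)"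
  "\<alpha> \<in> Ob (Cells B) \<Longrightarrow> Id (Cells B) \<alpha> \<in> Ar (Cells B)"
  "\<alpha> \<in> Ob (Cells B) \<Longrightarrow> Dom (Cells B) (Id (Cells B) \<alpha>) = \<alpha>"
  "\<alpha> \<in> Ob (Cells B) \<Longrightarrow> Cod (Cells B) (Id (Cells B) \<alpha>) = \<alpha>"
  by (simp_all add: Cat.dom_ob Cat.cod_ob Cat.id_ar Cat.dom_id Cat.cod_id)

lemma vcell_simps [simp]:
  assumes "\<phi> \<in> Ar (Cells B)" "\<psi> \<in> Ar (Cells B)" "Cod (Cells B) \<phi> = Dom (Cells B) \<psi>"
  shows "\<psi> \<cdot>\<cdot> \<phi> \<in> Ar (Cells B)"
    and "Dom (Cells B) (\<psi> \<cdot>\<cdot> \<phi>) = Dom (Cells B) \<phi>"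
    and "Cod (Cells B) (\<psi> \<cdot>\<cdot> \<phi>) = Cod (Cells B) \<psi>"
  using assms by (simp_all add: vcell_def Cat.comp_ar Cat.dom_comp Cat.cod_comp)

lemma in_hpairs [simp]:
  "(\<beta>, \<alpha>) \<in> hpairs B \<longleftrightarrow> \<beta> \<in> Ob (Cells B) \<and> \<alpha> \<in> Ob (Cells B) \<and> Trg B \<alpha> = Src B \<beta>"
  "(\<psi>, \<phi>) \<in> hpairs2 B \<longleftrightarrow> \<psi> \<in> Ar (Cells B) \<and> \<phi> \<in> Ar (Cells B)
    \<and> Trg B (Dom (Cells B) \<phi>) = Src B (Dom (Cells B) \<psi>)"
  by (simp_all add: hpairs_def hpairs2_def)

lemma hcomp_simps [simp]:
  "\<lbrakk>\<beta> \<in> Ob (Cells B); \<alpha> \<in> Ob (Cells B); Trg B \<alpha> = Src B \<beta>\<rbrakk> \<Longrightarrow> \<beta> \<star> \<alpha> \<in> Ob (Cells B)"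
  "\<lbrakk>\<beta> \<in> Ob (Cells B); \<alpha> \<in> Ob (Cells B); Trg B \<alpha> = Src B \<beta>\<rbrakk> \<Longrightarrow> Src B (\<beta> \<star> \<alpha>) = Src B \<alpha>"
  "\<lbrakk>\<beta> \<in> Ob (Cells B); \<alpha> \<in> Ob (Cells B); Trg B \<alpha> = Src B \<beta>\<rbrakk> \<Longrightarrow> Trg B (\<beta> \<star> \<alpha>) = Trg B \<beta>"
  "\<lbrakk>\<psi> \<in> Ar (Cells B); \<phi> \<in> Ar (Cells B); Trg B (Dom (Cells B) \<phi>) = Src B (Dom (Cells B) \<psi>)\<rbrakk>
    \<Longrightarrow> \<psi> \<diamondop> \<phi> \<in> Ar (Cells B)"
  "\<lbrakk>\<psi> \<in> Ar (Cells B); \<phi> \<in> Ar (Cells B); Trg B (Dom (Cells B) \<phi>) = Src B (Dom (Cells B) \<psi>)\<rbrakk>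
    \<Longrightarrow> Dom (Cells B) (\<psi> \<diamondop> \<phi>) = Dom (Cells B) \<psi> \<star> Dom (Cells B) \<phi>"
  "\<lbrakk>\<psi> \<in> Ar (Cells B); \<phi> \<in> Ar (Cells B); Trg B (Dom (Cells B) \<phi>) = Src B (Dom (Cells B) \<psi>)\<rbrakk>
    \<Longrightarrow> Cod (Cells B) (\<psi> \<diamondop> \<phi>) = Cod (Cells B) \<psi> \<star> Cod (Cells B) \<phi>"
  by (simp_all add: hcomp1_cell src_hcomp1 trg_hcomp1 hcomp2_cell dom_hcomp2 cod_hcomp2)

lemma cell_isoD:
  "cell_iso B \<phi> \<alpha> \<beta> \<Longrightarrow> \<phi> \<in> Ar (Cells B) \<and> Dom (Cells B) \<phi> = \<alpha> \<and> Cod (Cells B) \<phi> = \<beta>"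
  by (auto simp: cell_iso_def invertible_def inverse_arrows_def)

lemma coherence_cell_simps [simp]:
  assumes "\<alpha> \<in> Ob (Cells B)"
  shows "BLUn B \<alpha> \<in> Ar (Cells B)" "Dom (Cells B) (BLUn B \<alpha>) = Unit B (Trg B \<alpha>) \<star> \<alpha>"
    "Cod (Cells B) (BLUn B \<alpha>) = \<alpha>"
    "BRUn B \<alpha> \<in> Ar (Cells B)" "Dom (Cells B) (BRUn B \<alpha>) = \<alpha> \<star> Unit B (Src B \<alpha>)"
    "Cod (Cells B) (BRUn B \<alpha>) = \<alpha>"
  using cell_isoD[OF lun_iso[OF assms]] cell_isoD[OF run_iso[OF assms]] by blast+

lemma asc_cell_simps [simp]:
  assumes "\<gamma> \<in> Ob (Cells B)" "\<beta> \<in> Ob (Cells B)" "\<alpha> \<in> Ob (Cells B)" "Trg B \<beta> = Src B \<gamma>"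
    "Trg B \<alpha> = Src B \<beta>"
  shows "BAsc B \<gamma> \<beta> \<alpha> \<in> Ar (Cells B)"
    "Dom (Cells B) (BAsc B \<gamma> \<beta> \<alpha>) = (\<gamma> \<star> \<beta>) \<star> \<alpha>"
    "Cod (Cells B) (BAsc B \<gamma> \<beta> \<alpha>) = \<gamma> \<star> (\<beta> \<star> \<alpha>)"
proof -
  have "(\<gamma>, \<beta>) \<in> hpairs B" "(\<beta>, \<alpha>) \<in> hpairs B"
    using assms by simp_all
  from cell_isoD[OF asc_iso[OF this]] show "BAsc B \<gamma> \<beta> \<alpha> \<in> Ar (Cells B)"
    "Dom (Cells B) (BAsc B \<gamma> \<beta> \<alpha>) = (\<gamma> \<star> \<beta>) \<star> \<alpha>"
    "Cod (Cells B) (BAsc B \<gamma> \<beta> \<alpha>) = \<gamma> \<star> (\<beta> \<star> \<alpha>)"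
    by blast+
qed

lemma dec_simps [simp]:
  "f \<in> Ar (Dec B) \<Longrightarrow> Dom (Dec B) f \<in> Cell0 B" "f \<in> Ar (Dec B) \<Longrightarrow> Cod (Dec B) f \<in> Cell0 B"
  "a \<in> Cell0 B \<Longrightarrow> Id (Dec B) a \<in> Ar (Dec B)"
  "a \<in> Cell0 B \<Longrightarrow> Dom (Dec B) (Id (Dec B) a) = a"
  "a \<in> Cell0 B \<Longrightarrow> Cod (Dec B) (Id (Dec B) a) = a"
  "\<lbrakk>f \<in> Ar (Dec B); b = Cod (Dec B) f\<rbrakk> \<Longrightarrow> Id (Dec B) b \<cdot>\<^bsub>Dec B\<^esub> f = f"
  "\<lbrakk>f \<in> Ar (Dec B); a = Dom (Dec B) f\<rbrakk> \<Longrightarrow> f \<cdot>\<^bsub>Dec B\<^esub> Id (Dec B) a = f"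
  by (simp_all add: ob_dec[symmetric] Dc.dom_ob Dc.cod_ob Dc.id_ar Dc.dom_id Dc.cod_id
      Dc.comp_id_left Dc.comp_id_right)

lemma dec_comp_simps [simp]:
  assumes "f \<in> Ar (Dec B)" "g \<in> Ar (Dec B)" "Cod (Dec B) f = Dom (Dec B) g"
  shows "g \<cdot>\<^bsub>Dec B\<^esub> f \<in> Ar (Dec B)"
    "Dom (Dec B) (g \<cdot>\<^bsub>Dec B\<^esub> f) = Dom (Dec B) f" "Cod (Dec B) (g \<cdot>\<^bsub>Dec B\<^esub> f) = Cod (Dec B) g"
  using assms by (simp_all add: Dc.comp_ar Dc.dom_comp Dc.cod_comp)

text \<open>The vertical edges of a 2-cell are identities, so this turns formal horizontal
  composability of 2-cells into composability in \<open>B\<close>.\<close>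

lemma Id_dec_eq_iff [simp]:
  "\<lbrakk>a \<in> Cell0 B; b \<in> Cell0 B\<rbrakk> \<Longrightarrow> Id (Dec B) a = Id (Dec B) b \<longleftrightarrow> a = b"
  by (metis dec_simps(4))

text \<open>\<open>Src B\<close> is a left inverse of \<open>Unit B\<close>. Hence formal vertical
  composability of horizontal identities, an equation of unit 1-cells, is composability in the
  decoration.\<close>

lemma Unit_eq_iff [simp]:
  "\<lbrakk>a \<in> Cell0 B; b \<in> Cell0 B\<rbrakk> \<Longrightarrow> Unit B a = Unit B b \<longleftrightarrow> a = b"
  by (metis src_unit)

section \<open>Edges of expressions\<close>

lemma wf_expr_edges:
  assumes "wf_expr B \<Phi>"
  shows "top_edge B \<Phi> \<in> Ob (Cells B) \<and> bot_edge B \<Phi> \<in> Ob (Cells B)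
    \<and> left_edge B \<Phi> \<in> Ar (Dec B) \<and> right_edge B \<Phi> \<in> Ar (Dec B)
    \<and> Dom (Dec B) (left_edge B \<Phi>) = Src B (top_edge B \<Phi>)
    \<and> Cod (Dec B) (left_edge B \<Phi>) = Src B (bot_edge B \<Phi>)
    \<and> Dom (Dec B) (right_edge B \<Phi>) = Trg B (top_edge B \<Phi>)
    \<and> Cod (Dec B) (right_edge B \<Phi>) = Trg B (bot_edge B \<Phi>)"
  using assms
proof (induction \<Phi>)
  case (HComp \<Psi> \<Phi>)
  \<comment> \<open>The two factors share a vertical edge; its domain and codomain are the 0-cells
    at which the tops and the bottoms meet.\<close>
  have "Trg B (top_edge B \<Phi>) = Src B (top_edge B \<Psi>)" "Trg B (bot_edge B \<Phi>) = Src B (bot_edge B \<Psi>)"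
    using HComp by (metis wf_expr.simps(4))+
  then show ?case
    using HComp by simp
qed auto

lemma wf_expr_simps [simp]:
  assumes "wf_expr B \<Phi>"
  shows "top_edge B \<Phi> \<in> Ob (Cells B)" "bot_edge B \<Phi> \<in> Ob (Cells B)"
    "left_edge B \<Phi> \<in> Ar (Dec B)" "right_edge B \<Phi> \<in> Ar (Dec B)"
    "Dom (Dec B) (left_edge B \<Phi>) = Src B (top_edge B \<Phi>)"
    "Cod (Dec B) (left_edge B \<Phi>) = Src B (bot_edge B \<Phi>)"
    "Dom (Dec B) (right_edge B \<Phi>) = Trg B (top_edge B \<Phi>)"
    "Cod (Dec B) (right_edge B \<Phi>) = Trg B (bot_edge B \<Phi>)"
  using wf_expr_edges[OF assms] by blast+

lemma wf_expr_HComp_edges: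
  assumes "wf_expr B \<Psi>" "wf_expr B \<Phi>" "right_edge B \<Phi> = left_edge B \<Psi>"
  shows "Trg B (top_edge B \<Phi>) = Src B (top_edge B \<Psi>)"
    "Trg B (bot_edge B \<Phi>) = Src B (bot_edge B \<Psi>)"
  using assms by (metis wf_expr_simps(5,7), metis wf_expr_simps(6,8))

text \<open>The identifications preserve all four edges, which makes the domain, codomain and
  vertical edges of a class independent of its representative. Both sides are assumed well-formed
  since the rules of \<open>basic_rel\<close> are schematic in the expressions.\<close>

lemma basic_rel_edges:
  assumes "basic_rel B \<Phi> \<Psi>" "wf_expr B \<Phi>" "wf_expr B \<Psi>"
  shows "top_edge B \<Phi> = top_edge B \<Psi> \<and> bot_edge B \<Phi> = bot_edge B \<Psi>
    \<and> left_edge B \<Phi> = left_edge B \<Psi> \<and> right_edge B \<Phi> = right_edge B \<Psi>"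
  using assms
proof (induction rule: basic_rel.induct)
  case (v_assoc \<Theta> \<Psi> \<Phi>)
  then show ?case
    by (simp add: Dc.comp_assoc)
next
  case (asc_nat \<Theta> \<Psi> \<Phi>)
  then have wf: "wf_expr B \<Theta>" "wf_expr B \<Psi>" "wf_expr B \<Phi>" "right_edge B \<Psi> = left_edge B \<Theta>"
    "right_edge B \<Phi> = left_edge B \<Psi>"
    by auto
  note wf_expr_HComp_edges[OF wf(1,2,4)] wf_expr_HComp_edges[OF wf(2,3,5)]
  with wf show ?case
    by simp
next
  case (v_cell \<psi> \<phi>)
  \<comment> \<open>The left edge of the formal composite is a composite of two identities. These
    are at the same 0-cell because a 2-cell joins parallel 1-cells, and likewise on the
    right.\<close>
  then have "Src B (Dom (Cells B) \<psi>) = Src B (Dom (Cells B) \<phi>)"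
    "Trg B (Dom (Cells B) \<psi>) = Trg B (Dom (Cells B) \<phi>)"
    by (metis cells_simps(3) top_edge.simps(1) bot_edge.simps(1) wf_expr.simps(1,3),
        metis cells_simps(4) top_edge.simps(1) bot_edge.simps(1) wf_expr.simps(1,3))
  with v_cell show ?case
    by simp
qed auto

lemma expr_rel_edges:
  "expr_rel B \<Phi> \<Psi> \<Longrightarrow> wf_expr B \<Phi> \<and> wf_expr B \<Psi>
    \<and> top_edge B \<Phi> = top_edge B \<Psi> \<and> bot_edge B \<Phi> = bot_edge B \<Psi>
    \<and> left_edge B \<Phi> = left_edge B \<Psi> \<and> right_edge B \<Phi> = right_edge B \<Psi>"
  by (induction rule: expr_rel.induct) (simp_all add: basic_rel_edges)

lemma expr_rel_simps:
  assumes "expr_rel B \<Phi> \<Psi>"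
  shows "wf_expr B \<Phi>" "wf_expr B \<Psi>" "top_edge B \<Phi> = top_edge B \<Psi>"
    "bot_edge B \<Phi> = bot_edge B \<Psi>" "left_edge B \<Phi> = left_edge B \<Psi>"
    "right_edge B \<Phi> = right_edge B \<Psi>"
  using expr_rel_edges[OF assms] by blast+

section \<open>Squares as classes of expressions\<close>

lemma cls_eqI: "expr_rel B \<Phi> \<Psi> \<Longrightarrow> cls B \<Phi> = cls B \<Psi>"
  unfolding cls_def by (blast intro: expr_rel.sym expr_rel.trans)

lemma cls_basic: "\<lbrakk>basic_rel B \<Phi> \<Psi>; wf_expr B \<Phi>; wf_expr B \<Psi>\<rbrakk> \<Longrightarrow> cls B \<Phi> = cls B \<Psi>"
  by (intro cls_eqI expr_rel.basic)

lemma rep_cls: "wf_expr B \<Phi> \<Longrightarrow> expr_rel B \<Phi> (rep (cls B \<Phi>))"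
  unfolding rep_def cls_def by (rule someI2[of _ \<Phi>]) (auto intro: expr_rel.refl)

lemmas rep_cls_simps [simp] = expr_rel_simps(3-6)[OF rep_cls, symmetric]

lemma wf_rep_cls [simp]: "wf_expr B \<Phi> \<Longrightarrow> wf_expr B (rep (cls B \<Phi>))"
  by (rule expr_rel_simps(2)[OF rep_cls])

lemma freeQ_simps [simp]:
  "C0 (freeQ B) = Dec B" "Ob (C1 (freeQ B)) = Ob (Cells B)"
  "Id (C1 (freeQ B)) \<alpha> = cls B (Cell (Id (Cells B) \<alpha>))"
  "FOb (SrcF (freeQ B)) = Src B" "FOb (TrgF (freeQ B)) = Trg B" "FOb (IdF (freeQ B)) = Unit B"
  "FAr (IdF (freeQ B)) f = cls B (HId f)"
  "\<beta> \<odot>\<^bsub>freeQ B\<^esub> \<alpha> = \<beta> \<star> \<alpha>" "FOb (HorF (freeQ B)) (\<beta>, \<alpha>) = \<beta> \<star> \<alpha>"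
  "Asc (freeQ B) \<gamma> \<beta> \<alpha> = cls B (Cell (BAsc B \<gamma> \<beta> \<alpha>))"
  "LUn (freeQ B) \<alpha> = cls B (Cell (BLUn B \<alpha>))" "RUn (freeQ B) \<alpha> = cls B (Cell (BRUn B \<alpha>))"
  by (simp_all add: freeQ_def hmor_def)

lemma Ar_freeQ: "Ar (C1 (freeQ B)) = cls B ` {\<Phi>. wf_expr B \<Phi>}"
  by (auto simp: freeQ_def quotient_def cls_def Image_def)

lemma cls_in_Ar [simp]: "wf_expr B \<Phi> \<Longrightarrow> cls B \<Phi> \<in> Ar (C1 (freeQ B))"
  by (auto simp: Ar_freeQ)

lemma freeQ_arE:
  assumes "X \<in> Ar (C1 (freeQ B))"
  obtains \<Phi> where "wf_expr B \<Phi>" "X = cls B \<Phi>"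
  using assms by (auto simp: Ar_freeQ)

lemma freeQ_cls_simps [simp]:
  assumes "wf_expr B \<Phi>"
  shows "Dom (C1 (freeQ B)) (cls B \<Phi>) = top_edge B \<Phi>"
    "Cod (C1 (freeQ B)) (cls B \<Phi>) = bot_edge B \<Phi>"
    "FAr (SrcF (freeQ B)) (cls B \<Phi>) = left_edge B \<Phi>"
    "FAr (TrgF (freeQ B)) (cls B \<Phi>) = right_edge B \<Phi>"
  using assms by (simp_all add: freeQ_def)

text \<open>\<open>freeQ\<close> composes chosen representatives. Since \<open>expr_rel\<close> is a
  congruence that preserves edges, any well-formed representatives may be used instead;
  \<open>hsq_cls\<close> is the horizontal counterpart.\<close>

lemma vsq_cls [simp]:
  assumes "wf_expr B \<Psi>" "wf_expr B \<Phi>" "bot_edge B \<Phi> = top_edge B \<Psi>"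
  shows "cls B \<Psi> \<bullet>\<^bsub>freeQ B\<^esub> cls B \<Phi> = cls B (VComp \<Psi> \<Phi>)"
proof -
  have "expr_rel B (VComp \<Psi> \<Phi>) (VComp (rep (cls B \<Psi>)) (rep (cls B \<Phi>)))"
    using assms by (intro expr_rel.vert rep_cls) simp_all
  then show ?thesis
    by (simp add: vsq_def freeQ_def cls_eqI)
qed

lemma hsq_cls [simp]:
  assumes "wf_expr B \<Psi>" "wf_expr B \<Phi>" "right_edge B \<Phi> = left_edge B \<Psi>"
  shows "cls B \<Psi> \<ast>\<^bsub>freeQ B\<^esub> cls B \<Phi> = cls B (HComp \<Psi> \<Phi>)"
proof -
  have "expr_rel B (HComp \<Psi> \<Phi>) (HComp (rep (cls B \<Psi>)) (rep (cls B \<Phi>)))"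
    using assms by (intro expr_rel.hor rep_cls) simp_all
  then show ?thesis
    by (simp add: hsq_def freeQ_def cls_eqI)
qed

lemma cls_v_assoc:
  "\<lbrakk>wf_expr B \<Phi>; wf_expr B \<Psi>; wf_expr B \<Theta>; bot_edge B \<Phi> = top_edge B \<Psi>;
    bot_edge B \<Psi> = top_edge B \<Theta>\<rbrakk>
    \<Longrightarrow> cls B (VComp (VComp \<Theta> \<Psi>) \<Phi>) = cls B (VComp \<Theta> (VComp \<Psi> \<Phi>))"
  by (intro cls_basic basic_rel.v_assoc) simp_all

lemma cls_v_id [simp]:
  assumes "wf_expr B \<Phi>"
  shows "cls B (VComp (Cell (Id (Cells B) (bot_edge B \<Phi>))) \<Phi>) = cls B \<Phi>"
    and "cls B (VComp \<Phi> (Cell (Id (Cells B) (top_edge B \<Phi>)))) = cls B \<Phi>"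
  using assms by (intro cls_basic basic_rel.v_id_bot basic_rel.v_id_top; simp)+

lemma cls_interchange:
  assumes "wf_expr B \<Psi>'" "wf_expr B \<Phi>'" "right_edge B \<Phi>' = left_edge B \<Psi>'"
    "wf_expr B \<Psi>" "wf_expr B \<Phi>" "right_edge B \<Phi> = left_edge B \<Psi>"
    "bot_edge B \<Psi> = top_edge B \<Psi>'" "bot_edge B \<Phi> = top_edge B \<Phi>'"
  shows "cls B (HComp (VComp \<Psi>' \<Psi>) (VComp \<Phi>' \<Phi>)) = cls B (VComp (HComp \<Psi>' \<Phi>') (HComp \<Psi> \<Phi>))"
  using assms by (intro cls_basic basic_rel.interchange) simp_all

lemma cls_hid:
  "a \<in> Cell0 B \<Longrightarrow> cls B (HId (Id (Dec B) a)) = cls B (Cell (Id (Cells B) (Unit B a)))"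
  "\<lbrakk>f \<in> Ar (Dec B); g \<in> Ar (Dec B); Cod (Dec B) f = Dom (Dec B) g\<rbrakk>
    \<Longrightarrow> cls B (VComp (HId g) (HId f)) = cls B (HId (g \<cdot>\<^bsub>Dec B\<^esub> f))"
  by (intro cls_basic basic_rel.id_gen basic_rel.v_hid; simp)+

lemma cls_unitors:
  assumes "wf_expr B \<Phi>"
  shows "cls B (VComp (Cell (BLUn B (bot_edge B \<Phi>))) (HComp (HId (right_edge B \<Phi>)) \<Phi>))
      = cls B (VComp \<Phi> (Cell (BLUn B (top_edge B \<Phi>))))"
    and "cls B (VComp (Cell (BRUn B (bot_edge B \<Phi>))) (HComp \<Phi> (HId (left_edge B \<Phi>))))
      = cls B (VComp \<Phi> (Cell (BRUn B (top_edge B \<Phi>))))"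
  using assms by (intro cls_basic basic_rel.lun_nat basic_rel.run_nat; simp)+

lemma cls_asc:
  assumes "wf_expr B \<Theta>" "wf_expr B \<Psi>" "wf_expr B \<Phi>"
    "right_edge B \<Psi> = left_edge B \<Theta>" "right_edge B \<Phi> = left_edge B \<Psi>"
  shows "cls B (VComp (Cell (BAsc B (bot_edge B \<Theta>) (bot_edge B \<Psi>) (bot_edge B \<Phi>)))
        (HComp (HComp \<Theta> \<Psi>) \<Phi>))
      = cls B (VComp (HComp \<Theta> (HComp \<Psi> \<Phi>))
        (Cell (BAsc B (top_edge B \<Theta>) (top_edge B \<Psi>) (top_edge B \<Phi>))))"
  using assms wf_expr_HComp_edges[of \<Theta> \<Psi>] wf_expr_HComp_edges[of \<Psi> \<Phi>]
  by (intro cls_basic basic_rel.asc_nat) simp_all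

lemma cls_vcell:
  "\<lbrakk>\<phi> \<in> Ar (Cells B); \<psi> \<in> Ar (Cells B); Cod (Cells B) \<phi> = Dom (Cells B) \<psi>\<rbrakk>
    \<Longrightarrow> cls B (VComp (Cell \<psi>) (Cell \<phi>)) = cls B (Cell (\<psi> \<cdot>\<cdot> \<phi>))"
  by (intro cls_basic basic_rel.v_cell) simp_all

lemma cls_hcell:
  "\<lbrakk>\<phi> \<in> Ar (Cells B); \<psi> \<in> Ar (Cells B); Trg B (Dom (Cells B) \<phi>) = Src B (Dom (Cells B) \<psi>)\<rbrakk>
    \<Longrightarrow> cls B (HComp (Cell \<psi>) (Cell \<phi>)) = cls B (Cell (\<psi> \<diamondop> \<phi>))"
  by (intro cls_basic basic_rel.h_cell) simp_all

text \<open>With \<open>hsq_cell\<close>, this replaces \<open>vsq_cls\<close> and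
  \<open>hsq_cls\<close> where an equation of squares is to be reduced to an equation of 2-cells in
  \<open>B\<close>.\<close>

lemma vsq_cell:
  "\<lbrakk>\<phi> \<in> Ar (Cells B); \<psi> \<in> Ar (Cells B); Cod (Cells B) \<phi> = Dom (Cells B) \<psi>\<rbrakk>
    \<Longrightarrow> cls B (Cell \<psi>) \<bullet>\<^bsub>freeQ B\<^esub> cls B (Cell \<phi>) = cls B (Cell (\<psi> \<cdot>\<cdot> \<phi>))"
  by (simp add: cls_vcell)

lemma hsq_cell:
  "\<lbrakk>\<phi> \<in> Ar (Cells B); \<psi> \<in> Ar (Cells B); Trg B (Dom (Cells B) \<phi>) = Src B (Dom (Cells B) \<psi>)\<rbrakk>
    \<Longrightarrow> cls B (Cell \<psi>) \<ast>\<^bsub>freeQ B\<^esub> cls B (Cell \<phi>) = cls B (Cell (\<psi> \<diamondop> \<phi>))"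
  by (simp add: cls_hcell)

lemma globular_iso_cls_cell:
  assumes "cell_iso B \<phi> \<alpha> \<beta>"
  shows "globular_iso (freeQ B) (cls B (Cell \<phi>)) \<alpha> \<beta>"
proof -
  obtain \<psi> where \<psi>: "inverse_arrows (Cells B) \<phi> \<psi>"
    using assms by (auto simp: cell_iso_def invertible_def)
  then have "inverse_arrows (C1 (freeQ B)) (cls B (Cell \<phi>)) (cls B (Cell \<psi>))"
    by (auto simp: inverse_arrows_def vsq_def[symmetric] cls_vcell)
      (simp_all add: vcell_def)
  then have "invertible (C1 (freeQ B)) (cls B (Cell \<phi>))"
    by (auto simp: invertible_def)
  with cell_isoD[OF assms] show ?thesis
    by (auto simp: globular_iso_def globular_def ob_dec)
qed

section \<open>The double category axioms\<close>

lemma category_C1_freeQ: "category (C1 (freeQ B))"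
proof
  fix f assume "f \<in> Ar (C1 (freeQ B))"
  then show "Dom (C1 (freeQ B)) f \<in> Ob (C1 (freeQ B))"
    "Cod (C1 (freeQ B)) f \<in> Ob (C1 (freeQ B))"
    "Id (C1 (freeQ B)) (Cod (C1 (freeQ B)) f) \<cdot>\<^bsub>C1 (freeQ B)\<^esub> f = f"
    "f \<cdot>\<^bsub>C1 (freeQ B)\<^esub> Id (C1 (freeQ B)) (Dom (C1 (freeQ B)) f) = f"
    by (auto elim!: freeQ_arE simp: vsq_def[symmetric])
next
  fix f g assume "f \<in> Ar (C1 (freeQ B))" "g \<in> Ar (C1 (freeQ B))"
    "Cod (C1 (freeQ B)) f = Dom (C1 (freeQ B)) g"
  then show "g \<cdot>\<^bsub>C1 (freeQ B)\<^esub> f \<in> Ar (C1 (freeQ B))"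
    "Dom (C1 (freeQ B)) (g \<cdot>\<^bsub>C1 (freeQ B)\<^esub> f) = Dom (C1 (freeQ B)) f"
    "Cod (C1 (freeQ B)) (g \<cdot>\<^bsub>C1 (freeQ B)\<^esub> f) = Cod (C1 (freeQ B)) g"
    by (auto elim!: freeQ_arE simp: vsq_def[symmetric])
next
  fix f g h assume "f \<in> Ar (C1 (freeQ B))" "g \<in> Ar (C1 (freeQ B))" "h \<in> Ar (C1 (freeQ B))"
    "Cod (C1 (freeQ B)) f = Dom (C1 (freeQ B)) g" "Cod (C1 (freeQ B)) g = Dom (C1 (freeQ B)) h"
  then show "(h \<cdot>\<^bsub>C1 (freeQ B)\<^esub> g) \<cdot>\<^bsub>C1 (freeQ B)\<^esub> f = h \<cdot>\<^bsub>C1 (freeQ B)\<^esub> (g \<cdot>\<^bsub>C1 (freeQ B)\<^esub> f)"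
    by (auto elim!: freeQ_arE simp: vsq_def[symmetric] cls_v_assoc)
qed simp_all

text \<open>Equations between composites of arbitrary squares are basic identifications read on
  classes: interchange makes horizontal composition preserve vertical composites,
  \<open>id_gen\<close> and \<open>v_hid\<close> make \<open>i\<close> a functor, and naturality of
  associators and unitors is imposed directly. Equations that involve only classes of 2-cells are
  inherited from \<open>B\<close>, and edge conditions are computed on expressions.\<close>

lemma double_category_freeQ: "double_category (freeQ B)"
proof -
  interpret V: category "C1 (freeQ B)" by (rule category_C1_freeQ)
  have src: "is_functor (C1 (freeQ B)) (C0 (freeQ B)) (SrcF (freeQ B))"
    by (intro is_functor.intro is_functor_axioms.intro category_C1_freeQ)
      (auto simp: dec ob_dec vsq_def[symmetric] elim!: freeQ_arE)
  have trg: "is_functor (C1 (freeQ B)) (C0 (freeQ B)) (TrgF (freeQ B))"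
    by (intro is_functor.intro is_functor_axioms.intro category_C1_freeQ)
      (auto simp: dec ob_dec vsq_def[symmetric] elim!: freeQ_arE)
  have pb [simp]: "(\<beta>, \<alpha>) \<in> Ob (pullback (freeQ B)) \<longleftrightarrow>
      \<beta> \<in> Ob (Cells B) \<and> \<alpha> \<in> Ob (Cells B) \<and> Trg B \<alpha> = Src B \<beta>"
    "(Y, X) \<in> Ar (pullback (freeQ B)) \<longleftrightarrow>
      Y \<in> Ar (C1 (freeQ B)) \<and> X \<in> Ar (C1 (freeQ B)) \<and>
      FAr (TrgF (freeQ B)) X = FAr (SrcF (freeQ B)) Y" for \<alpha> \<beta> X Y
    by (simp_all add: pullback_def)
  have [simp]: "FAr (HorF (freeQ B)) (Y, X) = Y \<ast>\<^bsub>freeQ B\<^esub> X" for X Y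
    by (simp add: hsq_def)
  show ?thesis
  proof (rule double_category.intro[OF src trg])
    show "is_functor (C0 (freeQ B)) (C1 (freeQ B)) (IdF (freeQ B))"
    proof (intro is_functor.intro is_functor_axioms.intro category_C1_freeQ)
      fix a assume "a \<in> Ob (C0 (freeQ B))"
      then show "FAr (IdF (freeQ B)) (Id (C0 (freeQ B)) a) = Id (C1 (freeQ B)) (FOb (IdF (freeQ B)) a)"
        by (simp add: ob_dec cls_hid)
    next
      fix f g assume "f \<in> Ar (C0 (freeQ B))" "g \<in> Ar (C0 (freeQ B))"
        "Cod (C0 (freeQ B)) f = Dom (C0 (freeQ B)) g"
      then show "FAr (IdF (freeQ B)) (g \<cdot>\<^bsub>C0 (freeQ B)\<^esub> f) =
        FAr (IdF (freeQ B)) g \<cdot>\<^bsub>C1 (freeQ B)\<^esub> FAr (IdF (freeQ B)) f"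
        by (simp add: vsq_def[symmetric] cls_hid)
    qed (simp_all add: dec ob_dec)
    show "is_functor (pullback (freeQ B)) (C1 (freeQ B)) (HorF (freeQ B))"
    proof (intro is_functor.intro is_functor_axioms.intro category_pullback[OF src trg] category_C1_freeQ)
      fix f g assume "f \<in> Ar (pullback (freeQ B))" "g \<in> Ar (pullback (freeQ B))"
        "Cod (pullback (freeQ B)) f = Dom (pullback (freeQ B)) g"
      then show "FAr (HorF (freeQ B)) (g \<cdot>\<^bsub>pullback (freeQ B)\<^esub> f) =
        FAr (HorF (freeQ B)) g \<cdot>\<^bsub>C1 (freeQ B)\<^esub> FAr (HorF (freeQ B)) f"
        by (cases f; cases g) (auto simp: vsq_def[symmetric] wf_expr_HComp_edges cls_interchange
            elim!: freeQ_arE)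
    next
      fix a assume "a \<in> Ob (pullback (freeQ B))"
      then show "FAr (HorF (freeQ B)) (Id (pullback (freeQ B)) a) =
        Id (C1 (freeQ B)) (FOb (HorF (freeQ B)) a)"
        by (cases a) (auto simp: cls_hcell hcomp2_id)
    qed (auto simp: wf_expr_HComp_edges elim!: freeQ_arE)
  next
    fix \<Theta> \<Psi> \<Phi>
    assume "(\<Theta>, \<Psi>) \<in> Ar (pullback (freeQ B))" "(\<Psi>, \<Phi>) \<in> Ar (pullback (freeQ B))"
    then show "Asc (freeQ B) (Cod (C1 (freeQ B)) \<Theta>) (Cod (C1 (freeQ B)) \<Psi>) (Cod (C1 (freeQ B)) \<Phi>)
        \<bullet>\<^bsub>freeQ B\<^esub> ((\<Theta> \<ast>\<^bsub>freeQ B\<^esub> \<Psi>) \<ast>\<^bsub>freeQ B\<^esub> \<Phi>) =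
      (\<Theta> \<ast>\<^bsub>freeQ B\<^esub> (\<Psi> \<ast>\<^bsub>freeQ B\<^esub> \<Phi>)) \<bullet>\<^bsub>freeQ B\<^esub>
      Asc (freeQ B) (Dom (C1 (freeQ B)) \<Theta>) (Dom (C1 (freeQ B)) \<Psi>) (Dom (C1 (freeQ B)) \<Phi>)"
      by (auto simp: wf_expr_HComp_edges cls_asc elim!: freeQ_arE)
  next
    fix \<Phi> assume "\<Phi> \<in> Ar (C1 (freeQ B))"
    then show "LUn (freeQ B) (Cod (C1 (freeQ B)) \<Phi>) \<bullet>\<^bsub>freeQ B\<^esub>
        (FAr (IdF (freeQ B)) (FAr (TrgF (freeQ B)) \<Phi>) \<ast>\<^bsub>freeQ B\<^esub> \<Phi>) =
      \<Phi> \<bullet>\<^bsub>freeQ B\<^esub> LUn (freeQ B) (Dom (C1 (freeQ B)) \<Phi>)"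
      "RUn (freeQ B) (Cod (C1 (freeQ B)) \<Phi>) \<bullet>\<^bsub>freeQ B\<^esub>
        (\<Phi> \<ast>\<^bsub>freeQ B\<^esub> FAr (IdF (freeQ B)) (FAr (SrcF (freeQ B)) \<Phi>)) =
      \<Phi> \<bullet>\<^bsub>freeQ B\<^esub> RUn (freeQ B) (Dom (C1 (freeQ B)) \<Phi>)"
      by (auto simp: cls_unitors elim!: freeQ_arE)
  next
    fix \<alpha> \<beta> \<gamma> \<delta>
    assume "(\<delta>, \<gamma>) \<in> Ob (pullback (freeQ B))" "(\<gamma>, \<beta>) \<in> Ob (pullback (freeQ B))"
      "(\<beta>, \<alpha>) \<in> Ob (pullback (freeQ B))"
    then show "Asc (freeQ B) \<delta> \<gamma> (\<beta> \<odot>\<^bsub>freeQ B\<^esub> \<alpha>) \<bullet>\<^bsub>freeQ B\<^esub> Asc (freeQ B) (\<delta> \<odot>\<^bsub>freeQ B\<^esub> \<gamma>) \<beta> \<alpha> =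
      (Id (C1 (freeQ B)) \<delta> \<ast>\<^bsub>freeQ B\<^esub> Asc (freeQ B) \<gamma> \<beta> \<alpha>) \<bullet>\<^bsub>freeQ B\<^esub>
      (Asc (freeQ B) \<delta> (\<gamma> \<odot>\<^bsub>freeQ B\<^esub> \<beta>) \<alpha> \<bullet>\<^bsub>freeQ B\<^esub>
        (Asc (freeQ B) \<delta> \<gamma> \<beta> \<ast>\<^bsub>freeQ B\<^esub> Id (C1 (freeQ B)) \<alpha>))"
      \<comment> \<open>Every square in sight is the class of a 2-cell, so both sides are evaluated
        inside \<open>B\<close>.\<close>
      using pentagon[of \<delta> \<gamma> \<beta> \<alpha>]
      by (simp del: vsq_cls hsq_cls add: vsq_cell hsq_cell)
  next
    fix \<beta> \<alpha> assume "(\<beta>, \<alpha>) \<in> Ob (pullback (freeQ B))"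
    then show "(Id (C1 (freeQ B)) \<beta> \<ast>\<^bsub>freeQ B\<^esub> LUn (freeQ B) \<alpha>) \<bullet>\<^bsub>freeQ B\<^esub>
        Asc (freeQ B) \<beta> (FOb (IdF (freeQ B)) (FOb (TrgF (freeQ B)) \<alpha>)) \<alpha> =
      RUn (freeQ B) \<beta> \<ast>\<^bsub>freeQ B\<^esub> Id (C1 (freeQ B)) \<alpha>"
      using triangle[of \<beta> \<alpha>] by (simp del: vsq_cls hsq_cls add: vsq_cell hsq_cell)
  qed (auto simp: ob_dec globular_iso_cls_cell asc_iso lun_iso run_iso wf_expr_HComp_edges elim!: freeQ_arE)
qed

sublocale Q: double_category "freeQ B"
  by (rule double_category_freeQ)

lemma vcell_id [simp]:
  "\<lbrakk>\<phi> \<in> Ar (Cells B); \<beta> = Cod (Cells B) \<phi>\<rbrakk> \<Longrightarrow> Id (Cells B) \<beta> \<cdot>\<cdot> \<phi> = \<phi>"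
  "\<lbrakk>\<phi> \<in> Ar (Cells B); \<alpha> = Dom (Cells B) \<phi>\<rbrakk> \<Longrightarrow> \<phi> \<cdot>\<cdot> Id (Cells B) \<alpha> = \<phi>"
  by (simp_all add: vcell_def Cat.comp_id_left Cat.comp_id_right)

text \<open>Expressions are built by the very operations that generate squares, and the class of a
  2-cell is globular because its vertical edges are identities.\<close>

lemma globularly_generated_freeQ: "globularly_generated (freeQ B)"
proof -
  have "cls B \<Phi> \<in> generated_squares (freeQ B)" if "wf_expr B \<Phi>" for \<Phi>
    using that
  proof (induction \<Phi>)
    case (Cell \<phi>)
    then show ?case
      by (intro generated_squares.glob) (auto simp: globular_def ob_dec)
  next
    case (HId f)
    then show ?case
      using generated_squares.hid[of f "freeQ B"] by simp
  next
    case (VComp \<Psi> \<Phi>)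
    then show ?case
      using generated_squares.vert[of "cls B \<Psi>" "freeQ B" "cls B \<Phi>"] by simp
  next
    case (HComp \<Psi> \<Phi>)
    then show ?case
      using generated_squares.hor[of "cls B \<Psi>" "freeQ B" "cls B \<Phi>"] by simp
  qed
  then show ?thesis
    by (auto simp: globularly_generated_def elim!: freeQ_arE)
qed

end

text \<open>The universal arrow of the extension property. It is strict, so restricting a double
  functor along it keeps the comparison squares of that double functor. All fields are restricted to
  their carriers, as equality of double functors requires.\<close>

definition cell_incl ::
  "('o, 'v, 'h, 'c) decbicat \<Rightarrow> ('o, 'o, 'h, 'c, 'o, 'v, 'h, ('c, 'v) expr set) dblfun" where
  "cell_incl B =
    \<lparr>F0 = \<lparr>FOb = (\<lambda>a\<in>Cell0 B. a), FAr = (\<lambda>a\<in>Cell0 B. Id (Dec B) a)\<rparr>,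
     F1 = \<lparr>FOb = (\<lambda>\<alpha>\<in>Ob (Cells B). \<alpha>), FAr = (\<lambda>\<phi>\<in>Ar (Cells B). cls B (Cell \<phi>))\<rparr>,
     DComp = (\<lambda>(\<beta>, \<alpha>)\<in>hpairs B. cls B (Cell (Id (Cells B) (\<beta> \<star>\<^bsub>B\<^esub> \<alpha>)))),
     DUnit = (\<lambda>a\<in>Cell0 B. cls B (Cell (Id (Cells B) (Unit B a))))\<rparr>"

lemma cell_incl_simps [simp]:
  "a \<in> Cell0 B \<Longrightarrow> FOb (F0 (cell_incl B)) a = a"
  "a \<in> Cell0 B \<Longrightarrow> FAr (F0 (cell_incl B)) a = Id (Dec B) a"
  "\<alpha> \<in> Ob (Cells B) \<Longrightarrow> FOb (F1 (cell_incl B)) \<alpha> = \<alpha>"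
  "\<phi> \<in> Ar (Cells B) \<Longrightarrow> FAr (F1 (cell_incl B)) \<phi> = cls B (Cell \<phi>)"
  "(\<beta>, \<alpha>) \<in> hpairs B \<Longrightarrow> DComp (cell_incl B) (\<beta>, \<alpha>) = cls B (Cell (Id (Cells B) (\<beta> \<star>\<^bsub>B\<^esub> \<alpha>)))"
  "a \<in> Cell0 B \<Longrightarrow> DUnit (cell_incl B) a = cls B (Cell (Id (Cells B) (Unit B a)))"
  by (simp_all add: cell_incl_def)

text \<open>This is where the identifications inside \<open>B\<close> are used:
  \<open>v_cell\<close> gives functoriality, \<open>h_cell\<close> naturality of the composition
  comparison, and \<open>id_gen\<close> naturality of the unit comparison at an identity.\<close>

lemma (in decorated_bicategory) double_functor_cell_incl:
  "double_functor (vdisc B) (freeQ B) (cell_incl B)"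
proof -
  interpret D: double_category "vdisc B" by (rule double_category_vdisc)
  note [simp del] = vsq_cls hsq_cls
  note [simp] = vsq_cell hsq_cell hcomp2_id
  show ?thesis
  proof (intro double_functor.intro double_functor_axioms.intro double_category_vdisc
      double_category_freeQ)
    show "is_functor (C0 (vdisc B)) (C0 (freeQ B)) (F0 (cell_incl B))"
      by (intro is_functor.intro is_functor_axioms.intro D.V0.category_axioms)
        (auto simp: ob_dec dec)
    show "is_functor (C1 (vdisc B)) (C1 (freeQ B)) (F1 (cell_incl B))"
      by (intro is_functor.intro is_functor_axioms.intro D.V1.category_axioms Q.V1.category_axioms)
        (auto simp: vsq_def[symmetric] vcell_def[symmetric])
    show "ext_ftor (C0 (vdisc B)) (F0 (cell_incl B))" "ext_ftor (C1 (vdisc B)) (F1 (cell_incl B))"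
      "DComp (cell_incl B) \<in> extensional (Ob (pullback (vdisc B)))"
      "DUnit (cell_incl B) \<in> extensional (Ob (C0 (vdisc B)))"
      by (simp_all add: ext_ftor_def cell_incl_def split_def)
  next
    fix \<Psi> \<Phi> assume "(\<Psi>, \<Phi>) \<in> Ar (pullback (vdisc B))"
    then show "DComp (cell_incl B) (Cod (C1 (vdisc B)) \<Psi>, Cod (C1 (vdisc B)) \<Phi>) \<bullet>\<^bsub>freeQ B\<^esub>
        (FAr (F1 (cell_incl B)) \<Psi> \<ast>\<^bsub>freeQ B\<^esub> FAr (F1 (cell_incl B)) \<Phi>) =
      FAr (F1 (cell_incl B)) (\<Psi> \<ast>\<^bsub>vdisc B\<^esub> \<Phi>) \<bullet>\<^bsub>freeQ B\<^esub>
        DComp (cell_incl B) (Dom (C1 (vdisc B)) \<Psi>, Dom (C1 (vdisc B)) \<Phi>)"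
      by simp
  next
    fix \<beta> \<alpha> assume "(\<beta>, \<alpha>) \<in> Ob (pullback (vdisc B))"
    then show "globular_iso (freeQ B) (DComp (cell_incl B) (\<beta>, \<alpha>))
      (FOb (F1 (cell_incl B)) \<beta> \<odot>\<^bsub>freeQ B\<^esub> FOb (F1 (cell_incl B)) \<alpha>)
      (FOb (F1 (cell_incl B)) (\<beta> \<odot>\<^bsub>vdisc B\<^esub> \<alpha>))"
      using Q.globular_iso_Id[of "\<beta> \<star> \<alpha>"] by simp
  next
    fix a assume "a \<in> Ob (C0 (vdisc B))"
    then show "globular_iso (freeQ B) (DUnit (cell_incl B) a)
      (FOb (IdF (freeQ B)) (FOb (F0 (cell_incl B)) a))
      (FOb (F1 (cell_incl B)) (FOb (IdF (vdisc B)) a))"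
      using Q.globular_iso_Id[of "Unit B a"] by simp
  qed (auto simp: cls_hid)
qed


section \<open>Extending pseudofunctors along the inclusion of the 2-cells\<close>

text \<open>
  Here \<open>H\<close> is a pseudofunctor from \<open>B\<close> to the horizontal bicategory of \<open>E\<close>, and \<open>V\<close> a functor from
  the decoration.
\<close>

locale freeQ_extension = B: decorated_bicategory B + H: double_functor "vdisc B" E H
  for B :: "('o, 'v, 'h, 'c) decbicat" and E :: "('p, 'w, 'k, 's) dblcat"
    and H :: "('o, 'o, 'h, 'c, 'p, 'w, 'k, 's) dblfun" +
  fixes V :: "('o, 'v, 'p, 'w) ftor"
  assumes vertical: "is_functor (Dec B) (C0 E) V"
    and ext_vertical: "ext_ftor (Dec B) V"
    and agree: "a \<in> Cell0 B \<Longrightarrow> FOb (F0 H) a = FOb V a"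
begin

primrec ev :: "('c, 'v) expr \<Rightarrow> 's" where
  "ev (Cell \<phi>) = FAr (F1 H) \<phi>"
| "ev (HId f) = DUnit H (Cod (Dec B) f) \<bullet>\<^bsub>E\<^esub>
    (FAr (IdF E) (FAr V f) \<bullet>\<^bsub>E\<^esub> inv_ar (C1 E) (DUnit H (Dom (Dec B) f)))"
| "ev (VComp \<Psi> \<Phi>) = ev \<Psi> \<bullet>\<^bsub>E\<^esub> ev \<Phi>"
| "ev (HComp \<Psi> \<Phi>) = DComp H (bot_edge B \<Psi>, bot_edge B \<Phi>) \<bullet>\<^bsub>E\<^esub>
    ((ev \<Psi> \<ast>\<^bsub>E\<^esub> ev \<Phi>) \<bullet>\<^bsub>E\<^esub> inv_ar (C1 E) (DComp H (top_edge B \<Psi>, top_edge B \<Phi>)))"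

lemma vertical_simps [simp]:
  "a \<in> Cell0 B \<Longrightarrow> FOb (F0 H) a = FOb V a"
  "a \<in> Cell0 B \<Longrightarrow> FOb V a \<in> Ob (C0 E)"
  "f \<in> Ar (Dec B) \<Longrightarrow> FAr V f \<in> Ar (C0 E)"
  "f \<in> Ar (Dec B) \<Longrightarrow> Dom (C0 E) (FAr V f) = FOb V (Dom (Dec B) f)"
  "f \<in> Ar (Dec B) \<Longrightarrow> Cod (C0 E) (FAr V f) = FOb V (Cod (Dec B) f)"
  "a \<in> Cell0 B \<Longrightarrow> FAr V (Id (Dec B) a) = Id (C0 E) (FOb V a)"
  "\<lbrakk>f \<in> Ar (Dec B); g \<in> Ar (Dec B); Cod (Dec B) f = Dom (Dec B) g\<rbrakk>
    \<Longrightarrow> FAr V (g \<cdot>\<^bsub>Dec B\<^esub> f) = FAr V g \<cdot>\<^bsub>C0 E\<^esub> FAr V f"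
  using vertical
  by (simp_all add: agree is_functor.ob is_functor.ar is_functor.dom is_functor.cod
      is_functor.pres_id is_functor.pres_comp B.ob_dec)

lemma H_simps [simp]:
  "\<alpha> \<in> Ob (Cells B) \<Longrightarrow> FAr (F1 H) (Id (Cells B) \<alpha>) = Id (C1 E) (FOb (F1 H) \<alpha>)"
  "\<lbrakk>\<phi> \<in> Ar (Cells B); \<psi> \<in> Ar (Cells B); Cod (Cells B) \<phi> = Dom (Cells B) \<psi>\<rbrakk>
    \<Longrightarrow> FAr (F1 H) (\<psi> \<cdot>\<cdot>\<^bsub>B\<^esub> \<phi>) = FAr (F1 H) \<psi> \<bullet>\<^bsub>E\<^esub> FAr (F1 H) \<phi>"
  "\<phi> \<in> Ar (Cells B) \<Longrightarrow> Dom (C1 E) (FAr (F1 H) \<phi>) = FOb (F1 H) (Dom (Cells B) \<phi>)"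
  "\<phi> \<in> Ar (Cells B) \<Longrightarrow> Cod (C1 E) (FAr (F1 H) \<phi>) = FOb (F1 H) (Cod (Cells B) \<phi>)"
  "\<lbrakk>\<beta> \<in> Ob (Cells B); \<alpha> \<in> Ob (Cells B); Trg B \<alpha> = Src B \<beta>\<rbrakk>
    \<Longrightarrow> Cod (C1 E) (DComp H (\<beta>, \<alpha>)) = FOb (F1 H) (\<beta> \<star>\<^bsub>B\<^esub> \<alpha>)"
  "a \<in> Cell0 B \<Longrightarrow> FAr (F0 H) a = Id (C0 E) (FOb V a)"
  using H.functor_simps(5)[of \<alpha>] H.pres_vsq[of \<phi> \<psi>] H.functor_simps(3,4)[of \<phi>]
    H.comp_simps(3)[of \<beta> \<alpha>] H.functor_simps(10)[of a]
  by simp_all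

lemma comp_iso: "\<lbrakk>\<beta> \<in> Ob (Cells B); \<alpha> \<in> Ob (Cells B); Trg B \<alpha> = Src B \<beta>\<rbrakk>
  \<Longrightarrow> globular_iso E (DComp H (\<beta>, \<alpha>)) (FOb (F1 H) \<beta> \<odot>\<^bsub>E\<^esub> FOb (F1 H) \<alpha>) (FOb (F1 H) (\<beta> \<star>\<^bsub>B\<^esub> \<alpha>))"
  using H.comp_iso[of \<beta> \<alpha>] by simp

lemma unit_iso: "a \<in> Cell0 B
  \<Longrightarrow> globular_iso E (DUnit H a) (FOb (IdF E) (FOb V a)) (FOb (F1 H) (Unit B a))"
  using H.unit_iso[of a] by simp

lemma inv_simps [simp]:
  assumes "globular_iso E \<Phi> \<alpha> \<beta>"
  shows "inv_ar (C1 E) \<Phi> \<in> Ar (C1 E)" "Dom (C1 E) (inv_ar (C1 E) \<Phi>) = \<beta>"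
    "Cod (C1 E) (inv_ar (C1 E) \<Phi>) = \<alpha>"
    "FAr (SrcF E) (inv_ar (C1 E) \<Phi>) = Id (C0 E) (FOb (SrcF E) \<alpha>)"
    "FAr (TrgF E) (inv_ar (C1 E) \<Phi>) = Id (C0 E) (FOb (TrgF E) \<alpha>)"
  using H.E.globular_isoD[OF H.E.globular_iso_inv_ar(1)[OF assms]] by simp_all

text \<open>The last equation is naturality of the unit comparison. It determines
  \<open>ev (HId f)\<close>, the comparison square being invertible, and the verifications of the
  identifications below use it in place of the defining clause with its inverse.\<close>

lemma ev_HId:
  assumes f: "f \<in> Ar (Dec B)"
  shows "ev (HId f) \<in> Ar (C1 E)" "Dom (C1 E) (ev (HId f)) = FOb (F1 H) (Unit B (Dom (Dec B) f))"
    "Cod (C1 E) (ev (HId f)) = FOb (F1 H) (Unit B (Cod (Dec B) f))"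
    "FAr (SrcF E) (ev (HId f)) = FAr V f" "FAr (TrgF E) (ev (HId f)) = FAr V f"
    "ev (HId f) \<bullet>\<^bsub>E\<^esub> DUnit H (Dom (Dec B) f) = DUnit H (Cod (Dec B) f) \<bullet>\<^bsub>E\<^esub> FAr (IdF E) (FAr V f)"
proof -
  have u: "globular_iso E (DUnit H (Dom (Dec B) f)) (FOb (IdF E) (FOb V (Dom (Dec B) f)))
    (FOb (F1 H) (Unit B (Dom (Dec B) f)))"
    using f by (intro unit_iso) simp
  note inv = inv_simps[OF u] H.E.globular_iso_inv_ar(2)[OF u]
  show "ev (HId f) \<in> Ar (C1 E)" "Dom (C1 E) (ev (HId f)) = FOb (F1 H) (Unit B (Dom (Dec B) f))"
    "Cod (C1 E) (ev (HId f)) = FOb (F1 H) (Unit B (Cod (Dec B) f))"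
    "FAr (SrcF E) (ev (HId f)) = FAr V f" "FAr (TrgF E) (ev (HId f)) = FAr V f"
    "ev (HId f) \<bullet>\<^bsub>E\<^esub> DUnit H (Dom (Dec B) f) = DUnit H (Cod (Dec B) f) \<bullet>\<^bsub>E\<^esub> FAr (IdF E) (FAr V f)"
    using f inv by (simp_all add: H.E.vsq_assoc)
qed

text \<open>The edges of the two values are hypotheses, so that this can serve as the induction step
  of \<open>ev_edges\<close>. The last equation is the analogue for horizontal composites of the one
  in \<open>ev_HId\<close>.\<close>

lemma ev_HComp_aux:
  assumes "wf_expr B (HComp \<Psi> \<Phi>)"
    and \<Psi>: "ev \<Psi> \<in> Ar (C1 E)" "Dom (C1 E) (ev \<Psi>) = FOb (F1 H) (top_edge B \<Psi>)"
      "Cod (C1 E) (ev \<Psi>) = FOb (F1 H) (bot_edge B \<Psi>)"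
      "FAr (SrcF E) (ev \<Psi>) = FAr V (left_edge B \<Psi>)" "FAr (TrgF E) (ev \<Psi>) = FAr V (right_edge B \<Psi>)"
    and \<Phi>: "ev \<Phi> \<in> Ar (C1 E)" "Dom (C1 E) (ev \<Phi>) = FOb (F1 H) (top_edge B \<Phi>)"
      "Cod (C1 E) (ev \<Phi>) = FOb (F1 H) (bot_edge B \<Phi>)"
      "FAr (SrcF E) (ev \<Phi>) = FAr V (left_edge B \<Phi>)" "FAr (TrgF E) (ev \<Phi>) = FAr V (right_edge B \<Phi>)"
  shows "ev (HComp \<Psi> \<Phi>) \<in> Ar (C1 E)"
    "Dom (C1 E) (ev (HComp \<Psi> \<Phi>)) = FOb (F1 H) (top_edge B \<Psi> \<star>\<^bsub>B\<^esub> top_edge B \<Phi>)"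
    "Cod (C1 E) (ev (HComp \<Psi> \<Phi>)) = FOb (F1 H) (bot_edge B \<Psi> \<star>\<^bsub>B\<^esub> bot_edge B \<Phi>)"
    "FAr (SrcF E) (ev (HComp \<Psi> \<Phi>)) = FAr V (left_edge B \<Phi>)"
    "FAr (TrgF E) (ev (HComp \<Psi> \<Phi>)) = FAr V (right_edge B \<Psi>)"
    "ev (HComp \<Psi> \<Phi>) \<bullet>\<^bsub>E\<^esub> DComp H (top_edge B \<Psi>, top_edge B \<Phi>)
      = DComp H (bot_edge B \<Psi>, bot_edge B \<Phi>) \<bullet>\<^bsub>E\<^esub> (ev \<Psi> \<ast>\<^bsub>E\<^esub> ev \<Phi>)"
proof -
  have wf: "wf_expr B \<Psi>" "wf_expr B \<Phi>" "right_edge B \<Phi> = left_edge B \<Psi>"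
    using assms(1) by simp_all
  note e = B.wf_expr_HComp_edges[OF wf]
  have c: "globular_iso E (DComp H (top_edge B \<Psi>, top_edge B \<Phi>))
    (FOb (F1 H) (top_edge B \<Psi>) \<odot>\<^bsub>E\<^esub> FOb (F1 H) (top_edge B \<Phi>))
    (FOb (F1 H) (top_edge B \<Psi> \<star>\<^bsub>B\<^esub> top_edge B \<Phi>))"
    using wf e by (intro comp_iso) simp_all
  note inv = inv_simps[OF c] H.E.globular_iso_inv_ar(2)[OF c]
  show "ev (HComp \<Psi> \<Phi>) \<in> Ar (C1 E)"
    "Dom (C1 E) (ev (HComp \<Psi> \<Phi>)) = FOb (F1 H) (top_edge B \<Psi> \<star>\<^bsub>B\<^esub> top_edge B \<Phi>)"
    "Cod (C1 E) (ev (HComp \<Psi> \<Phi>)) = FOb (F1 H) (bot_edge B \<Psi> \<star>\<^bsub>B\<^esub> bot_edge B \<Phi>)"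
    "FAr (SrcF E) (ev (HComp \<Psi> \<Phi>)) = FAr V (left_edge B \<Phi>)"
    "FAr (TrgF E) (ev (HComp \<Psi> \<Phi>)) = FAr V (right_edge B \<Psi>)"
    "ev (HComp \<Psi> \<Phi>) \<bullet>\<^bsub>E\<^esub> DComp H (top_edge B \<Psi>, top_edge B \<Phi>)
      = DComp H (bot_edge B \<Psi>, bot_edge B \<Phi>) \<bullet>\<^bsub>E\<^esub> (ev \<Psi> \<ast>\<^bsub>E\<^esub> ev \<Phi>)"
    using wf e inv \<Psi> \<Phi> by (simp_all add: H.E.vsq_assoc)
qed

lemma ev_edges:
  "wf_expr B \<Phi> \<Longrightarrow> ev \<Phi> \<in> Ar (C1 E)
    \<and> Dom (C1 E) (ev \<Phi>) = FOb (F1 H) (top_edge B \<Phi>) \<and> Cod (C1 E) (ev \<Phi>) = FOb (F1 H) (bot_edge B \<Phi>)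
    \<and> FAr (SrcF E) (ev \<Phi>) = FAr V (left_edge B \<Phi>) \<and> FAr (TrgF E) (ev \<Phi>) = FAr V (right_edge B \<Phi>)"
proof (induction \<Phi>)
  case (Cell \<phi>)
  then show ?case
    using H.src_ar[of \<phi>] H.trg_ar[of \<phi>] by simp
next
  case (HId f)
  then show ?case
    using ev_HId[of f] by (simp del: ev.simps)
next
  case (VComp \<Psi> \<Phi>)
  then show ?case
    by simp
next
  case (HComp \<Psi> \<Phi>)
  then show ?case
    using ev_HComp_aux[of \<Psi> \<Phi>] by (simp del: ev.simps)
qed

lemma ev_simps [simp]:
  assumes "wf_expr B \<Phi>"
  shows "ev \<Phi> \<in> Ar (C1 E)"
    "Dom (C1 E) (ev \<Phi>) = FOb (F1 H) (top_edge B \<Phi>)" "Cod (C1 E) (ev \<Phi>) = FOb (F1 H) (bot_edge B \<Phi>)"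
    "FAr (SrcF E) (ev \<Phi>) = FAr V (left_edge B \<Phi>)" "FAr (TrgF E) (ev \<Phi>) = FAr V (right_edge B \<Phi>)"
  using ev_edges[OF assms] by blast+

lemma ev_HComp:
  "wf_expr B (HComp \<Psi> \<Phi>) \<Longrightarrow> ev (HComp \<Psi> \<Phi>) \<bullet>\<^bsub>E\<^esub> DComp H (top_edge B \<Psi>, top_edge B \<Phi>)
    = DComp H (bot_edge B \<Psi>, bot_edge B \<Phi>) \<bullet>\<^bsub>E\<^esub> (ev \<Psi> \<ast>\<^bsub>E\<^esub> ev \<Phi>)"
  using ev_HComp_aux(6)[of \<Psi> \<Phi>] by (simp del: ev.simps)

declare ev.simps(2,4) [simp del]

lemma ev_HComp_shift:
  assumes "wf_expr B (HComp \<Psi> \<Phi>)" "X \<in> Ar (C1 E)"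
    and "Cod (C1 E) X = FOb (F1 H) (top_edge B \<Psi>) \<odot>\<^bsub>E\<^esub> FOb (F1 H) (top_edge B \<Phi>)"
  shows "ev (HComp \<Psi> \<Phi>) \<bullet>\<^bsub>E\<^esub> (DComp H (top_edge B \<Psi>, top_edge B \<Phi>) \<bullet>\<^bsub>E\<^esub> X)
    = DComp H (bot_edge B \<Psi>, bot_edge B \<Phi>) \<bullet>\<^bsub>E\<^esub> ((ev \<Psi> \<ast>\<^bsub>E\<^esub> ev \<Phi>) \<bullet>\<^bsub>E\<^esub> X)"
proof -
  have wf: "wf_expr B \<Psi>" "wf_expr B \<Phi>" "right_edge B \<Phi> = left_edge B \<Psi>"
    using assms(1) by simp_all
  note e = B.wf_expr_HComp_edges[OF wf]
  show ?thesis
    using wf e assms(2,3) by (intro H.E.vsq_shift[OF ev_HComp[OF assms(1)]]) simp_all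
qed

text \<open>Precomposed with the comparison square at the top, the lower composite ends in the
  comparison square at the middle edge, which the upper composite absorbs. What remains is
  interchange in \<open>E\<close>.\<close>

lemma ev_interchange:
  assumes wf: "wf_expr B (VComp (HComp \<Psi>' \<Phi>') (HComp \<Psi> \<Phi>))"
    "wf_expr B (HComp (VComp \<Psi>' \<Psi>) (VComp \<Phi>' \<Phi>))"
  shows "ev (HComp (VComp \<Psi>' \<Psi>) (VComp \<Phi>' \<Phi>)) = ev (VComp (HComp \<Psi>' \<Phi>') (HComp \<Psi> \<Phi>))"
proof -
  have w: "wf_expr B \<Psi>'" "wf_expr B \<Psi>" "wf_expr B \<Phi>'" "wf_expr B \<Phi>"
    "right_edge B \<Phi> = left_edge B \<Psi>" "right_edge B \<Phi>' = left_edge B \<Psi>'"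
    "bot_edge B \<Psi> = top_edge B \<Psi>'" "bot_edge B \<Phi> = top_edge B \<Phi>'"
    using wf by simp_all
  note e = B.wf_expr_HComp_edges[OF w(2,4,5)] B.wf_expr_HComp_edges[OF w(1,3,6)]
  have "ev (HComp \<Psi>' \<Phi>') \<bullet>\<^bsub>E\<^esub> (ev (HComp \<Psi> \<Phi>) \<bullet>\<^bsub>E\<^esub> DComp H (top_edge B \<Psi>, top_edge B \<Phi>))
    = ev (HComp \<Psi>' \<Phi>') \<bullet>\<^bsub>E\<^esub> (DComp H (top_edge B \<Psi>', top_edge B \<Phi>') \<bullet>\<^bsub>E\<^esub> (ev \<Psi> \<ast>\<^bsub>E\<^esub> ev \<Phi>))"
    using w by (simp add: ev_HComp)
  also have "\<dots> = DComp H (bot_edge B \<Psi>', bot_edge B \<Phi>') \<bullet>\<^bsub>E\<^esub>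
      ((ev \<Psi>' \<ast>\<^bsub>E\<^esub> ev \<Phi>') \<bullet>\<^bsub>E\<^esub> (ev \<Psi> \<ast>\<^bsub>E\<^esub> ev \<Phi>))"
    using w e by (subst ev_HComp_shift) simp_all
  also have "\<dots> = ev (HComp (VComp \<Psi>' \<Psi>) (VComp \<Phi>' \<Phi>)) \<bullet>\<^bsub>E\<^esub> DComp H (top_edge B \<Psi>, top_edge B \<Phi>)"
    using ev_HComp[OF wf(2)] w by (simp add: H.E.interchange)
  finally have "ev (VComp (HComp \<Psi>' \<Phi>') (HComp \<Psi> \<Phi>)) \<bullet>\<^bsub>E\<^esub> DComp H (top_edge B \<Psi>, top_edge B \<Phi>)
    = ev (HComp (VComp \<Psi>' \<Psi>) (VComp \<Phi>' \<Phi>)) \<bullet>\<^bsub>E\<^esub> DComp H (top_edge B \<Psi>, top_edge B \<Phi>)"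
    using w e by (simp add: H.E.vsq_assoc)
  with w e wf show ?thesis
    by - (rule H.E.vsq_cancel[OF comp_iso[of "top_edge B \<Psi>" "top_edge B \<Phi>"], symmetric]; simp del: ev.simps)
qed

text \<open>At an identity the naturality equation reads
  \<open>ev (HId _) \<bullet> DUnit H a = DUnit H a\<close>, and the unit comparison
  cancels.\<close>

lemma ev_id_gen:
  assumes "a \<in> Cell0 B"
  shows "ev (HId (Id (Dec B) a)) = ev (Cell (Id (Cells B) (Unit B a)))"
  using assms ev_HId(6)[of "Id (Dec B) a"]
  by - (rule H.E.vsq_cancel[OF unit_iso[OF assms]]; simp)

text \<open>The naturality squares of the unit comparison at \<open>f\<close> and \<open>g\<close>
  are stacked, and \<open>IdF E\<close> preserves the composite of the images of \<open>f\<close>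
  and \<open>g\<close>.\<close>

lemma ev_v_hid:
  assumes "f \<in> Ar (Dec B)" "g \<in> Ar (Dec B)" "Cod (Dec B) f = Dom (Dec B) g"
  shows "ev (VComp (HId g) (HId f)) = ev (HId (g \<cdot>\<^bsub>Dec B\<^esub> f))"
proof -
  have id: "FAr (IdF E) (FAr V g) \<bullet>\<^bsub>E\<^esub> FAr (IdF E) (FAr V f) = FAr (IdF E) (FAr V (g \<cdot>\<^bsub>Dec B\<^esub> f))"
    using assms is_functor.pres_comp[OF H.E.id_functor, of "FAr V f" "FAr V g"] by (simp add: vsq_def)
  have "ev (HId g) \<bullet>\<^bsub>E\<^esub> (ev (HId f) \<bullet>\<^bsub>E\<^esub> DUnit H (Dom (Dec B) f))
    = ev (HId g) \<bullet>\<^bsub>E\<^esub> (DUnit H (Dom (Dec B) g) \<bullet>\<^bsub>E\<^esub> FAr (IdF E) (FAr V f))"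
    using assms ev_HId(6)[of f] by simp
  also have "\<dots> = DUnit H (Cod (Dec B) g) \<bullet>\<^bsub>E\<^esub> (FAr (IdF E) (FAr V g) \<bullet>\<^bsub>E\<^esub> FAr (IdF E) (FAr V f))"
    using assms by (subst H.E.vsq_shift[OF ev_HId(6)]) simp_all
  also have "\<dots> = ev (HId (g \<cdot>\<^bsub>Dec B\<^esub> f)) \<bullet>\<^bsub>E\<^esub> DUnit H (Dom (Dec B) f)"
    using assms ev_HId(6)[of "g \<cdot>\<^bsub>Dec B\<^esub> f"] by (simp add: id)
  finally show ?thesis
    using assms by - (rule H.E.vsq_cancel[OF unit_iso[of "Dom (Dec B) f"]]; simp add: H.E.vsq_assoc)
qed

text \<open>Both sides satisfy the naturality equation of \<open>DComp H\<close> at the given pair: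
  the left side by \<open>ev_HComp\<close>, the right side because \<open>H\<close> is a double
  functor.\<close>

lemma ev_h_cell:
  assumes "(\<psi>, \<phi>) \<in> hpairs2 B"
  shows "ev (HComp (Cell \<psi>) (Cell \<phi>)) = ev (Cell (\<psi> \<diamondop>\<^bsub>B\<^esub> \<phi>))"
  using assms H.comp_natural[of \<psi> \<phi>] ev_HComp[of "Cell \<psi>" "Cell \<phi>"]
  by - (rule H.E.vsq_cancel[OF comp_iso[of "Dom (Cells B) \<psi>" "Dom (Cells B) \<phi>"]]; simp)

text \<open>Precompose with \<open>?c \<bullet> (?u \<ast> id)\<close>, which turns a unit of
  \<open>E\<close> into the image of a unit of \<open>B\<close> and then applies the composition
  comparison. By the unit coherence of \<open>H\<close> it converts the image of the unitor of
  \<open>B\<close> into the unitor of \<open>E\<close>, so the claim becomes naturality of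
  \<open>LUn E\<close> at \<open>ev \<Phi>\<close>.\<close>

lemma ev_lun_nat:
  assumes wf: "wf_expr B \<Phi>"
  shows "ev (VComp (Cell (BLUn B (bot_edge B \<Phi>))) (HComp (HId (right_edge B \<Phi>)) \<Phi>))
    = ev (VComp \<Phi> (Cell (BLUn B (top_edge B \<Phi>))))" (is "?L = ?R")
proof -
  define \<alpha> \<beta> f where d: "\<alpha> = top_edge B \<Phi>" "\<beta> = bot_edge B \<Phi>" "f = right_edge B \<Phi>"
  have t [simp]: "\<alpha> \<in> Ob (Cells B)" "\<beta> \<in> Ob (Cells B)" "f \<in> Ar (Dec B)" "Dom (Dec B) f = Trg B \<alpha>"
    "Cod (Dec B) f = Trg B \<beta>"
    using wf by (simp_all add: d)
  let ?a = "FOb (F1 H) \<alpha>" and ?b = "FOb (F1 H) \<beta>" and ?i = "FAr (IdF E) (FAr V f)"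
  let ?u = "DUnit H (Trg B \<alpha>)" and ?u' = "DUnit H (Trg B \<beta>)"
  let ?c = "DComp H (Unit B (Trg B \<alpha>), \<alpha>)" and ?c' = "DComp H (Unit B (Trg B \<beta>), \<beta>)"
  let ?l = "FAr (F1 H) (BLUn B \<alpha>)" and ?l' = "FAr (F1 H) (BLUn B \<beta>)"
  have ev: "ev \<Phi> \<in> Ar (C1 E)" "Dom (C1 E) (ev \<Phi>) = ?a" "Cod (C1 E) (ev \<Phi>) = ?b"
    "FAr (SrcF E) (ev \<Phi>) = FAr V (left_edge B \<Phi>)" "FAr (TrgF E) (ev \<Phi>) = FAr V f"
    using wf by (simp_all add: d)
  have wf': "wf_expr B (HComp (HId f) \<Phi>)"
    using wf by (simp add: d)
  have X: "?u \<ast>\<^bsub>E\<^esub> Id (C1 E) ?a \<in> Ar (C1 E)"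
    "Cod (C1 E) (?u \<ast>\<^bsub>E\<^esub> Id (C1 E) ?a) = FOb (F1 H) (Unit B (Trg B \<alpha>)) \<odot>\<^bsub>E\<^esub> ?a"
    by simp_all
  have "ev (HComp (HId f) \<Phi>) \<bullet>\<^bsub>E\<^esub> (?c \<bullet>\<^bsub>E\<^esub> (?u \<ast>\<^bsub>E\<^esub> Id (C1 E) ?a))
    = ?c' \<bullet>\<^bsub>E\<^esub> ((ev (HId f) \<ast>\<^bsub>E\<^esub> ev \<Phi>) \<bullet>\<^bsub>E\<^esub> (?u \<ast>\<^bsub>E\<^esub> Id (C1 E) ?a))"
    using ev_HComp_shift[OF wf' X(1)] X(2) by (simp add: d[symmetric])
  \<comment> \<open>Interchange separates the two columns. In the left one the unit comparison
    passes through \<open>ev (HId f)\<close>; in the right one the identity square moves from above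
    \<open>ev \<Phi>\<close> to below it; interchange then recombines them.\<close>
  also have "(ev (HId f) \<ast>\<^bsub>E\<^esub> ev \<Phi>) \<bullet>\<^bsub>E\<^esub> (?u \<ast>\<^bsub>E\<^esub> Id (C1 E) ?a)
    = (ev (HId f) \<bullet>\<^bsub>E\<^esub> ?u) \<ast>\<^bsub>E\<^esub> (ev \<Phi> \<bullet>\<^bsub>E\<^esub> Id (C1 E) ?a)"
    using ev by (intro H.E.interchange[symmetric]) (simp_all add: ev_HId)
  also have "\<dots> = (?u' \<bullet>\<^bsub>E\<^esub> ?i) \<ast>\<^bsub>E\<^esub> (Id (C1 E) ?b \<bullet>\<^bsub>E\<^esub> ev \<Phi>)"
    using ev_HId(6)[of f] ev by simp
  also have "\<dots> = (?u' \<ast>\<^bsub>E\<^esub> Id (C1 E) ?b) \<bullet>\<^bsub>E\<^esub> (?i \<ast>\<^bsub>E\<^esub> ev \<Phi>)"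
    using ev by (intro H.E.interchange) simp_all
  finally have 1: "ev (HComp (HId f) \<Phi>) \<bullet>\<^bsub>E\<^esub> (?c \<bullet>\<^bsub>E\<^esub> (?u \<ast>\<^bsub>E\<^esub> Id (C1 E) ?a))
    = ?c' \<bullet>\<^bsub>E\<^esub> ((?u' \<ast>\<^bsub>E\<^esub> Id (C1 E) ?b) \<bullet>\<^bsub>E\<^esub> (?i \<ast>\<^bsub>E\<^esub> ev \<Phi>))" .
  have l: "?l \<bullet>\<^bsub>E\<^esub> (?c \<bullet>\<^bsub>E\<^esub> (?u \<ast>\<^bsub>E\<^esub> Id (C1 E) ?a)) = LUn E ?a"
    "?l' \<bullet>\<^bsub>E\<^esub> (?c' \<bullet>\<^bsub>E\<^esub> (?u' \<ast>\<^bsub>E\<^esub> Id (C1 E) ?b)) = LUn E ?b"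
    using H.lun_coherence[of \<alpha>] H.lun_coherence[of \<beta>] by simp_all
  have evh: "ev (HComp (HId f) \<Phi>) \<in> Ar (C1 E)"
    "Dom (C1 E) (ev (HComp (HId f) \<Phi>)) = FOb (F1 H) (Unit B (Trg B \<alpha>) \<star>\<^bsub>B\<^esub> \<alpha>)"
    "Cod (C1 E) (ev (HComp (HId f) \<Phi>)) = FOb (F1 H) (Unit B (Trg B \<beta>) \<star>\<^bsub>B\<^esub> \<beta>)"
    using ev_simps(1-3)[OF wf'] by (simp_all add: d[symmetric])
  have "?L \<bullet>\<^bsub>E\<^esub> (?c \<bullet>\<^bsub>E\<^esub> (?u \<ast>\<^bsub>E\<^esub> Id (C1 E) ?a))
    = ?l' \<bullet>\<^bsub>E\<^esub> (ev (HComp (HId f) \<Phi>) \<bullet>\<^bsub>E\<^esub> (?c \<bullet>\<^bsub>E\<^esub> (?u \<ast>\<^bsub>E\<^esub> Id (C1 E) ?a)))"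
    using evh by (simp add: H.E.vsq_assoc d[symmetric])
  \<comment> \<open>The bracket is the left side of the unit coherence at \<beta>, so it becomes the
    unitor of \<open>E\<close> there.\<close>
  also have "\<dots> = (?l' \<bullet>\<^bsub>E\<^esub> (?c' \<bullet>\<^bsub>E\<^esub> (?u' \<ast>\<^bsub>E\<^esub> Id (C1 E) ?b))) \<bullet>\<^bsub>E\<^esub> (?i \<ast>\<^bsub>E\<^esub> ev \<Phi>)"
    unfolding 1 using ev by (simp add: H.E.vsq_assoc)
  also have "\<dots> = ev \<Phi> \<bullet>\<^bsub>E\<^esub> LUn E ?a"
    unfolding l using H.E.lun_natural[of "ev \<Phi>"] ev by simp
  also have "\<dots> = ?R \<bullet>\<^bsub>E\<^esub> (?c \<bullet>\<^bsub>E\<^esub> (?u \<ast>\<^bsub>E\<^esub> Id (C1 E) ?a))"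
    unfolding l(1)[symmetric] using ev by (simp add: H.E.vsq_assoc d[symmetric])
  finally have eq: "?L \<bullet>\<^bsub>E\<^esub> (?c \<bullet>\<^bsub>E\<^esub> (?u \<ast>\<^bsub>E\<^esub> Id (C1 E) ?a))
    = ?R \<bullet>\<^bsub>E\<^esub> (?c \<bullet>\<^bsub>E\<^esub> (?u \<ast>\<^bsub>E\<^esub> Id (C1 E) ?a))" .
  have "globular_iso E (?c \<bullet>\<^bsub>E\<^esub> (?u \<ast>\<^bsub>E\<^esub> Id (C1 E) ?a))
    (FOb (IdF E) (FOb V (Trg B \<alpha>)) \<odot>\<^bsub>E\<^esub> ?a) (FOb (F1 H) (Unit B (Trg B \<alpha>) \<star>\<^bsub>B\<^esub> \<alpha>))"
    by (intro H.E.globular_iso_vsq[OF H.E.globular_iso_hsq[OF H.E.globular_iso_Id unit_iso] comp_iso])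
      simp_all
  from H.E.vsq_cancel[OF this _ _ _ _ eq] show ?thesis
    using ev evh by (simp add: d[symmetric])
qed

text \<open>The mirror image of \<open>ev_lun_nat\<close>: the unit comparison now sits in the right
  factor of the horizontal composite, which is the left column of the pasting.\<close>

lemma ev_run_nat:
  assumes wf: "wf_expr B \<Phi>"
  shows "ev (VComp (Cell (BRUn B (bot_edge B \<Phi>))) (HComp \<Phi> (HId (left_edge B \<Phi>))))
    = ev (VComp \<Phi> (Cell (BRUn B (top_edge B \<Phi>))))" (is "?L = ?R")
proof -
  define \<alpha> \<beta> f where d: "\<alpha> = top_edge B \<Phi>" "\<beta> = bot_edge B \<Phi>" "f = left_edge B \<Phi>"
  have t [simp]: "\<alpha> \<in> Ob (Cells B)" "\<beta> \<in> Ob (Cells B)" "f \<in> Ar (Dec B)" "Dom (Dec B) f = Src B \<alpha>"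
    "Cod (Dec B) f = Src B \<beta>"
    using wf by (simp_all add: d)
  let ?a = "FOb (F1 H) \<alpha>" and ?b = "FOb (F1 H) \<beta>" and ?i = "FAr (IdF E) (FAr V f)"
  let ?u = "DUnit H (Src B \<alpha>)" and ?u' = "DUnit H (Src B \<beta>)"
  let ?c = "DComp H (\<alpha>, Unit B (Src B \<alpha>))" and ?c' = "DComp H (\<beta>, Unit B (Src B \<beta>))"
  let ?l = "FAr (F1 H) (BRUn B \<alpha>)" and ?l' = "FAr (F1 H) (BRUn B \<beta>)"
  have ev: "ev \<Phi> \<in> Ar (C1 E)" "Dom (C1 E) (ev \<Phi>) = ?a" "Cod (C1 E) (ev \<Phi>) = ?b"
    "FAr (SrcF E) (ev \<Phi>) = FAr V f" "FAr (TrgF E) (ev \<Phi>) = FAr V (right_edge B \<Phi>)"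
    using wf by (simp_all add: d)
  have wf': "wf_expr B (HComp \<Phi> (HId f))"
    using wf by (simp add: d)
  have X: "Id (C1 E) ?a \<ast>\<^bsub>E\<^esub> ?u \<in> Ar (C1 E)"
    "Cod (C1 E) (Id (C1 E) ?a \<ast>\<^bsub>E\<^esub> ?u) = ?a \<odot>\<^bsub>E\<^esub> FOb (F1 H) (Unit B (Src B \<alpha>))"
    by simp_all
  have "ev (HComp \<Phi> (HId f)) \<bullet>\<^bsub>E\<^esub> (?c \<bullet>\<^bsub>E\<^esub> (Id (C1 E) ?a \<ast>\<^bsub>E\<^esub> ?u))
    = ?c' \<bullet>\<^bsub>E\<^esub> ((ev \<Phi> \<ast>\<^bsub>E\<^esub> ev (HId f)) \<bullet>\<^bsub>E\<^esub> (Id (C1 E) ?a \<ast>\<^bsub>E\<^esub> ?u))"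
    using ev_HComp_shift[OF wf' X(1)] X(2) by (simp add: d[symmetric])
  also have "(ev \<Phi> \<ast>\<^bsub>E\<^esub> ev (HId f)) \<bullet>\<^bsub>E\<^esub> (Id (C1 E) ?a \<ast>\<^bsub>E\<^esub> ?u)
    = (ev \<Phi> \<bullet>\<^bsub>E\<^esub> Id (C1 E) ?a) \<ast>\<^bsub>E\<^esub> (ev (HId f) \<bullet>\<^bsub>E\<^esub> ?u)"
    using ev by (intro H.E.interchange[symmetric]) (simp_all add: ev_HId)
  also have "\<dots> = (Id (C1 E) ?b \<bullet>\<^bsub>E\<^esub> ev \<Phi>) \<ast>\<^bsub>E\<^esub> (?u' \<bullet>\<^bsub>E\<^esub> ?i)"
    using ev_HId(6)[of f] ev by simp
  also have "\<dots> = (Id (C1 E) ?b \<ast>\<^bsub>E\<^esub> ?u') \<bullet>\<^bsub>E\<^esub> (ev \<Phi> \<ast>\<^bsub>E\<^esub> ?i)"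
    using ev by (intro H.E.interchange) simp_all
  finally have 1: "ev (HComp \<Phi> (HId f)) \<bullet>\<^bsub>E\<^esub> (?c \<bullet>\<^bsub>E\<^esub> (Id (C1 E) ?a \<ast>\<^bsub>E\<^esub> ?u))
    = ?c' \<bullet>\<^bsub>E\<^esub> ((Id (C1 E) ?b \<ast>\<^bsub>E\<^esub> ?u') \<bullet>\<^bsub>E\<^esub> (ev \<Phi> \<ast>\<^bsub>E\<^esub> ?i))" .
  have l: "?l \<bullet>\<^bsub>E\<^esub> (?c \<bullet>\<^bsub>E\<^esub> (Id (C1 E) ?a \<ast>\<^bsub>E\<^esub> ?u)) = RUn E ?a"
    "?l' \<bullet>\<^bsub>E\<^esub> (?c' \<bullet>\<^bsub>E\<^esub> (Id (C1 E) ?b \<ast>\<^bsub>E\<^esub> ?u')) = RUn E ?b"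
    using H.run_coherence[of \<alpha>] H.run_coherence[of \<beta>] by simp_all
  have evh: "ev (HComp \<Phi> (HId f)) \<in> Ar (C1 E)"
    "Dom (C1 E) (ev (HComp \<Phi> (HId f))) = FOb (F1 H) (\<alpha> \<star>\<^bsub>B\<^esub> Unit B (Src B \<alpha>))"
    "Cod (C1 E) (ev (HComp \<Phi> (HId f))) = FOb (F1 H) (\<beta> \<star>\<^bsub>B\<^esub> Unit B (Src B \<beta>))"
    using ev_simps(1-3)[OF wf'] by (simp_all add: d[symmetric])
  have "?L \<bullet>\<^bsub>E\<^esub> (?c \<bullet>\<^bsub>E\<^esub> (Id (C1 E) ?a \<ast>\<^bsub>E\<^esub> ?u))
    = ?l' \<bullet>\<^bsub>E\<^esub> (ev (HComp \<Phi> (HId f)) \<bullet>\<^bsub>E\<^esub> (?c \<bullet>\<^bsub>E\<^esub> (Id (C1 E) ?a \<ast>\<^bsub>E\<^esub> ?u)))"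
    using evh by (simp add: H.E.vsq_assoc d[symmetric])
  also have "\<dots> = (?l' \<bullet>\<^bsub>E\<^esub> (?c' \<bullet>\<^bsub>E\<^esub> (Id (C1 E) ?b \<ast>\<^bsub>E\<^esub> ?u'))) \<bullet>\<^bsub>E\<^esub> (ev \<Phi> \<ast>\<^bsub>E\<^esub> ?i)"
    unfolding 1 using ev by (simp add: H.E.vsq_assoc)
  also have "\<dots> = ev \<Phi> \<bullet>\<^bsub>E\<^esub> RUn E ?a"
    unfolding l using H.E.run_natural[of "ev \<Phi>"] ev by simp
  also have "\<dots> = ?R \<bullet>\<^bsub>E\<^esub> (?c \<bullet>\<^bsub>E\<^esub> (Id (C1 E) ?a \<ast>\<^bsub>E\<^esub> ?u))"
    unfolding l(1)[symmetric] using ev by (simp add: H.E.vsq_assoc d[symmetric])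
  finally have eq: "?L \<bullet>\<^bsub>E\<^esub> (?c \<bullet>\<^bsub>E\<^esub> (Id (C1 E) ?a \<ast>\<^bsub>E\<^esub> ?u))
    = ?R \<bullet>\<^bsub>E\<^esub> (?c \<bullet>\<^bsub>E\<^esub> (Id (C1 E) ?a \<ast>\<^bsub>E\<^esub> ?u))" .
  have "globular_iso E (?c \<bullet>\<^bsub>E\<^esub> (Id (C1 E) ?a \<ast>\<^bsub>E\<^esub> ?u))
    (?a \<odot>\<^bsub>E\<^esub> FOb (IdF E) (FOb V (Src B \<alpha>))) (FOb (F1 H) (\<alpha> \<star>\<^bsub>B\<^esub> Unit B (Src B \<alpha>)))"
    by (intro H.E.globular_iso_vsq[OF H.E.globular_iso_hsq[OF unit_iso H.E.globular_iso_Id] comp_iso])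
      simp_all
  from H.E.vsq_cancel[OF this _ _ _ _ eq] show ?thesis
    using ev evh by (simp add: d[symmetric])
qed

text \<open>\<open>?c \<bullet> ?d\<close> and \<open>?e \<bullet> ?f\<close> are the comparisons
  from the two bracketings of the images to the images of the two bracketings. Both nested
  composites slide through them, the associativity coherence of \<open>H\<close> relates the two
  comparisons, and the claim becomes naturality of \<open>Asc E\<close>.\<close>

lemma ev_asc_nat:
  assumes "wf_expr B (HComp (HComp \<Theta> \<Psi>) \<Phi>)"
  shows "ev (VComp (Cell (BAsc B (bot_edge B \<Theta>) (bot_edge B \<Psi>) (bot_edge B \<Phi>)))
      (HComp (HComp \<Theta> \<Psi>) \<Phi>))
    = ev (VComp (HComp \<Theta> (HComp \<Psi> \<Phi>))
      (Cell (BAsc B (top_edge B \<Theta>) (top_edge B \<Psi>) (top_edge B \<Phi>))))" (is "?L = ?R")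
proof -
  define \<gamma> \<beta> \<alpha> where d: "\<gamma> = top_edge B \<Theta>" "\<beta> = top_edge B \<Psi>" "\<alpha> = top_edge B \<Phi>"
  define \<gamma>' \<beta>' \<alpha>' where d': "\<gamma>' = bot_edge B \<Theta>" "\<beta>' = bot_edge B \<Psi>" "\<alpha>' = bot_edge B \<Phi>"
  have wf: "wf_expr B \<Theta>" "wf_expr B \<Psi>" "wf_expr B \<Phi>" "right_edge B \<Psi> = left_edge B \<Theta>"
    "right_edge B \<Phi> = left_edge B \<Psi>"
    using assms by simp_all
  have t [simp]: "\<gamma> \<in> Ob (Cells B)" "\<beta> \<in> Ob (Cells B)" "\<alpha> \<in> Ob (Cells B)" "Trg B \<beta> = Src B \<gamma>"
    "Trg B \<alpha> = Src B \<beta>" "\<gamma>' \<in> Ob (Cells B)" "\<beta>' \<in> Ob (Cells B)" "\<alpha>' \<in> Ob (Cells B)"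
    "Trg B \<beta>' = Src B \<gamma>'" "Trg B \<alpha>' = Src B \<beta>'"
    using wf B.wf_expr_HComp_edges[of \<Theta> \<Psi>] B.wf_expr_HComp_edges[of \<Psi> \<Phi>] by (simp_all add: d d')
  let ?k = "FOb (F1 H)" and ?i = "\<lambda>\<alpha>. Id (C1 E) (FOb (F1 H) \<alpha>)"
  have ev: "ev \<Theta> \<in> Ar (C1 E)" "Dom (C1 E) (ev \<Theta>) = ?k \<gamma>" "Cod (C1 E) (ev \<Theta>) = ?k \<gamma>'"
    "ev \<Psi> \<in> Ar (C1 E)" "Dom (C1 E) (ev \<Psi>) = ?k \<beta>" "Cod (C1 E) (ev \<Psi>) = ?k \<beta>'"
    "ev \<Phi> \<in> Ar (C1 E)" "Dom (C1 E) (ev \<Phi>) = ?k \<alpha>" "Cod (C1 E) (ev \<Phi>) = ?k \<alpha>'"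
    "FAr (TrgF E) (ev \<Phi>) = FAr (SrcF E) (ev \<Psi>)" "FAr (TrgF E) (ev \<Psi>) = FAr (SrcF E) (ev \<Theta>)"
    using wf by (simp_all add: d d')
  have w: "wf_expr B (HComp \<Theta> \<Psi>)" "wf_expr B (HComp \<Psi> \<Phi>)" "wf_expr B (HComp \<Theta> (HComp \<Psi> \<Phi>))"
    using wf by simp_all
  have tp: "ev (HComp \<Theta> \<Psi>) \<in> Ar (C1 E)" "Dom (C1 E) (ev (HComp \<Theta> \<Psi>)) = ?k (\<gamma> \<star>\<^bsub>B\<^esub> \<beta>)"
    "Cod (C1 E) (ev (HComp \<Theta> \<Psi>)) = ?k (\<gamma>' \<star>\<^bsub>B\<^esub> \<beta>')"
    "ev (HComp \<Psi> \<Phi>) \<in> Ar (C1 E)" "Dom (C1 E) (ev (HComp \<Psi> \<Phi>)) = ?k (\<beta> \<star>\<^bsub>B\<^esub> \<alpha>)"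
    "Cod (C1 E) (ev (HComp \<Psi> \<Phi>)) = ?k (\<beta>' \<star>\<^bsub>B\<^esub> \<alpha>')"
    using ev_simps(1-3)[OF w(1)] ev_simps(1-3)[OF w(2)] by (simp_all add: d d')
  have ed: "FAr (TrgF E) (ev \<Phi>) = FAr (SrcF E) (ev (HComp \<Theta> \<Psi>))"
    "FAr (TrgF E) (ev (HComp \<Psi> \<Phi>)) = FAr (SrcF E) (ev \<Theta>)"
    using wf ev_simps(4)[OF w(1)] ev_simps(5)[OF w(2)] by simp_all
  have evh: "ev (HComp (HComp \<Theta> \<Psi>) \<Phi>) \<in> Ar (C1 E)"
    "Dom (C1 E) (ev (HComp (HComp \<Theta> \<Psi>) \<Phi>)) = ?k ((\<gamma> \<star>\<^bsub>B\<^esub> \<beta>) \<star>\<^bsub>B\<^esub> \<alpha>)"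
    "Cod (C1 E) (ev (HComp (HComp \<Theta> \<Psi>) \<Phi>)) = ?k ((\<gamma>' \<star>\<^bsub>B\<^esub> \<beta>') \<star>\<^bsub>B\<^esub> \<alpha>')"
    "ev (HComp \<Theta> (HComp \<Psi> \<Phi>)) \<in> Ar (C1 E)"
    "Dom (C1 E) (ev (HComp \<Theta> (HComp \<Psi> \<Phi>))) = ?k (\<gamma> \<star>\<^bsub>B\<^esub> (\<beta> \<star>\<^bsub>B\<^esub> \<alpha>))"
    "Cod (C1 E) (ev (HComp \<Theta> (HComp \<Psi> \<Phi>))) = ?k (\<gamma>' \<star>\<^bsub>B\<^esub> (\<beta>' \<star>\<^bsub>B\<^esub> \<alpha>'))"
    using ev_simps(1-3)[OF assms] ev_simps(1-3)[OF w(3)] by (simp_all add: d d')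
  let ?c = "DComp H (\<gamma> \<star>\<^bsub>B\<^esub> \<beta>, \<alpha>)" and ?c' = "DComp H (\<gamma>' \<star>\<^bsub>B\<^esub> \<beta>', \<alpha>')"
  let ?e = "DComp H (\<gamma>, \<beta> \<star>\<^bsub>B\<^esub> \<alpha>)" and ?e' = "DComp H (\<gamma>', \<beta>' \<star>\<^bsub>B\<^esub> \<alpha>')"
  let ?d = "DComp H (\<gamma>, \<beta>) \<ast>\<^bsub>E\<^esub> ?i \<alpha>" and ?d' = "DComp H (\<gamma>', \<beta>') \<ast>\<^bsub>E\<^esub> ?i \<alpha>'"
  let ?f = "?i \<gamma> \<ast>\<^bsub>E\<^esub> DComp H (\<beta>, \<alpha>)" and ?f' = "?i \<gamma>' \<ast>\<^bsub>E\<^esub> DComp H (\<beta>', \<alpha>')"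
  let ?a = "Asc E (?k \<gamma>) (?k \<beta>) (?k \<alpha>)" and ?a' = "Asc E (?k \<gamma>') (?k \<beta>') (?k \<alpha>')"
  let ?A = "FAr (F1 H) (BAsc B \<gamma> \<beta> \<alpha>)" and ?A' = "FAr (F1 H) (BAsc B \<gamma>' \<beta>' \<alpha>')"
  let ?l = "(ev \<Theta> \<ast>\<^bsub>E\<^esub> ev \<Psi>) \<ast>\<^bsub>E\<^esub> ev \<Phi>" and ?r = "ev \<Theta> \<ast>\<^bsub>E\<^esub> (ev \<Psi> \<ast>\<^bsub>E\<^esub> ev \<Phi>)"
  have coh: "?A \<bullet>\<^bsub>E\<^esub> (?c \<bullet>\<^bsub>E\<^esub> ?d) = ?e \<bullet>\<^bsub>E\<^esub> (?f \<bullet>\<^bsub>E\<^esub> ?a)"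
    "?A' \<bullet>\<^bsub>E\<^esub> (?c' \<bullet>\<^bsub>E\<^esub> ?d') = ?e' \<bullet>\<^bsub>E\<^esub> (?f' \<bullet>\<^bsub>E\<^esub> ?a')"
    using H.asc_coherence[of \<gamma> \<beta> \<alpha>] H.asc_coherence[of \<gamma>' \<beta>' \<alpha>'] by simp_all
  have hc: "ev (HComp \<Theta> \<Psi>) \<bullet>\<^bsub>E\<^esub> DComp H (\<gamma>, \<beta>) = DComp H (\<gamma>', \<beta>') \<bullet>\<^bsub>E\<^esub> (ev \<Theta> \<ast>\<^bsub>E\<^esub> ev \<Psi>)"
    "ev (HComp \<Psi> \<Phi>) \<bullet>\<^bsub>E\<^esub> DComp H (\<beta>, \<alpha>) = DComp H (\<beta>', \<alpha>') \<bullet>\<^bsub>E\<^esub> (ev \<Psi> \<ast>\<^bsub>E\<^esub> ev \<Phi>)"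
    using ev_HComp[OF w(1)] ev_HComp[OF w(2)] by (simp_all add: d d')
  \<comment> \<open>The outer composite passes through \<open>?c\<close> first; interchange then
    exposes the inner composite next to its own comparison square, where \<open>hc\<close>
    applies.\<close>
  have "ev (HComp (HComp \<Theta> \<Psi>) \<Phi>) \<bullet>\<^bsub>E\<^esub> (?c \<bullet>\<^bsub>E\<^esub> ?d)
    = ?c' \<bullet>\<^bsub>E\<^esub> ((ev (HComp \<Theta> \<Psi>) \<ast>\<^bsub>E\<^esub> ev \<Phi>) \<bullet>\<^bsub>E\<^esub> ?d)"
    using ev_HComp_shift[OF assms, of ?d] by (simp add: d[symmetric] d'[symmetric])
  also have "(ev (HComp \<Theta> \<Psi>) \<ast>\<^bsub>E\<^esub> ev \<Phi>) \<bullet>\<^bsub>E\<^esub> ?d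
    = (ev (HComp \<Theta> \<Psi>) \<bullet>\<^bsub>E\<^esub> DComp H (\<gamma>, \<beta>)) \<ast>\<^bsub>E\<^esub> (ev \<Phi> \<bullet>\<^bsub>E\<^esub> ?i \<alpha>)"
    using ev tp ed by (intro H.E.interchange[symmetric]) simp_all
  also have "\<dots> = (DComp H (\<gamma>', \<beta>') \<bullet>\<^bsub>E\<^esub> (ev \<Theta> \<ast>\<^bsub>E\<^esub> ev \<Psi>)) \<ast>\<^bsub>E\<^esub> (?i \<alpha>' \<bullet>\<^bsub>E\<^esub> ev \<Phi>)"
    unfolding hc using ev by simp
  also have "\<dots> = ?d' \<bullet>\<^bsub>E\<^esub> ?l"
    using ev by (intro H.E.interchange) simp_all
  finally have 1: "ev (HComp (HComp \<Theta> \<Psi>) \<Phi>) \<bullet>\<^bsub>E\<^esub> (?c \<bullet>\<^bsub>E\<^esub> ?d) = ?c' \<bullet>\<^bsub>E\<^esub> (?d' \<bullet>\<^bsub>E\<^esub> ?l)" .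
  \<comment> \<open>The same sliding for the other bracketing, with the inner composite now in the
    other factor.\<close>
  have "ev (HComp \<Theta> (HComp \<Psi> \<Phi>)) \<bullet>\<^bsub>E\<^esub> (?e \<bullet>\<^bsub>E\<^esub> ?f)
    = ?e' \<bullet>\<^bsub>E\<^esub> ((ev \<Theta> \<ast>\<^bsub>E\<^esub> ev (HComp \<Psi> \<Phi>)) \<bullet>\<^bsub>E\<^esub> ?f)"
    using ev_HComp_shift[OF w(3), of ?f] by (simp add: d[symmetric] d'[symmetric])
  also have "(ev \<Theta> \<ast>\<^bsub>E\<^esub> ev (HComp \<Psi> \<Phi>)) \<bullet>\<^bsub>E\<^esub> ?f
    = (ev \<Theta> \<bullet>\<^bsub>E\<^esub> ?i \<gamma>) \<ast>\<^bsub>E\<^esub> (ev (HComp \<Psi> \<Phi>) \<bullet>\<^bsub>E\<^esub> DComp H (\<beta>, \<alpha>))"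
    using ev tp ed by (intro H.E.interchange[symmetric]) simp_all
  also have "\<dots> = (?i \<gamma>' \<bullet>\<^bsub>E\<^esub> ev \<Theta>) \<ast>\<^bsub>E\<^esub> (DComp H (\<beta>', \<alpha>') \<bullet>\<^bsub>E\<^esub> (ev \<Psi> \<ast>\<^bsub>E\<^esub> ev \<Phi>))"
    unfolding hc using ev by simp
  also have "\<dots> = ?f' \<bullet>\<^bsub>E\<^esub> ?r"
    using ev by (intro H.E.interchange) simp_all
  finally have 2: "ev (HComp \<Theta> (HComp \<Psi> \<Phi>)) \<bullet>\<^bsub>E\<^esub> (?e \<bullet>\<^bsub>E\<^esub> ?f) = ?e' \<bullet>\<^bsub>E\<^esub> (?f' \<bullet>\<^bsub>E\<^esub> ?r)" .
  have nat: "?a' \<bullet>\<^bsub>E\<^esub> ?l = ?r \<bullet>\<^bsub>E\<^esub> ?a"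
    using H.E.asc_natural[of "ev \<Theta>" "ev \<Psi>" "ev \<Phi>"] ev by simp
  have "?L \<bullet>\<^bsub>E\<^esub> (?c \<bullet>\<^bsub>E\<^esub> ?d) = ?A' \<bullet>\<^bsub>E\<^esub> (ev (HComp (HComp \<Theta> \<Psi>) \<Phi>) \<bullet>\<^bsub>E\<^esub> (?c \<bullet>\<^bsub>E\<^esub> ?d))"
    using evh by (simp add: H.E.vsq_assoc d'[symmetric])
  also have "\<dots> = (?A' \<bullet>\<^bsub>E\<^esub> (?c' \<bullet>\<^bsub>E\<^esub> ?d')) \<bullet>\<^bsub>E\<^esub> ?l"
    unfolding 1 using ev by (simp add: H.E.vsq_assoc)
  \<comment> \<open>Coherence at the bottom edges produces the associator of \<open>E\<close>, and
    its naturality moves it above the three values.\<close>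
  also have "\<dots> = ?e' \<bullet>\<^bsub>E\<^esub> (?f' \<bullet>\<^bsub>E\<^esub> (?r \<bullet>\<^bsub>E\<^esub> ?a))"
    unfolding coh using ev by (simp add: H.E.vsq_assoc nat)
  also have "\<dots> = (ev (HComp \<Theta> (HComp \<Psi> \<Phi>)) \<bullet>\<^bsub>E\<^esub> (?e \<bullet>\<^bsub>E\<^esub> ?f)) \<bullet>\<^bsub>E\<^esub> ?a"
    unfolding 2 using ev by (simp add: H.E.vsq_assoc)
  also have "\<dots> = ev (HComp \<Theta> (HComp \<Psi> \<Phi>)) \<bullet>\<^bsub>E\<^esub> (?e \<bullet>\<^bsub>E\<^esub> (?f \<bullet>\<^bsub>E\<^esub> ?a))"
    using evh by (simp add: H.E.vsq_assoc)
  also have "\<dots> = ?R \<bullet>\<^bsub>E\<^esub> (?c \<bullet>\<^bsub>E\<^esub> ?d)"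
    unfolding coh[symmetric] using evh by (simp add: H.E.vsq_assoc d[symmetric])
  finally have eq: "?L \<bullet>\<^bsub>E\<^esub> (?c \<bullet>\<^bsub>E\<^esub> ?d) = ?R \<bullet>\<^bsub>E\<^esub> (?c \<bullet>\<^bsub>E\<^esub> ?d)" .
  have "globular_iso E (?c \<bullet>\<^bsub>E\<^esub> ?d) ((?k \<gamma> \<odot>\<^bsub>E\<^esub> ?k \<beta>) \<odot>\<^bsub>E\<^esub> ?k \<alpha>) (?k ((\<gamma> \<star>\<^bsub>B\<^esub> \<beta>) \<star>\<^bsub>B\<^esub> \<alpha>))"
    by (intro H.E.globular_iso_vsq[OF H.E.globular_iso_hsq[OF H.E.globular_iso_Id comp_iso] comp_iso])
      simp_all
  from H.E.vsq_cancel[OF this _ _ _ _ eq] show ?thesis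
    using evh by (simp add: d[symmetric] d'[symmetric])
qed

lemma ev_basic_rel:
  assumes "basic_rel B \<Phi> \<Psi>" "wf_expr B \<Phi>" "wf_expr B \<Psi>"
  shows "ev \<Phi> = ev \<Psi>"
  using assms
proof (induction rule: basic_rel.induct)
  case (v_assoc \<Theta> \<Psi> \<Phi>)
  then show ?case
    by (simp add: H.E.vsq_assoc)
next
  case (v_hid g f)
  then show ?case
    by (intro ev_v_hid) auto
next
  case (asc_nat \<Theta> \<Psi> \<Phi>)
  then show ?case
    by (intro ev_asc_nat) simp
qed (simp_all add: ev_id_gen ev_interchange ev_h_cell ev_lun_nat ev_run_nat del: ev.simps, simp_all)

lemma ev_expr_rel: "expr_rel B \<Phi> \<Psi> \<Longrightarrow> ev \<Phi> = ev \<Psi>"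
proof (induction rule: expr_rel.induct)
  case (hor \<Psi> \<Psi>' \<Phi> \<Phi>')
  then show ?case
    \<comment> \<open>The value on a horizontal composite depends also on the tops and bottoms of
      its factors, through the comparison squares; related factors share these.\<close>
    using B.expr_rel_edges[of \<Psi> \<Psi>'] B.expr_rel_edges[of \<Phi> \<Phi>'] by (simp add: ev.simps(4))
qed (simp_all add: ev_basic_rel)

end


section \<open>Functoriality\<close>

lemma (in decorated_bicategory) pullback_freeQ [simp]: "Ob (pullback (freeQ B)) = hpairs B"
  by (simp add: pullback_def hpairs_def)

section \<open>Existence of the extension\<close>

context freeQ_extension
begin

definition extension :: "('o, 'v, 'h, ('c, 'v) expr set, 'p, 'w, 'k, 's) dblfun" where
  "extension = \<lparr>F0 = V, F1 = \<lparr>FOb = FOb (F1 H), FAr = (\<lambda>X\<in>Ar (C1 (freeQ B)). ev (rep X))\<rparr>,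
    DComp = DComp H, DUnit = DUnit H\<rparr>"

lemma extension_simps [simp]:
  "F0 extension = V" "FOb (F1 extension) = FOb (F1 H)" "DComp extension = DComp H" "DUnit extension = DUnit H"
  by (simp_all add: extension_def)

text \<open>Independence of the representative picked by \<open>rep\<close> is exactly invariance of
  \<open>ev\<close> under \<open>expr_rel\<close>.\<close>

lemma extension_cls [simp]: "wf_expr B \<Phi> \<Longrightarrow> FAr (F1 extension) (cls B \<Phi>) = ev \<Phi>"
  using ev_expr_rel[OF B.rep_cls[of \<Phi>]] by (simp add: extension_def)

text \<open>Naturality of the comparison squares is what the clauses of \<open>ev\<close> were
  chosen to satisfy. The associators and unitors of \<open>freeQ B\<close> are classes of 2-cells,
  so their coherence is that of \<open>H\<close>.\<close>

lemma double_functor_extension: "double_functor (freeQ B) E extension"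
proof (intro double_functor.intro double_functor_axioms.intro B.double_category_freeQ
    H.E.double_category_axioms)
  show "is_functor (C0 (freeQ B)) (C0 E) (F0 extension)"
    using vertical by simp
  show "is_functor (C1 (freeQ B)) (C1 E) (F1 extension)"
    by (intro is_functor.intro is_functor_axioms.intro B.Q.V1.category_axioms
        H.E.V1.category_axioms)
      (auto simp: vsq_def[symmetric] elim!: B.freeQ_arE)
  show "ext_ftor (C0 (freeQ B)) (F0 extension)"
    using ext_vertical by simp
  show "ext_ftor (C1 (freeQ B)) (F1 extension)"
    using H.ext1 by (simp add: ext_ftor_def) (simp add: extension_def)
  show "DComp extension \<in> extensional (Ob (pullback (freeQ B)))"
    using H.ext_comp by simp
  show "DUnit extension \<in> extensional (Ob (C0 (freeQ B)))"
    using H.ext_unit by (simp add: B.ob_dec)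
next
  fix \<Psi> \<Phi> assume "(\<Psi>, \<Phi>) \<in> Ar (pullback (freeQ B))"
  then obtain \<Psi>' \<Phi>' where "\<Psi> = cls B \<Psi>'" "\<Phi> = cls B \<Phi>'" "wf_expr B \<Psi>'" "wf_expr B \<Phi>'"
    "right_edge B \<Phi>' = left_edge B \<Psi>'"
    by (auto elim!: B.freeQ_arE)
  then show "DComp extension (Cod (C1 (freeQ B)) \<Psi>, Cod (C1 (freeQ B)) \<Phi>) \<bullet>\<^bsub>E\<^esub>
      (FAr (F1 extension) \<Psi> \<ast>\<^bsub>E\<^esub> FAr (F1 extension) \<Phi>)
    = FAr (F1 extension) (\<Psi> \<ast>\<^bsub>freeQ B\<^esub> \<Phi>) \<bullet>\<^bsub>E\<^esub> DComp extension (Dom (C1 (freeQ B)) \<Psi>, Dom (C1 (freeQ B)) \<Phi>)"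
    using ev_HComp[of \<Psi>' \<Phi>'] by simp
next
  fix f assume "f \<in> Ar (C0 (freeQ B))"
  then show "DUnit extension (Cod (C0 (freeQ B)) f) \<bullet>\<^bsub>E\<^esub> FAr (IdF E) (FAr (F0 extension) f)
    = FAr (F1 extension) (FAr (IdF (freeQ B)) f) \<bullet>\<^bsub>E\<^esub> DUnit extension (Dom (C0 (freeQ B)) f)"
    using ev_HId(6)[of f] by simp
next
  fix \<gamma> \<beta> \<alpha> assume "(\<gamma>, \<beta>) \<in> Ob (pullback (freeQ B))" "(\<beta>, \<alpha>) \<in> Ob (pullback (freeQ B))"
  then show "FAr (F1 extension) (Asc (freeQ B) \<gamma> \<beta> \<alpha>) \<bullet>\<^bsub>E\<^esub> (DComp extension (\<gamma> \<odot>\<^bsub>freeQ B\<^esub> \<beta>, \<alpha>) \<bullet>\<^bsub>E\<^esub>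
      (DComp extension (\<gamma>, \<beta>) \<ast>\<^bsub>E\<^esub> Id (C1 E) (FOb (F1 extension) \<alpha>)))
    = DComp extension (\<gamma>, \<beta> \<odot>\<^bsub>freeQ B\<^esub> \<alpha>) \<bullet>\<^bsub>E\<^esub> ((Id (C1 E) (FOb (F1 extension) \<gamma>) \<ast>\<^bsub>E\<^esub> DComp extension (\<beta>, \<alpha>)) \<bullet>\<^bsub>E\<^esub>
      Asc E (FOb (F1 extension) \<gamma>) (FOb (F1 extension) \<beta>) (FOb (F1 extension) \<alpha>))"
    using H.asc_coherence[of \<gamma> \<beta> \<alpha>] by simp
next
  fix \<alpha> b assume "\<alpha> \<in> Ob (C1 (freeQ B))" "b = FOb (TrgF (freeQ B)) \<alpha>"
  then show "FAr (F1 extension) (LUn (freeQ B) \<alpha>) \<bullet>\<^bsub>E\<^esub> (DComp extension (FOb (IdF (freeQ B)) b, \<alpha>) \<bullet>\<^bsub>E\<^esub>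
      (DUnit extension b \<ast>\<^bsub>E\<^esub> Id (C1 E) (FOb (F1 extension) \<alpha>))) = LUn E (FOb (F1 extension) \<alpha>)"
    using H.lun_coherence[of \<alpha> b] by simp
next
  fix \<alpha> a assume "\<alpha> \<in> Ob (C1 (freeQ B))" "a = FOb (SrcF (freeQ B)) \<alpha>"
  then show "FAr (F1 extension) (RUn (freeQ B) \<alpha>) \<bullet>\<^bsub>E\<^esub> (DComp extension (\<alpha>, FOb (IdF (freeQ B)) a) \<bullet>\<^bsub>E\<^esub>
      (Id (C1 E) (FOb (F1 extension) \<alpha>) \<ast>\<^bsub>E\<^esub> DUnit extension a)) = RUn E (FOb (F1 extension) \<alpha>)"
    using H.run_coherence[of \<alpha> a] by simp
qed (auto simp: comp_iso unit_iso B.ob_dec elim!: B.freeQ_arE)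

text \<open>Since the inclusion has identity comparison squares, the composite has the comparison
  squares of the extension, which are those of \<open>H\<close>.\<close>

lemma extension_cell_incl: "dblfun_comp (vdisc B) E extension (cell_incl B) = H"
  by (rule dblfun_eqI[OF double_functor_dblfun_comp[OF B.double_functor_cell_incl double_functor_extension]
        H.double_functor_axioms])
    (simp_all add: dblfun_comp_simps)

end

text \<open>The uniqueness half of the universal property. Equality of the restrictions includes
  equality of comparison squares; these are then cancelled in an induction over expressions.\<close>

lemma double_functor_freeQ_eqI:
  assumes B: "decorated_bicategory B"
    and F: "double_functor (freeQ B) E F" and G: "double_functor (freeQ B) E G"
    and vert: "F0 F = F0 G"
    and cells: "dblfun_comp (vdisc B) E F (cell_incl B) = dblfun_comp (vdisc B) E G (cell_incl B)"
  shows "F = G"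
proof -
  interpret B: decorated_bicategory B by fact
  interpret F: double_functor "freeQ B" E F by fact
  interpret G: double_functor "freeQ B" E G by fact
  have ob: "FOb (F1 F) \<alpha> = FOb (F1 G) \<alpha>" if "\<alpha> \<in> Ob (Cells B)" for \<alpha>
    using arg_cong[OF cells, of "\<lambda>K. FOb (F1 K) \<alpha>"] that by (simp add: dblfun_comp_simps)
  have cell: "FAr (F1 F) (cls B (Cell \<phi>)) = FAr (F1 G) (cls B (Cell \<phi>))" if "\<phi> \<in> Ar (Cells B)" for \<phi>
    using arg_cong[OF cells, of "\<lambda>K. FAr (F1 K) \<phi>"] that by (simp add: dblfun_comp_simps)
  have idF: "FAr (F1 F) (cls B (Cell (Id (Cells B) \<alpha>))) = Id (C1 E) (FOb (F1 F) \<alpha>)"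
    "FAr (F1 G) (cls B (Cell (Id (Cells B) \<alpha>))) = Id (C1 E) (FOb (F1 G) \<alpha>)"
    if "\<alpha> \<in> Ob (Cells B)" for \<alpha>
    using F.functor_simps(5)[of \<alpha>] G.functor_simps(5)[of \<alpha>] that by simp_all
  \<comment> \<open>A comparison square of the restriction is an identity square followed, on the
    side of its domain, by the comparison square of \<open>F\<close>; hence it is the latter, and
    likewise for \<open>G\<close> and for units.\<close>
  have comp: "DComp F (\<beta>, \<alpha>) = DComp G (\<beta>, \<alpha>)" if *: "(\<beta>, \<alpha>) \<in> hpairs B" for \<beta> \<alpha>
    using arg_cong[OF cells, of "\<lambda>K. DComp K (\<beta>, \<alpha>)"] that F.comp_simps(1,3)[of \<beta> \<alpha>]
      G.comp_simps(1,3)[of \<beta> \<alpha>]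
    by (simp add: dblfun_comp_simps idF)
  have unit: "DUnit F a = DUnit G a" if "a \<in> Cell0 B" for a
    using arg_cong[OF cells, of "\<lambda>K. DUnit K a"] that F.unit_simps(1,3)[of a] G.unit_simps(1,3)[of a]
    by (simp add: dblfun_comp_simps idF B.ob_dec)
  have "FAr (F1 F) (cls B \<Phi>) = FAr (F1 G) (cls B \<Phi>)" if "wf_expr B \<Phi>" for \<Phi>
    using that
  proof (induction \<Phi>)
    case (Cell \<phi>)
    then show ?case
      by (simp add: cell)
  next
    case (HId f)
    let ?a = "Dom (Dec B) f"
    \<comment> \<open>By unit naturality both sides equal the unit comparison at the codomain after
      the horizontal identity of the image of \<open>f\<close>, on which \<open>F\<close> and
      \<open>G\<close> agree.\<close>
    have "FAr (F1 F) (cls B (HId f)) \<bullet>\<^bsub>E\<^esub> DUnit F ?a = FAr (F1 G) (cls B (HId f)) \<bullet>\<^bsub>E\<^esub> DUnit F ?a"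
      using HId F.unit_natural[of f] G.unit_natural[of f] by (simp add: vert unit)
    then show ?case
      using HId F.functor_simps(2,3)[of "cls B (HId f)"] G.functor_simps(2,3)[of "cls B (HId f)"]
      by - (rule F.E.vsq_cancel[OF F.unit_iso[of ?a]]; simp add: ob B.ob_dec)
  next
    case (VComp \<Psi> \<Phi>)
    then show ?case
      using F.pres_vsq[of "cls B \<Phi>" "cls B \<Psi>"] G.pres_vsq[of "cls B \<Phi>" "cls B \<Psi>"] by simp
  next
    case (HComp \<Psi> \<Phi>)
    then have wf: "wf_expr B \<Psi>" "wf_expr B \<Phi>" "right_edge B \<Phi> = left_edge B \<Psi>"
      by simp_all
    note e = B.wf_expr_HComp_edges[OF wf]
    let ?p = "(top_edge B \<Psi>, top_edge B \<Phi>)"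
    \<comment> \<open>By naturality both sides equal the comparison square at the bottoms after the
      horizontal composite of the two values, which agree by induction.\<close>
    have "FAr (F1 F) (cls B (HComp \<Psi> \<Phi>)) \<bullet>\<^bsub>E\<^esub> DComp F ?p
      = FAr (F1 G) (cls B (HComp \<Psi> \<Phi>)) \<bullet>\<^bsub>E\<^esub> DComp F ?p"
      using HComp F.comp_natural[of "cls B \<Psi>" "cls B \<Phi>"] G.comp_natural[of "cls B \<Psi>" "cls B \<Phi>"] e
      by (simp add: comp)
    then show ?case
      using wf e F.functor_simps(2,3)[of "cls B (HComp \<Psi> \<Phi>)"]
        G.functor_simps(2,3)[of "cls B (HComp \<Psi> \<Phi>)"]
      by - (rule F.E.vsq_cancel[OF F.comp_iso[of "top_edge B \<Psi>" "top_edge B \<Phi>"]]; simp add: ob)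
  qed
  then show ?thesis
    using vert ob comp unit by (intro dblfun_eqI[OF F G]) (auto simp: B.ob_dec elim!: B.freeQ_arE)
qed

section \<open>The free double functor as an extension\<close>

context decorated_pseudofunctor
begin

lemma G_simps [simp]:
  "a \<in> Cell0 B \<Longrightarrow> P0 G a \<in> Cell0 B'"
  "\<alpha> \<in> Ob (Cells B) \<Longrightarrow> FOb (PCells G) \<alpha> \<in> Ob (Cells B')"
  "\<phi> \<in> Ar (Cells B) \<Longrightarrow> FAr (PCells G) \<phi> \<in> Ar (Cells B')"
  "\<phi> \<in> Ar (Cells B) \<Longrightarrow> Dom (Cells B') (FAr (PCells G) \<phi>) = FOb (PCells G) (Dom (Cells B) \<phi>)"
  "\<phi> \<in> Ar (Cells B) \<Longrightarrow> Cod (Cells B') (FAr (PCells G) \<phi>) = FOb (PCells G) (Cod (Cells B) \<phi>)"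
  "\<alpha> \<in> Ob (Cells B) \<Longrightarrow> Src B' (FOb (PCells G) \<alpha>) = P0 G (Src B \<alpha>)"
  "\<alpha> \<in> Ob (Cells B) \<Longrightarrow> Trg B' (FOb (PCells G) \<alpha>) = P0 G (Trg B \<alpha>)"
  "a \<in> Cell0 B \<Longrightarrow> FOb (PDec G) a = P0 G a"
  "f \<in> Ar (Dec B) \<Longrightarrow> FAr (PDec G) f \<in> Ar (Dec B')"
  "f \<in> Ar (Dec B) \<Longrightarrow> Dom (Dec B') (FAr (PDec G) f) = P0 G (Dom (Dec B) f)"
  "f \<in> Ar (Dec B) \<Longrightarrow> Cod (Dec B') (FAr (PDec G) f) = P0 G (Cod (Dec B) f)"
  using functor_cells functor_dec
  by (simp_all add: zero_cell src trg agree is_functor.ob is_functor.ar is_functor.dom is_functor.cod)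

definition cells_fun :: "('o, 'o, 'h, 'c, 'p, 'w, 'k, ('d, 'w) expr set) dblfun" where
  "cells_fun = dblfun_comp (vdisc B) (freeQ B') (cell_incl B') (vdisc_fun G)"

lemma double_functor_vdisc_fun: "double_functor (vdisc B) (vdisc B') (vdisc_fun G)"
  using pseudofunctor_axioms by (simp add: pseudofunctor_iff_double_functor)

sublocale X: freeQ_extension B "freeQ B'" cells_fun "PDec G"
proof (intro freeQ_extension.intro freeQ_extension_axioms.intro B.decorated_bicategory_axioms)
  show "double_functor (vdisc B) (freeQ B') cells_fun"
    unfolding cells_fun_def
    by (rule double_functor_dblfun_comp[OF double_functor_vdisc_fun B'.double_functor_cell_incl])
  show "is_functor (Dec B) (C0 (freeQ B')) (PDec G)"
    using functor_dec by simp
  show "FOb (F0 cells_fun) a = FOb (PDec G) a" if "a \<in> Cell0 B" for a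
    using that by (simp add: cells_fun_def dblfun_comp_simps)
qed (rule ext_dec)

lemma cells_fun_simps [simp]:
  "\<alpha> \<in> Ob (Cells B) \<Longrightarrow> FOb (F1 cells_fun) \<alpha> = FOb (PCells G) \<alpha>"
  "\<phi> \<in> Ar (Cells B) \<Longrightarrow> FAr (F1 cells_fun) \<phi> = cls B' (Cell (FAr (PCells G) \<phi>))"
  "(\<beta>, \<alpha>) \<in> hpairs B \<Longrightarrow> DComp cells_fun (\<beta>, \<alpha>) = cls B' (Cell (PComp G (\<beta>, \<alpha>)))"
  "a \<in> Cell0 B \<Longrightarrow> DUnit cells_fun a = cls B' (Cell (PUnit G a))"
  using B'.cell_isoD[OF comp_iso, of \<beta> \<alpha>] B'.cell_isoD[OF unit_iso, of a]
  by (simp_all add: cells_fun_def dblfun_comp_simps B'.cls_vcell)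

text \<open>The inclusion of 2-cells preserves inverses, and inverses are unique. So the inverses
  formed among 2-cells in \<open>mapQ\<close> represent the inverses formed among squares in
  \<open>ev\<close>.\<close>

lemma inv_cls_cell:
  assumes "cell_iso B' \<phi> \<alpha> \<beta>"
  shows "inv_ar (Cells B') \<phi> \<in> Ar (Cells B')" "Dom (Cells B') (inv_ar (Cells B') \<phi>) = \<beta>"
    "Cod (Cells B') (inv_ar (Cells B') \<phi>) = \<alpha>"
    "inv_ar (C1 (freeQ B')) (cls B' (Cell \<phi>)) = cls B' (Cell (inv_ar (Cells B') \<phi>))"
proof -
  have inv: "inverse_arrows (Cells B') \<phi> (inv_ar (Cells B') \<phi>)"
    using assms by (intro B'.Cat.inverse_arrows_inv_ar) (simp add: cell_iso_def)
  then show *: "inv_ar (Cells B') \<phi> \<in> Ar (Cells B')" "Dom (Cells B') (inv_ar (Cells B') \<phi>) = \<beta>"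
    "Cod (Cells B') (inv_ar (Cells B') \<phi>) = \<alpha>"
    using assms by (auto simp: inverse_arrows_def cell_iso_def)
  note \<phi> = B'.cell_isoD[OF assms]
  have "inverse_arrows (C1 (freeQ B')) (cls B' (Cell \<phi>)) (cls B' (Cell (inv_ar (Cells B') \<phi>)))"
    using inv * \<phi> by (simp add: inverse_arrows_def vsq_def[symmetric] vcell_def[symmetric] B'.cls_vcell)
  then show "inv_ar (C1 (freeQ B')) (cls B' (Cell \<phi>)) = cls B' (Cell (inv_ar (Cells B') \<phi>))"
    by (metis B'.Q.V1.inverse_arrows_inv_ar B'.Q.V1.inverse_arrows_unique invertible_def)
qed

text \<open>All claims need a single induction: composites of classes can be computed by
  \<open>vsq_cls\<close> and \<open>hsq_cls\<close> only once the images of the factors are known to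
  be well-formed with matching edges.\<close>

lemma mapQ_ev:
  "wf_expr B \<Phi> \<Longrightarrow> wf_expr B' (mapQ B B' G \<Phi>)
    \<and> top_edge B' (mapQ B B' G \<Phi>) = FOb (PCells G) (top_edge B \<Phi>)
    \<and> bot_edge B' (mapQ B B' G \<Phi>) = FOb (PCells G) (bot_edge B \<Phi>)
    \<and> left_edge B' (mapQ B B' G \<Phi>) = FAr (PDec G) (left_edge B \<Phi>)
    \<and> right_edge B' (mapQ B B' G \<Phi>) = FAr (PDec G) (right_edge B \<Phi>)
    \<and> X.ev \<Phi> = cls B' (mapQ B B' G \<Phi>)"
proof (induction \<Phi>)
  case (Cell \<phi>)
  then show ?case
    using X.vertical_simps(6)[of "Src B (Dom (Cells B) \<phi>)"] X.vertical_simps(6)[of "Trg B (Dom (Cells B) \<phi>)"]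
    by simp
next
  case (HId f)
  then have ob: "Dom (Dec B) f \<in> Cell0 B" "Cod (Dec B) f \<in> Cell0 B"
    by simp_all
  note u = B'.cell_isoD[OF unit_iso[OF ob(1)]] B'.cell_isoD[OF unit_iso[OF ob(2)]]
    inv_cls_cell[OF unit_iso[OF ob(1)]]
  show ?case
    using HId ob u by (simp add: X.ev.simps(2))
next
  case (VComp \<Psi> \<Phi>)
  then show ?case
    using X.vertical_simps(7) by simp
next
  case (HComp \<Psi> \<Phi>)
  then have wf: "wf_expr B \<Psi>" "wf_expr B \<Phi>" "right_edge B \<Phi> = left_edge B \<Psi>"
    by simp_all
  note e = B.wf_expr_HComp_edges[OF wf]
  have p: "(top_edge B \<Psi>, top_edge B \<Phi>) \<in> hpairs B" "(bot_edge B \<Psi>, bot_edge B \<Phi>) \<in> hpairs B"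
    using wf e by simp_all
  note c = B'.cell_isoD[OF comp_iso[OF p(1)]] B'.cell_isoD[OF comp_iso[OF p(2)]]
    inv_cls_cell[OF comp_iso[OF p(1)]]
  show ?case
    using HComp.IH wf e p c by (simp add: X.ev.simps(4))
qed

text \<open>The compatibility of \<open>mapQ\<close> with the identifications is thereby inherited
  from \<open>ev\<close>, without a separate check on expressions of \<open>B'\<close>.\<close>

lemma freeQ_map_eq_extension: "freeQ_map B B' G = X.extension"
proof -
  have "(\<lambda>X\<in>Ar (C1 (freeQ B)). cls B' (mapQ B B' G (rep X))) = (\<lambda>X\<in>Ar (C1 (freeQ B)). X.ev (rep X))"
    by (rule restrict_ext) (auto simp: mapQ_ev elim!: B.freeQ_arE)
  moreover have "FOb (PCells G) = FOb (F1 cells_fun)"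
    using ext_cells X.H.ext1 by (intro extensionalityI[of _ "Ob (Cells B)"]) (simp_all add: ext_ftor_def)
  moreover have "(\<lambda>p\<in>hpairs B. cls B' (Cell (PComp G p))) = DComp cells_fun"
    using X.H.ext_comp by (intro extensionalityI[of _ "hpairs B"]) auto
  moreover have "(\<lambda>a\<in>Cell0 B. cls B' (Cell (PUnit G a))) = DUnit cells_fun"
    using X.H.ext_unit by (intro extensionalityI[of _ "Cell0 B"]) auto
  ultimately show ?thesis
    by (simp add: freeQ_map_def X.extension_def)
qed

lemma double_functor_freeQ_map: "double_functor (freeQ B) (freeQ B') (freeQ_map B B' G)"
  unfolding freeQ_map_eq_extension by (rule X.double_functor_extension)

text \<open>Naturality of the inclusions with respect to \<open>G\<close>. Together with the functor
  on the decoration it characterises \<open>freeQ_map B B' G\<close>.\<close>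

lemma freeQ_map_cell_incl:
  "dblfun_comp (vdisc B) (freeQ B') (freeQ_map B B' G) (cell_incl B)
    = dblfun_comp (vdisc B) (freeQ B') (cell_incl B') (vdisc_fun G)"
  unfolding freeQ_map_eq_extension X.extension_cell_incl by (rule cells_fun_def)

end

text \<open>Both double functors restrict to the inclusion of \<open>B\<close> and are the identity
  on the decoration.\<close>

lemma freeQ_map_id:
  assumes "decorated_bicategory B"
  shows "freeQ_map B B (decpsfun_id B) = dblfun_id (freeQ B)"
proof -
  interpret decorated_bicategory B by fact
  interpret I: decorated_pseudofunctor B B "decpsfun_id B"
    by (rule decorated_pseudofunctor_id[OF assms])
  show ?thesis
  proof (rule double_functor_freeQ_eqI[OF assms I.double_functor_freeQ_map Q.double_functor_dblfun_id])
    show "F0 (freeQ_map B B (decpsfun_id B)) = F0 (dblfun_id (freeQ B))"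
      by (simp add: freeQ_map_def decpsfun_id_def dblfun_id_simps)
    show "dblfun_comp (vdisc B) (freeQ B) (freeQ_map B B (decpsfun_id B)) (cell_incl B)
      = dblfun_comp (vdisc B) (freeQ B) (dblfun_id (freeQ B)) (cell_incl B)"
      unfolding I.freeQ_map_cell_incl vdisc_fun_id
      by (simp add: dblfun_comp_id_left dblfun_comp_id_right double_functor_cell_incl)
  qed
qed

text \<open>The naturality squares of the inclusions for \<open>G\<close> and for \<open>H\<close>
  are pasted: both sides restrict to the inclusion of \<open>B''\<close> after the composite
  pseudofunctor.\<close>

lemma freeQ_map_comp:
  assumes G: "decorated_pseudofunctor B B' G" and H: "decorated_pseudofunctor B' B'' H"
  shows "freeQ_map B B'' (decpsfun_comp B B'' H G)
    = dblfun_comp (freeQ B) (freeQ B'') (freeQ_map B' B'' H) (freeQ_map B B' G)"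
proof -
  interpret G: decorated_pseudofunctor B B' G by fact
  interpret H: decorated_pseudofunctor B' B'' H by fact
  interpret K: decorated_pseudofunctor B B'' "decpsfun_comp B B'' H G"
    by (rule decorated_pseudofunctor_comp[OF G H])
  show ?thesis
  proof (rule double_functor_freeQ_eqI[OF G.B.decorated_bicategory_axioms K.double_functor_freeQ_map
        double_functor_dblfun_comp[OF G.double_functor_freeQ_map H.double_functor_freeQ_map]])
    show "F0 (freeQ_map B B'' (decpsfun_comp B B'' H G))
      = F0 (dblfun_comp (freeQ B) (freeQ B'') (freeQ_map B' B'' H) (freeQ_map B B' G))"
      by (simp add: freeQ_map_def decpsfun_comp_def dblfun_comp_simps)
    \<comment> \<open>The inclusion travels from \<open>B''\<close> back to \<open>B\<close> by
      alternating the naturality square of \<open>H\<close>, then that of \<open>G\<close>, with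
      reassociation of composites.\<close>
    have "dblfun_comp (vdisc B) (freeQ B'') (freeQ_map B B'' (decpsfun_comp B B'' H G)) (cell_incl B)
      = dblfun_comp (vdisc B) (freeQ B'') (cell_incl B'')
          (dblfun_comp (vdisc B) (vdisc B'') (vdisc_fun H) (vdisc_fun G))"
      unfolding K.freeQ_map_cell_incl vdisc_fun_comp ..
    also have "\<dots> = dblfun_comp (vdisc B) (freeQ B'')
        (dblfun_comp (vdisc B') (freeQ B'') (freeQ_map B' B'' H) (cell_incl B')) (vdisc_fun G)"
      unfolding H.freeQ_map_cell_incl
      by (rule dblfun_comp_assoc[OF G.double_functor_vdisc_fun H.double_functor_vdisc_fun
            H.B'.double_functor_cell_incl, symmetric])
    also have "\<dots> = dblfun_comp (vdisc B) (freeQ B'') (freeQ_map B' B'' H)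
        (dblfun_comp (vdisc B) (freeQ B') (freeQ_map B B' G) (cell_incl B))"
      unfolding G.freeQ_map_cell_incl
      by (rule dblfun_comp_assoc[OF G.double_functor_vdisc_fun G.B'.double_functor_cell_incl
            H.double_functor_freeQ_map])
    also have "\<dots> = dblfun_comp (vdisc B) (freeQ B'')
        (dblfun_comp (freeQ B) (freeQ B'') (freeQ_map B' B'' H) (freeQ_map B B' G)) (cell_incl B)"
      by (rule dblfun_comp_assoc[OF G.B.double_functor_cell_incl G.double_functor_freeQ_map
            H.double_functor_freeQ_map, symmetric])
    finally show "dblfun_comp (vdisc B) (freeQ B'') (freeQ_map B B'' (decpsfun_comp B B'' H G))
        (cell_incl B)
      = dblfun_comp (vdisc B) (freeQ B'')
        (dblfun_comp (freeQ B) (freeQ B'') (freeQ_map B' B'' H) (freeQ_map B B' G)) (cell_incl B)" .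
  qed
qed

theorem corollary4p11:
  shows "is_functor
    (bCat :: (('o, 'v, 'h, 'c) decbicat, ('o, 'v, 'h, 'c) bmor) cat)
    (gCat :: (('o, 'v, 'h, ('c, 'v) expr set) dblcat, ('o, 'v, 'h, ('c, 'v) expr set) gmor) cat)
    freeQ_functor"
  by (intro is_functor.intro is_functor_axioms.intro category_bCat category_gCat)
    (auto simp: bCat_def gCat_def freeQ_functor_def freeQ_map_id freeQ_map_comp
      decorated_bicategory.double_category_freeQ decorated_bicategory.globularly_generated_freeQ
      decorated_pseudofunctor.double_functor_freeQ_map dest: decorated_pseudofunctorD(1,2))

end
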